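(* Let $f\in\mathcal{P}_n$ and let $C$ be an origin-symmetric convex body in $\mathbb{R}^m$, $m\ge1$. If $p\in(-1,0)$ and $n/|p|\in\mathbb{N}$, then $$|Z^\diamondsuit_{p,C}(f)|\le|Z^\diamondsuit_{p,C}(f^* )|.$$ Furthermore, let $N>n$, let $\mathcal{F}=(f_{ij})_{i\in[N],j\in[m_i]}\subseteq\mathcal{P}_n$ and $\mathcal{C}=(C_1,\dots,C_N)$, where each $C_i$ is an origin-symmetric convex body in $\mathbb{R}^{m_i}$ with $m_i\ge n+1$. If $p\in[-1,0)$ and $n/|p|\in\mathbb{N}$, then $$\mathbb{E}\,|\mathcal{Z}^\diamondsuit_{p,\mathcal{C}}(\mathcal{F})|\le\mathbb{E}\,|\mathcal{Z}^\diamondsuit_{p,\mathcal{C}}(\mathcal{F}^\#)|.$$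
   Context: $\mathcal{P}_n$ is the set of measurable $f:\mathbb{R}^n\to[0,\infty)$ with $\int f=1$ and $\|f\|_\infty<\infty$. For measurable $A\subseteq\mathbb{R}^n$ of finite volume, $A^*$ is the open centered Euclidean ball with $|A^*|=|A|$; $f^*(x)=\int_0^\infty\chi_{\{f>t\}^*}(x)\,dt$. Star-shaped sets are given by radial functions $\rho(K,u)=\sup\{\lambda\ge0:\lambda u\in K\}\in[0,\infty]$ on $S^{n-1}$, with volume $|K|=\omega_n\int_{S^{n-1}}\rho(K,u)^n\,d\sigma(u)\in[0,\infty]$ ($\sigma$ normalized surface measure, $\omega_n=|B_2^n|$). $h(C,y)=\sup_{c\in C}\langle c,y\rangle$. Convention $0^q=+\infty$ for $q<0$. For $f\in\mathcal{P}_n$, $C\subseteq\mathbb{R}^m$ origin-symmetric convex body and $p\neq 0$, $Z^\diamondsuit_{p,C}(f)$ is the star-shaped set with $\rho^{-p}(Z^\diamondsuit_{p,C}(f),u)=\int_{(\mathbb{R}^n)^m}h^p(C,(\langle x_i,u\rangle)_{i=1}^m)\prod_{i=1}^mf(x_i)\,dx_1\cdots dx_m$. Empirical version: for $\mathcal{C}=(C_1,\dots,C_N)$, $C_i\subseteq\mathbb{R}^{m_i}$ origin-symmetric convex bodies, and $\mathcal{F}=(f_{ij})\subseteq\mathcal{P}_n$, let $X_{ij}$ ($i\in[N],j\in[m_i]$) be independent random vectors with densities $f_{ij}$, ${\bf X}_i^Tu=(\langle X_{ij},u\rangle)_{j=1}^{m_i}$; for $p\ne0$, $\mathcal{Z}^\diamondsuit_{p,\mathcal{C}}(\mathcal{F})$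 is the random star-shaped set with $\rho^{-p}(\mathcal{Z}^\diamondsuit_{p,\mathcal{C}}(\mathcal{F}),u)=\frac1N\sum_{i=1}^Nh^p(C_i,{\bf X}_i^Tu)$. $\mathcal{F}^\#=(f^*_{ij})$. *)

theory Defs
  imports "HOL-Analysis.Analysis"
begin

definition Pn :: "(real^'n \<Rightarrow> real) set" where
  "Pn = {f. f \<in> borel_measurable lebesgue \<and> (\<forall>x. 0 \<le> f x)
            \<and> (\<integral>\<^sup>+ x. ennreal (f x) \<partial>lebesgue) = 1
            \<and> (\<exists>M. AE x in lebesgue. f x \<le> M)}"

text \<open>A* : open centred Euclidean ball with the same volume as A (A of finite volume).\<close>
definition sym_ball :: "(real^'n) set \<Rightarrow> (real^'n) set" where
  "sym_ball A = ball 0 ((enn2real (emeasure lebesgue A) / measure lebesgue (ball (0::real^'n) 1))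
                          powr (1 / real CARD('n)))"

definition sym_rearr :: "(real^'n \<Rightarrow> real) \<Rightarrow> real^'n \<Rightarrow> real" where
  "sym_rearr f x = enn2real (\<integral>\<^sup>+ t. indicator {0<..} t * indicator (sym_ball {y. f y > t}) x \<partial>lborel)"

section \<open>Origin-symmetric convex bodies in R^m, points of R^m as nat => real vanishing from m on\<close>

definition Rsp :: "nat \<Rightarrow> (nat \<Rightarrow> real) set" where
  "Rsp m = {x. \<forall>j\<ge>m. x j = 0}"

definition sym_convex_body :: "nat \<Rightarrow> (nat \<Rightarrow> real) set \<Rightarrow> bool" where
  "sym_convex_body m C \<longleftrightarrow>
     C \<subseteq> Rsp m
   \<and> (\<forall>c\<in>C. \<forall>d\<in>C. \<forall>t::real. 0 \<le> t \<and> t \<le> 1 \<longrightarrow> (\<lambda>j. t * c j + (1 - t) * d j) \<in> C)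
   \<and> (\<exists>R. \<forall>c\<in>C. \<forall>j<m. \<bar>c j\<bar> \<le> R)
   \<and> (\<forall>s y. (\<forall>k. s k \<in> C) \<and> (\<forall>j. (\<lambda>k. s k j) \<longlonglongrightarrow> y j) \<longrightarrow> y \<in> C)
   \<and> (\<exists>x r. r > 0 \<and> (\<forall>y\<in>Rsp m. (\<Sum>j<m. (y j - x j)\<^sup>2) < r\<^sup>2 \<longrightarrow> y \<in> C))
   \<and> (\<forall>c\<in>C. (\<lambda>j. - c j) \<in> C)"

definition supp :: "nat \<Rightarrow> (nat \<Rightarrow> real) set \<Rightarrow> (nat \<Rightarrow> real) \<Rightarrow> real" where
  "supp m C y = (SUP c\<in>C. \<Sum>j<m. c j * y j)"

text \<open>h^p with the convention 0^q = +oo for q < 0 (h >= 0 here).\<close>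
definition powe :: "real \<Rightarrow> real \<Rightarrow> ennreal" where
  "powe h p = (if h = 0 \<and> p < 0 then \<infinity> else ennreal (h powr p))"

text \<open>Radial function rho from the value I = rho^q (q \<noteq> 0), with values in [0,oo].\<close>
definition rho_of :: "real \<Rightarrow> ennreal \<Rightarrow> ennreal" where
  "rho_of q I = (if I = \<infinity> then (if q > 0 then \<infinity> else 0)
                 else if I = 0 then (if q > 0 then 0 else \<infinity>)
                 else ennreal (enn2real I powr (1 / q)))"

definition star_set :: "(real^'n \<Rightarrow> ennreal) \<Rightarrow> (real^'n) set" where
  "star_set rho = {t *\<^sub>R u |u t. u \<in> sphere 0 1 \<and> 0 \<le> t \<and> ennreal t < rho u}"

definition Zdiam :: "real \<Rightarrow> nat \<Rightarrow> (nat \<Rightarrow> real) set \<Rightarrow> (real^'n \<Rightarrow> real) \<Rightarrow> (real^'n) set" where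
  "Zdiam p m C f = star_set (\<lambda>u. rho_of (- p)
      (\<integral>\<^sup>+ x. powe (supp m C (\<lambda>i. x i \<bullet> u)) p * (\<Prod>i<m. ennreal (f (x i)))
          \<partial>(PiM {..<m} (\<lambda>_. lebesgue))))"

definition ZdiamEmp :: "real \<Rightarrow> nat \<Rightarrow> (nat \<Rightarrow> nat) \<Rightarrow> (nat \<Rightarrow> (nat \<Rightarrow> real) set)
     \<Rightarrow> (nat \<times> nat \<Rightarrow> real^'n) \<Rightarrow> (real^'n) set" where
  "ZdiamEmp p N ms Cs X = star_set (\<lambda>u. rho_of (- p)
      (ennreal (1 / real N) * (\<Sum>i<N. powe (supp (ms i) (Cs i) (\<lambda>j. X (i, j) \<bullet> u)) p)))"

definition idx :: "nat \<Rightarrow> (nat \<Rightarrow> nat) \<Rightarrow> (nat \<times> nat) set" where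
  "idx N ms = {(i, j). i < N \<and> j < ms i}"

text \<open>Expected volume E |Z(F)|, the X_(i,j) being independent with densities F (i,j).\<close>
definition EvolEmp :: "real \<Rightarrow> nat \<Rightarrow> (nat \<Rightarrow> nat) \<Rightarrow> (nat \<Rightarrow> (nat \<Rightarrow> real) set)
     \<Rightarrow> (nat \<times> nat \<Rightarrow> real^'n \<Rightarrow> real) \<Rightarrow> ennreal" where
  "EvolEmp p N ms Cs F = (\<integral>\<^sup>+ X. emeasure lebesgue (ZdiamEmp p N ms Cs X)
        * (\<Prod>ij\<in>idx N ms. ennreal (F ij (X ij))) \<partial>(PiM (idx N ms) (\<lambda>_. lebesgue)))"

end

theory Submission
  imports Defs
begin

text \<open>
  Write \<open>q = -p\<close> and \<open>k = n / q\<close>. The superlevel set \<open>{G > 1}\<close> of a function \<open>G\<close> that is homogeneous of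
  degree \<open>-n\<close> has volume \<open>2 / n\<close> times the integral of \<open>G\<close> over the affine hyperplane
  \<open>e + e\<^sup>\<bottom>\<close>, for every unit vector \<open>e\<close>. Expanding the \<open>k\<close>-th power, both volumes of the theorem
  become integrals, against the product of the densities, of functions
  \<open>x \<mapsto> \<integral> \<Prod>\<^sub>l h\<^sub>l(x, e + v)\<^bsup>-q\<^esup> dv\<close>. The gauges \<open>h\<^sub>l\<close> are even and convex in \<open>v\<close> and in the
  \<open>e\<close>-coordinates of the points \<open>x\<^sub>j\<close> jointly, so by the layer-cake formula and the Prekopa--Leindler inequality the average
  of such a function over a box with centre \<open>s a\<close> decreases in \<open>s \<ge> 0\<close>. Sliding intervals towards
  the origin and merging them when they meet (Rogers, Brascamp--Lieb--Luttinger) then shows that Steiner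
  symmetrisation along \<open>e\<close> increases the integral, and by rotation invariance this holds in all directions.
  Averaging over directions yields, for bounded sets, a Steiner symmetrisation that decreases the distance to the balls
  by a quadratic amount, so the infimum of the distance over iterated symmetrisations is zero.
  Replacing \<open>h\<^sub>l\<close> by \<open>h\<^sub>l + \<epsilon> |u|\<close> keeps all kernels bounded along the way.
\<close>


section \<open>Integration over finite products\<close>

text \<open>Integrality of n / |p| is what lets a power of a sum or an integral expand into products
  of k factors, each of which carries the power -q of a single convex gauge. The hyperplane replaces
  the sphere for the sake of convexity: with x_j = t_j e + y_j and y_j, v orthogonal to e, one has
  <x_j, e + v> = t_j + <y_j, v>. For fixed y_j this is affine in (t, v) jointly, and (t, v) -> (-t,
  -v) only changes its sign; unit vectors offer no such joint linearity. The chart singles out e,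
  but the volume that it computes does not depend on e, so rotations remain available. The obstacle
  is that h^(-q) is unbounded near h = 0, whereas replacing a set by an approximating one costs the
  supremum of the kernel times the volume of the difference. The term epsilon |u| repairs this
  without harm to homogeneity, convexity, evenness or rotation invariance, and monotone convergence
  removes it at the end. No sequence of symmetrisations has to converge: a family whose distance to
  the balls is close to a positive infimum would be moved below that infimum by the next
  symmetrisation.\<close>

lemma product_sigma_finite_lborel: "product_sigma_finite (\<lambda>_. lborel)"
  by standard

lemma sigma_finite_PiM_lborel:
  "finite I \<Longrightarrow> sigma_finite_measure (PiM I (\<lambda>_. lborel :: 'a::euclidean_space measure))"
  by (rule product_sigma_finite.sigma_finite[OF product_sigma_finite_lborel])

text \<open>Induction on the index set with Fubini: every coordinate contributes one factor
  \<open>c\<close>. Reflections, scalings, rotations and the passage from completed to Borel measure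
  are instances; the last one is the reason for two measures \<open>M\<close> and
  \<open>N\<close>.\<close>

lemma nn_integral_PiM_comp:
  fixes M :: "'a measure" and N :: "'b measure" and c :: ennreal
  assumes M: "sigma_finite_measure M" and N: "sigma_finite_measure N" and J: "finite J"
    and \<phi>[measurable]: "\<phi> \<in> measurable M N"
    and c: "\<And>g. g \<in> borel_measurable N \<Longrightarrow> (\<integral>\<^sup>+ z. g (\<phi> z) \<partial>M) = c * (\<integral>\<^sup>+ z. g z \<partial>N)"
    and F: "F \<in> borel_measurable (PiM J (\<lambda>_. N))"
  shows "(\<integral>\<^sup>+ x. F (\<lambda>j\<in>J. \<phi> (x j)) \<partial>PiM J (\<lambda>_. M)) = c ^ card J * (\<integral>\<^sup>+ x. F x \<partial>PiM J (\<lambda>_. N))"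
  using J F
proof (induction J arbitrary: F)
  case empty
  interpret PM: product_sigma_finite "\<lambda>_. M" by standard (use M in \<open>auto simp: sigma_finite_measure_def\<close>)
  interpret PN: product_sigma_finite "\<lambda>_. N" by standard (use N in \<open>auto simp: sigma_finite_measure_def\<close>)
  show ?case
    using PM.emeasure_PiM[of "{}"] by (simp add: PN.nn_integral_empty restrict_def space_PiM)
next
  case (insert j J)
  interpret PM: product_sigma_finite "\<lambda>_. M" by standard (use M in \<open>auto simp: sigma_finite_measure_def\<close>)
  interpret PN: product_sigma_finite "\<lambda>_. N" by standard (use N in \<open>auto simp: sigma_finite_measure_def\<close>)
  interpret N: sigma_finite_measure N by fact
  note insert.prems[measurable] insert.hyps(1)[simp]
  have upd: "(\<lambda>i\<in>insert j J. \<phi> ((x(j := y)) i)) = (\<lambda>i\<in>J. \<phi> (x i))(j := \<phi> y)" for x y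
    using insert.hyps by (auto simp: fun_eq_iff)
  have [measurable]: "(\<lambda>x. \<integral>\<^sup>+ y. F (x(j := y)) \<partial>N) \<in> borel_measurable (PiM J (\<lambda>_. N))"
    by measurable
  have "(\<integral>\<^sup>+ x. F (\<lambda>i\<in>insert j J. \<phi> (x i)) \<partial>PiM (insert j J) (\<lambda>_. M))
      = (\<integral>\<^sup>+ x. (\<integral>\<^sup>+ y. F ((\<lambda>i\<in>J. \<phi> (x i))(j := \<phi> y)) \<partial>M) \<partial>PiM J (\<lambda>_. M))"
    by (subst PM.product_nn_integral_insert) (use insert.hyps in \<open>auto simp only: upd, measurable\<close>)
  also have "\<dots> = (\<integral>\<^sup>+ x. c * (\<integral>\<^sup>+ y. F ((\<lambda>i\<in>J. \<phi> (x i))(j := y)) \<partial>N) \<partial>PiM J (\<lambda>_. M))"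
  proof (rule nn_integral_cong)
    fix x assume x: "x \<in> space (PiM J (\<lambda>_. M))"
    then have "(\<lambda>i\<in>J. \<phi> (x i)) \<in> space (PiM J (\<lambda>_. N))"
      using measurable_space[OF \<phi>] by (auto simp: space_PiM PiE_iff)
    then have "(\<lambda>y. F ((\<lambda>i\<in>J. \<phi> (x i))(j := y))) \<in> borel_measurable N"
      using measurable_comp[OF measurable_component_update insert.prems] insert.hyps(2)
      unfolding comp_def by blast
    then show "(\<integral>\<^sup>+ y. F ((\<lambda>i\<in>J. \<phi> (x i))(j := \<phi> y)) \<partial>M) = c * (\<integral>\<^sup>+ y. F ((\<lambda>i\<in>J. \<phi> (x i))(j := y)) \<partial>N)"
      by (rule c)
  qed
  also have "\<dots> = c * (\<integral>\<^sup>+ x. (\<integral>\<^sup>+ y. F ((\<lambda>i\<in>J. \<phi> (x i))(j := y)) \<partial>N) \<partial>PiM J (\<lambda>_. M))"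
    by (rule nn_integral_cmult) measurable
  also have "\<dots> = c * (c ^ card J * (\<integral>\<^sup>+ x. (\<integral>\<^sup>+ y. F (x(j := y)) \<partial>N) \<partial>PiM J (\<lambda>_. N)))"
    by (subst insert.IH) auto
  also have "\<dots> = c ^ card (insert j J) * (\<integral>\<^sup>+ x. F x \<partial>PiM (insert j J) (\<lambda>_. N))"
    using insert.hyps by (subst PN.product_nn_integral_insert) (auto simp: mult_ac)
  finally show ?case .
qed

text \<open>An exceptional null set in one coordinate is contained in a cylinder whose measure is a
  product with a zero factor. \<open>H\<close> is arbitrary because the lemma is applied to volumes
  before anything is known about their measurability.\<close>

lemma nn_integral_PiM_weight_cong_AE:
  fixes H :: "('i \<Rightarrow> 'a) \<Rightarrow> ennreal"
  assumes M: "sigma_finite_measure M" and J: "finite J"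
    and ae: "\<And>j. j \<in> J \<Longrightarrow> AE z in M. w j z = w' j z"
  shows "(\<integral>\<^sup>+ x. H x * (\<Prod>j\<in>J. w j (x j)) \<partial>PiM J (\<lambda>_. M)) = (\<integral>\<^sup>+ x. H x * (\<Prod>j\<in>J. w' j (x j)) \<partial>PiM J (\<lambda>_. M))"
proof -
  interpret PM: product_sigma_finite "\<lambda>_. M" by standard (use M in \<open>auto simp: sigma_finite_measure_def\<close>)
  have "AE x in PiM J (\<lambda>_. M). w j (x j) = w' j (x j)" if j: "j \<in> J" for j
  proof -
    obtain Z where Z: "Z \<in> sets M" "emeasure M Z = 0" "{z\<in>space M. w j z \<noteq> w' j z} \<subseteq> Z"
      using ae[OF j] by (auto elim: AE_E)
    let ?A = "\<lambda>i. if i = j then Z else space M"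
    have "emeasure (PiM J (\<lambda>_. M)) (PiE J ?A) = (\<Prod>i\<in>J. emeasure M (?A i))"
      using Z J by (intro PM.emeasure_PiM) auto
    also have "\<dots> = 0"
      using Z j J by (auto simp: prod_zero_iff)
    finally have "PiE J ?A \<in> null_sets (PiM J (\<lambda>_. M))"
      using Z J by (auto intro!: null_setsI sets_PiM_I_finite)
    then show ?thesis
      by (rule AE_I') (use Z j in \<open>force simp: space_PiM PiE_iff\<close>)
  qed
  then have "AE x in PiM J (\<lambda>_. M). \<forall>j\<in>J. w j (x j) = w' j (x j)"
    by (intro AE_finite_allI J)
  then show ?thesis
    by (intro nn_integral_cong_AE) (auto elim!: eventually_mono intro!: prod.cong arg_cong2[where f="(*)"])
qed

text \<open>A product of indicators of sets \<open>A j\<close> exceeds the product for sets \<open>B j\<close> only where some coordinate lies in \<open>A j - B j\<close>.\<close>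
lemma nn_integral_PiM_indicator_perturb:
  fixes W :: "('i \<Rightarrow> 'a) \<Rightarrow> ennreal"
  assumes M: "sigma_finite_measure M" and J: "finite J"
    and W[measurable]: "W \<in> borel_measurable (PiM J (\<lambda>_. M))" and C: "\<And>x. x \<in> space (PiM J (\<lambda>_. M)) \<Longrightarrow> W x \<le> C"
    and A[measurable]: "\<And>j. j \<in> J \<Longrightarrow> A j \<in> sets M" and B[measurable]: "\<And>j. j \<in> J \<Longrightarrow> B j \<in> sets M"
    and V: "1 \<le> V" "\<And>j. j \<in> J \<Longrightarrow> emeasure M (A j) \<le> V"
    and d: "\<And>j. j \<in> J \<Longrightarrow> emeasure M (A j - B j) \<le> d"
  shows "(\<integral>\<^sup>+ x. W x * (\<Prod>j\<in>J. indicator (A j) (x j)) \<partial>PiM J (\<lambda>_. M))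
      \<le> (\<integral>\<^sup>+ x. W x * (\<Prod>j\<in>J. indicator (B j) (x j)) \<partial>PiM J (\<lambda>_. M)) + C * of_nat (card J) * V ^ card J * d"
proof -
  interpret PM: product_sigma_finite "\<lambda>_. M" by standard (use M in \<open>auto simp: sigma_finite_measure_def\<close>)
  let ?P = "PiM J (\<lambda>_. M)"
  let ?E = "\<lambda>j i. if i = j then A j - B j else A i"
  have mE: "?E j i \<in> sets M" if "j \<in> J" "i \<in> J" for i j using A B that by auto
  have pt: "W x * (\<Prod>j\<in>J. indicator (A j) (x j)) \<le> W x * (\<Prod>j\<in>J. indicator (B j) (x j)) + (\<Sum>j\<in>J. C * (\<Prod>i\<in>J. indicator (?E j i) (x i)))"
    if x: "x \<in> space ?P" for x
  proof (cases "\<forall>j\<in>J. x j \<in> A j")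
    case False
    then have "(\<Prod>j\<in>J. indicator (A j) (x j)) = (0::ennreal)" using J by (force simp: indicator_def)
    then show ?thesis by (simp only: mult_zero_right zero_le)
  next
    case T: True
    show ?thesis
    proof (cases "\<forall>j\<in>J. x j \<in> B j")
      case True
      with T show ?thesis by (simp add: add_increasing2)
    next
      case False
      then obtain j where j: "j \<in> J" "x j \<notin> B j" by auto
      have "(\<Prod>j\<in>J. indicator (A j) (x j)) = (1::ennreal)" "(\<Prod>i\<in>J. indicator (?E j i) (x i)) = (1::ennreal)"
        using T j by (auto intro!: prod.neutral)
      then have "W x * (\<Prod>j\<in>J. indicator (A j) (x j)) \<le> C * (\<Prod>i\<in>J. indicator (?E j i) (x i))"
        using C[OF x] by simp
      also have "\<dots> \<le> (\<Sum>j\<in>J. C * (\<Prod>i\<in>J. indicator (?E j i) (x i)))"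
        using j J by (intro member_le_sum) auto
      finally show ?thesis by (simp add: add_increasing)
    qed
  qed
  have ae[measurable]: "(\<lambda>x. (\<Prod>i\<in>J. indicator (?E j i) (x i)) :: ennreal) \<in> borel_measurable ?P" if "j \<in> J" for j
    using mE that by (intro borel_measurable_prod_ennreal) (auto intro!: measurable_compose[OF measurable_component_singleton] borel_measurable_indicator)
  have [measurable]: "(\<lambda>x. (\<Prod>i\<in>J. indicator (B i) (x i)) :: ennreal) \<in> borel_measurable ?P"
    using B by (intro borel_measurable_prod_ennreal) (auto intro!: measurable_compose[OF measurable_component_singleton] borel_measurable_indicator)
  have E: "(\<integral>\<^sup>+ x. (\<Prod>i\<in>J. indicator (?E j i) (x i)) \<partial>?P) \<le> V ^ card J * d" if j: "j \<in> J" for j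
  proof -
    have "(\<integral>\<^sup>+ x. (\<Prod>i\<in>J. indicator (?E j i) (x i)) \<partial>?P) = (\<Prod>i\<in>J. emeasure M (?E j i))"
      using mE j J by (subst PM.product_nn_integral_prod) auto
    also have "\<dots> = emeasure M (A j - B j) * (\<Prod>i\<in>J-{j}. emeasure M (A i))"
      using j J by (simp add: prod.remove[of J j])
    also have "\<dots> \<le> d * (\<Prod>i\<in>J-{j}. V)"
      using j by (intro mult_mono d prod_mono_ennreal) (auto intro: V)
    \<comment> \<open>Since \<open>1 \<le> V\<close>, the exponent \<open>card J - 1\<close> may be
      raised to \<open>card J\<close>.\<close>
    also have "\<dots> \<le> d * V ^ card J"
      using J j V(1) by (intro mult_left_mono) (auto intro!: power_increasing card_mono)
    finally show ?thesis by (simp add: mult_ac)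
  qed
  have "(\<integral>\<^sup>+ x. W x * (\<Prod>j\<in>J. indicator (A j) (x j)) \<partial>?P)
      \<le> (\<integral>\<^sup>+ x. W x * (\<Prod>j\<in>J. indicator (B j) (x j)) + (\<Sum>j\<in>J. C * (\<Prod>i\<in>J. indicator (?E j i) (x i))) \<partial>?P)"
    by (rule nn_integral_mono) (rule pt)
  also have "\<dots> = (\<integral>\<^sup>+ x. W x * (\<Prod>j\<in>J. indicator (B j) (x j)) \<partial>?P) + (\<Sum>j\<in>J. C * (\<integral>\<^sup>+ x. (\<Prod>i\<in>J. indicator (?E j i) (x i)) \<partial>?P))"
    by (subst nn_integral_add) (auto simp: nn_integral_sum nn_integral_cmult intro!: borel_measurable_sum)
  also have "(\<Sum>j\<in>J. C * (\<integral>\<^sup>+ x. (\<Prod>i\<in>J. indicator (?E j i) (x i)) \<partial>?P)) \<le> (\<Sum>j\<in>J. C * (V ^ card J * d))"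
    by (intro sum_mono mult_left_mono E) auto
  also have "\<dots> = C * of_nat (card J) * V ^ card J * d" by (simp add: mult_ac)
  finally show ?thesis by (simp add: add_left_mono)
qed

lemma nn_integral_layer_cake_const:
  fixes c :: ennreal
  shows "(\<integral>\<^sup>+ s. indicator {s. 0 < s \<and> ennreal s < c} s \<partial>lborel) = c"
proof (cases c)
  case (real r)
  then have "{s. 0 < s \<and> ennreal s < c} = {0<..<r}" by (auto simp: ennreal_less_iff)
  then show ?thesis using real by simp
next
  case top
  then have "{s. 0 < s \<and> ennreal s < c} = {0<..}" by auto
  moreover have "emeasure lborel {0::real<..} = \<infinity>"
  proof (rule ccontr)
    assume "emeasure lborel {0::real<..} \<noteq> \<infinity>"
    then obtain r where r: "0 \<le> r" "emeasure lborel {0::real<..} = ennreal r" by (cases "emeasure lborel {0::real<..}") auto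
    have "emeasure lborel {0::real<..<r+1} \<le> emeasure lborel {0::real<..}" by (intro emeasure_mono) auto
    then show False using r by (simp add: ennreal_le_iff)
  qed
  ultimately show ?thesis using top by simp
qed

section \<open>The Prekopa--Leindler inequality\<close>

lemma emeasure_lborel_affine_image:
  fixes S :: "real set"
  assumes S: "S \<in> sets borel" and c: "c \<noteq> 0"
  shows "(\<lambda>x. t + c * x) ` S \<in> sets borel"
    and "emeasure lborel ((\<lambda>x. t + c * x) ` S) = ennreal \<bar>c\<bar> * emeasure lborel S"
proof -
  have eq: "(\<lambda>x. t + c * x) ` S = (\<lambda>y. (y - t) / c) -` S"
  proof (intro set_eqI iffI)
    fix y assume "y \<in> (\<lambda>y. (y - t) / c) -` S"
    then show "y \<in> (\<lambda>x. t + c * x) ` S"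
      using c by (intro image_eqI[of _ _ "(y - t) / c"]) auto
  qed (use c in auto)
  have "(\<lambda>y. (y - t) / c) \<in> borel_measurable borel" by measurable
  from measurable_sets[OF this S] show im: "(\<lambda>x. t + c * x) ` S \<in> sets borel"
    unfolding eq by simp
  have "emeasure lborel ((\<lambda>x. t + c * x) ` S) = (\<integral>\<^sup>+ x. indicator ((\<lambda>x. t + c * x) ` S) x \<partial>lborel)"
    using im by simp
  also have "\<dots> = ennreal \<bar>c\<bar> * (\<integral>\<^sup>+ x. indicator ((\<lambda>x. t + c * x) ` S) (t + c * x) \<partial>lborel)"
    using im c by (subst nn_integral_real_affine[where c=c and t=t]) auto
  also have "(\<lambda>x. indicator ((\<lambda>x. t + c * x) ` S) (t + c * x)) = (indicator S :: real \<Rightarrow> ennreal)"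
    using c by (auto simp: indicator_def fun_eq_iff)
  finally show "emeasure lborel ((\<lambda>x. t + c * x) ` S) = ennreal \<bar>c\<bar> * emeasure lborel S"
    using S by simp
qed

text \<open>Inner regularity: closed sets approximate from inside, and cutting with large closed
  balls first makes them compact. The index set contains nonempty sets only, because the
  Brunn--Minkowski inequality to which this is applied fails for an empty summand.\<close>

lemma emeasure_lborel_eq_SUP_compact:
  fixes A :: "real set"
  assumes A: "A \<in> sets borel" and ne: "A \<noteq> {}"
  shows "emeasure lborel A = (SUP K\<in>{K. compact K \<and> K \<subseteq> A \<and> K \<noteq> {}}. emeasure lborel K)"
proof (rule antisym)
  show "(SUP K\<in>{K. compact K \<and> K \<subseteq> A \<and> K \<noteq> {}}. emeasure lborel K) \<le> emeasure lborel A"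
    using A by (intro SUP_least emeasure_mono) auto
  show "emeasure lborel A \<le> (SUP K\<in>{K. compact K \<and> K \<subseteq> A \<and> K \<noteq> {}}. emeasure lborel K)"
  proof (rule dense_le)
    fix c assume c: "c < emeasure lborel A"
    have [measurable]: "A \<in> sets borel" by fact
    have "emeasure lborel A = (SUP m. emeasure lborel (A \<inter> cball 0 (real m)))"
    proof (subst SUP_emeasure_incseq)
      show "incseq (\<lambda>m. A \<inter> cball 0 (real m))" by (auto simp: incseq_def)
      have "(\<Union>m. A \<inter> cball 0 (real m)) = A"
        by (auto intro: real_arch_simple)
      then show "emeasure lborel A = emeasure lborel (\<Union>m. A \<inter> cball 0 (real m))" by simp
    qed auto
    with c obtain m where m: "c < emeasure lborel (A \<inter> cball 0 (real m))"
      by (auto simp: less_SUP_iff)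
    let ?B = "A \<inter> cball 0 (real m)"
    have "emeasure lborel ?B \<le> emeasure lborel (cball (0::real) (real m))" by (intro emeasure_mono) auto
    also have "\<dots> < \<infinity>" using emeasure_bounded_finite[OF bounded_cball] by blast
    finally have fin: "emeasure lborel ?B < \<infinity>" .
    \<comment> \<open>\<open>e\<close> is the gap between \<open>c\<close> and the measure of
      \<open>?B\<close>; a closed set that misses less than \<open>e\<close> of \<open>?B\<close>
      still has measure above \<open>c\<close>.\<close>
    define e where "e = enn2real (emeasure lborel ?B - c)"
    have e: "0 < e" "ennreal e = emeasure lborel ?B - c"
      using m fin by (auto simp: e_def enn2real_positive_iff diff_gr0_ennreal less_top ennreal_enn2real_if intro: le_less_trans[OF diff_le_self_ennreal])
    obtain T where T: "closed T" "T \<subseteq> ?B" "emeasure lebesgue (?B - T) < ennreal e"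
      using sets_lebesgue_inner_closed[of ?B e] e A by (metis sets.Int sets_completionI_sets sets_lborel borel_closed closed_cball)
    have "compact T" using T by (metis bounded_cball bounded_subset compact_eq_bounded_closed inf.cobounded2)
    have [measurable]: "T \<in> sets borel" using T by auto
    have "emeasure lborel ?B = emeasure lborel (T \<union> (?B - T))"
      using T by (intro arg_cong[where f="emeasure lborel"]) auto
    also have "\<dots> = emeasure lborel T + emeasure lborel (?B - T)"
      by (subst plus_emeasure) auto
    finally have s: "emeasure lborel ?B = emeasure lborel T + emeasure lborel (?B - T)" .
    have "c < emeasure lborel T"
    proof (rule ccontr)
      assume "\<not> c < emeasure lborel T"
      then have "emeasure lborel ?B \<le> c + emeasure lborel (?B - T)"
        unfolding s by (intro add_right_mono) auto
      also have "\<dots> < c + ennreal e"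
        using T m fin by (subst ennreal_add_left_cancel_less) auto
      also have "\<dots> = emeasure lborel ?B"
        using e m by (simp add: add_diff_inverse_ennreal less_imp_le)
      finally show False by simp
    qed
    moreover have "T \<noteq> {}" using calculation by auto
    ultimately show "c \<le> (SUP K\<in>{K. compact K \<and> K \<subseteq> A \<and> K \<noteq> {}}. emeasure lborel K)"
      using \<open>compact T\<close> T by (intro SUP_upper2[of T]) auto
  qed
qed

text \<open>Let \<open>a\<close> be the maximum of \<open>A\<close> and \<open>b\<close> the minimum
  of \<open>B\<close>. The copies l b + (1 - l) A and (1 - l) a + l B both lie in \<open>C\<close>,
  the first one to the left and the second one to the right of the point (1 - l) a + l b, so they
  share at most this point and their measures add up.\<close>

lemma emeasure_sumset_ge_compact:
  fixes A B C :: "real set"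
  assumes A: "compact A" "A \<noteq> {}" and B: "compact B" "B \<noteq> {}" and C: "C \<in> sets borel"
    and l: "0 < l" "l < 1"
    and sub: "\<And>a b. a \<in> A \<Longrightarrow> b \<in> B \<Longrightarrow> (1 - l) * a + l * b \<in> C"
  shows "ennreal (1 - l) * emeasure lborel A + ennreal l * emeasure lborel B \<le> emeasure lborel C"
proof -
  obtain a where a: "a \<in> A" "\<And>x. x \<in> A \<Longrightarrow> x \<le> a" using compact_attains_sup[OF A] by auto
  obtain b where b: "b \<in> B" "\<And>x. x \<in> B \<Longrightarrow> b \<le> x" using compact_attains_inf[OF B] by auto
  let ?z = "(1 - l) * a + l * b"
  let ?A = "(\<lambda>x. l * b + (1 - l) * x) ` A" and ?B = "(\<lambda>x. (1 - l) * a + l * x) ` B"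
  have mA: "A \<in> sets borel" "B \<in> sets borel" using A B by (auto intro: borel_closed compact_imp_closed)
  note [measurable] = emeasure_lborel_affine_image(1)[OF mA(1), of "1 - l" "l * b"] emeasure_lborel_affine_image(1)[OF mA(2), of l "(1 - l) * a"]
  have m: "?A \<in> sets borel" "?B \<in> sets borel" using l emeasure_lborel_affine_image(1) mA by auto
  have "?A \<inter> (?B - {?z}) = {}"
  proof (auto, goal_cases)
    case (1 x y)
    have "(1 - l) * x \<le> (1 - l) * a" "l * b \<le> l * y" using l a b 1 by auto
    then have "l * y = l * b" using 1 by linarith
    then show ?case using 1 l by auto
  qed
  have "ennreal (1 - l) * emeasure lborel A + ennreal l * emeasure lborel B = emeasure lborel ?A + emeasure lborel ?B"
    using l mA by (simp add: emeasure_lborel_affine_image(2))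
  also have "emeasure lborel ?B = emeasure lborel (?B - {?z})"
    using m by (intro emeasure_Diff_null_set[symmetric]) auto
  also have "emeasure lborel ?A + emeasure lborel (?B - {?z}) = emeasure lborel (?A \<union> (?B - {?z}))"
    using m \<open>?A \<inter> (?B - {?z}) = {}\<close> by (intro plus_emeasure) auto
  also have "\<dots> \<le> emeasure lborel C"
    using C sub a b by (intro emeasure_mono) (auto simp: add.commute)
  finally show ?thesis .
qed

lemma emeasure_sumset_ge:
  fixes A B C :: "real set"
  assumes A: "A \<in> sets borel" "A \<noteq> {}" and B: "B \<in> sets borel" "B \<noteq> {}" and C: "C \<in> sets borel"
    and l: "0 < l" "l < 1"
    and sub: "\<And>a b. a \<in> A \<Longrightarrow> b \<in> B \<Longrightarrow> (1 - l) * a + l * b \<in> C"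
  shows "ennreal (1 - l) * emeasure lborel A + ennreal l * emeasure lborel B \<le> emeasure lborel C"
proof -
  let ?K = "\<lambda>A. {K. compact K \<and> K \<subseteq> A \<and> K \<noteq> ({}::real set)}"
  have ne: "?K A \<noteq> {}" "?K B \<noteq> {}"
    using A B by (auto intro: exI[of _ "{x}" for x])
  have "ennreal (1 - l) * emeasure lborel A + ennreal l * emeasure lborel B
     = (SUP K\<in>?K A. ennreal (1 - l) * emeasure lborel K + ennreal l * emeasure lborel B)"
    using ne by (subst emeasure_lborel_eq_SUP_compact[OF A], subst SUP_mult_left_ennreal) (simp add: ennreal_SUP_add_left[symmetric])
  also have "\<dots> \<le> emeasure lborel C"
  proof (rule SUP_least)
    fix K assume K: "K \<in> ?K A"
    have "ennreal (1 - l) * emeasure lborel K + ennreal l * emeasure lborel B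
       = (SUP L\<in>?K B. ennreal (1 - l) * emeasure lborel K + ennreal l * emeasure lborel L)"
      using ne by (subst emeasure_lborel_eq_SUP_compact[OF B], subst SUP_mult_left_ennreal) (simp add: ennreal_SUP_add_right[symmetric])
    also have "\<dots> \<le> emeasure lborel C"
    proof (rule SUP_least)
      fix L assume "L \<in> ?K B"
      then show "ennreal (1 - l) * emeasure lborel K + ennreal l * emeasure lborel L \<le> emeasure lborel C"
        using K C l sub by (intro emeasure_sumset_ge_compact) auto
    qed
    finally show "ennreal (1 - l) * emeasure lborel K + ennreal l * emeasure lborel B \<le> emeasure lborel C" .
  qed
  finally show ?thesis .
qed

section \<open>Layer-cake integration and the inequality itself\<close>

lemma nn_integral_eq_layer_cake:
  fixes f :: "'a \<Rightarrow> ennreal"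
  assumes M: "sigma_finite_measure M" and f[measurable]: "f \<in> borel_measurable M"
  shows "(\<integral>\<^sup>+ x. f x \<partial>M) = (\<integral>\<^sup>+ s. indicator {0<..} s * emeasure M {x\<in>space M. ennreal s < f x} \<partial>lborel)"
proof -
  interpret M: sigma_finite_measure M by fact
  interpret P: pair_sigma_finite M lborel by standard
  have "(\<integral>\<^sup>+ x. f x \<partial>M) = (\<integral>\<^sup>+ x. (\<integral>\<^sup>+ s. indicator {s. 0 < s \<and> ennreal s < f x} s \<partial>lborel) \<partial>M)"
    by (simp only: nn_integral_layer_cake_const)
  also have "\<dots> = (\<integral>\<^sup>+ s. (\<integral>\<^sup>+ x. indicator {s. 0 < s \<and> ennreal s < f x} s \<partial>M) \<partial>lborel)"
    by (rule P.Fubini'[symmetric]) measurable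
  also have "\<dots> = (\<integral>\<^sup>+ s. indicator {0<..} s * (\<integral>\<^sup>+ x. indicator {x\<in>space M. ennreal s < f x} x \<partial>M) \<partial>lborel)"
  proof (rule nn_integral_cong)
    fix s :: real
    have "(\<integral>\<^sup>+ x. indicator {s. 0 < s \<and> ennreal s < f x} s \<partial>M) = (\<integral>\<^sup>+ x. indicator {0<..} s * indicator {x\<in>space M. ennreal s < f x} x \<partial>M)"
      by (intro nn_integral_cong) (auto simp: indicator_def)
    also have "\<dots> = indicator {0<..} s * (\<integral>\<^sup>+ x. indicator {x\<in>space M. ennreal s < f x} x \<partial>M)"
      by (rule nn_integral_cmult) measurable
    finally show "(\<integral>\<^sup>+ x. indicator {s. 0 < s \<and> ennreal s < f x} s \<partial>M) = indicator {0<..} s * (\<integral>\<^sup>+ x. indicator {x\<in>space M. ennreal s < f x} x \<partial>M)" .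
  qed
  also have "\<dots> = (\<integral>\<^sup>+ s. indicator {0<..} s * emeasure M {x\<in>space M. ennreal s < f x} \<partial>lborel)"
    by (intro nn_integral_cong, subst nn_integral_indicator) auto
  finally show ?thesis .
qed

text \<open>The scaling brings functions with different suprema to the same range of levels (0,
  1).\<close>

lemma nn_integral_eq_layer_cake_scaled:
  fixes f :: "'a \<Rightarrow> ennreal"
  assumes M: "sigma_finite_measure M" and f[measurable]: "f \<in> borel_measurable M" and c: "0 < c"
  shows "(\<integral>\<^sup>+ x. f x \<partial>M) = ennreal c * (\<integral>\<^sup>+ s. indicator {0<..} s * emeasure M {x\<in>space M. ennreal (c * s) < f x} \<partial>lborel)"
proof -
  interpret M: sigma_finite_measure M by fact
  have "(\<integral>\<^sup>+ x. f x \<partial>M) = ennreal c * (\<integral>\<^sup>+ s. indicator {0<..} (0 + c * s) * emeasure M {x\<in>space M. ennreal (0 + c * s) < f x} \<partial>lborel)"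
    using c by (subst nn_integral_eq_layer_cake[OF M f], subst nn_integral_real_affine[where c=c and t=0]) auto
  also have "(\<lambda>s. indicator {0<..} (0 + c * s)) = (indicator {0<..} :: real \<Rightarrow> ennreal)"
    using c by (auto simp: indicator_def fun_eq_iff zero_less_mult_iff)
  finally show ?thesis by simp
qed

text \<open>The condition f^(1-l) g^l <= h is phrased with exponentials strictly below the values,
  which avoids powers of 0 and of infinity. After division of \<open>f\<close> and \<open>g\<close>
  by their suprema \<open>exp c\<close> and \<open>exp d\<close>, the superlevel sets at every level
  in (0, 1) are nonempty, Brunn--Minkowski applies to them, and the weighted arithmetic-geometric
  mean inequality turns the resulting sum into a product.\<close>

lemma prekopa_leindler_real_bounded:
  fixes f g h :: "real \<Rightarrow> ennreal"
  assumes f[measurable]: "f \<in> borel_measurable borel" and g[measurable]: "g \<in> borel_measurable borel"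
    and h[measurable]: "h \<in> borel_measurable borel" and l: "0 < l" "l < 1"
    and fgh: "\<And>x y a b. exp a < f x \<Longrightarrow> exp b < g y \<Longrightarrow> exp ((1 - l) * a + l * b) \<le> h ((1 - l) * x + l * y)"
    and bf: "\<And>x. f x \<le> ennreal B" and bg: "\<And>x. g x \<le> ennreal B"
    and F: "exp a < (\<integral>\<^sup>+ x. f x \<partial>lborel)" and G: "exp b < (\<integral>\<^sup>+ x. g x \<partial>lborel)"
  shows "exp ((1 - l) * a + l * b) \<le> (\<integral>\<^sup>+ x. h x \<partial>lborel)"
proof -
  \<comment> \<open>\<open>exp c\<close> is the supremum of \<open>u\<close>, finite by the bound
    \<open>B\<close> and positive because the integral is positive.\<close>
  have sup: "\<exists>c. (\<forall>x. u x \<le> ennreal (exp c)) \<and> (\<forall>s. 0 < s \<longrightarrow> s < 1 \<longrightarrow> (\<exists>x. ennreal (exp c * s) < u x))"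
    if bu: "\<And>x. u x \<le> ennreal B" and U: "exp a < (\<integral>\<^sup>+ x. u x \<partial>lborel)" for u :: "real \<Rightarrow> ennreal" and a
  proof -
    let ?S = "SUP x. u x"
    have "?S \<le> ennreal B" by (intro SUP_least bu)
    then have fin: "?S < \<infinity>" using le_less_trans[OF _ ennreal_less_top[of B]] by (simp add: top.not_eq_extremum)
    have "?S \<noteq> 0"
    proof
      assume "?S = 0"
      then have "u = (\<lambda>_. 0)" by (auto simp: fun_eq_iff SUP_eq_iff bot_ennreal[symmetric])
      then show False using U by simp
    qed
    then obtain r where r: "?S = ennreal r" "0 < r" using fin by (cases ?S) (auto simp: less_le)
    show ?thesis
    proof (rule exI[of _ "ln r"], intro conjI allI impI)
      show "u x \<le> ennreal (exp (ln r))" for x using SUP_upper[of x UNIV u] r by auto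
      fix s :: real assume "0 < s" "s < 1"
      then have "ennreal (exp (ln r) * s) < ?S" using r by (auto simp: ennreal_less_iff)
      then show "\<exists>x. ennreal (exp (ln r) * s) < u x" by (auto simp: less_SUP_iff)
    qed
  qed
  obtain c where c: "\<And>x. f x \<le> ennreal (exp c)" "\<And>s. 0 < s \<Longrightarrow> s < 1 \<Longrightarrow> (\<exists>x. ennreal (exp c * s) < f x)"
    using sup[OF bf F] by auto
  obtain d where d: "\<And>x. g x \<le> ennreal (exp d)" "\<And>s. 0 < s \<Longrightarrow> s < 1 \<Longrightarrow> (\<exists>x. ennreal (exp d * s) < g x)"
    using sup[OF bg G] by auto
  define E where "E = exp ((1 - l) * c + l * d)"
  let ?D = "\<lambda>u c s. indicator {0<..} s * emeasure lborel {x\<in>space lborel. ennreal (c * s) < u x}"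
  have key: "ennreal (1 - l) * ?D f (exp c) s + ennreal l * ?D g (exp d) s \<le> ?D h E s" for s
  proof (cases "0 < s \<and> s < 1")
    case False
    then consider "s \<le> 0" | "1 \<le> s" by linarith
    then show ?thesis
    proof cases
      case 2
      have "ennreal (exp c) \<le> ennreal (exp c * s)" "ennreal (exp d) \<le> ennreal (exp d * s)"
        using 2 by (auto intro!: ennreal_leI)
      then have "{x. ennreal (exp c * s) < f x} = {}" "{x. ennreal (exp d * s) < g x} = {}"
        using c(1) d(1) by (auto simp: not_less intro: order_trans)
      then show ?thesis by simp
    qed simp
  next
    case s: True
    have step: "ennreal (E * t) \<le> h ((1 - l) * x + l * y)" if "0 < t" "ennreal (exp c * t) < f x" "ennreal (exp d * t) < g y" for x y t
    proof -
      have "exp (c + ln t) < f x" "exp (d + ln t) < g y" using that by (auto simp: exp_add)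
      from fgh[OF this] have "exp ((1 - l) * (c + ln t) + l * (d + ln t)) \<le> h ((1 - l) * x + l * y)" .
      also have "(1 - l) * (c + ln t) + l * (d + ln t) = ((1 - l) * c + l * d) + ln t" by (simp add: algebra_simps)
      finally show ?thesis using that by (simp add: exp_add E_def)
    qed
    \<comment> \<open>\<open>fgh\<close> concludes with a weak inequality, but the superlevel set of
      \<open>h\<close> asks for a strict one. Raising the level slightly before using
      \<open>fgh\<close> supplies the strictness.\<close>
    have gap: "\<exists>t>s. ennreal (e * t) < v" if v: "ennreal (e * s) < v" and "0 < e" for e v
    proof -
      obtain w where w: "ennreal (e * s) < ennreal w" "ennreal w < v" "0 \<le> w"
        using dense[OF v] by (metis ennreal_cases less_top order.strict_trans)
      then have "e * s < w" using s that by (simp add: ennreal_less_iff)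
      then show ?thesis using that w by (intro exI[of _ "w / e"]) (auto simp: field_simps)
    qed
    have "ennreal (1 - l) * emeasure lborel {x. ennreal (exp c * s) < f x} + ennreal l * emeasure lborel {x. ennreal (exp d * s) < g x}
        \<le> emeasure lborel {x. ennreal (E * s) < h x}"
    proof (rule emeasure_sumset_ge)
      fix x y assume x: "x \<in> {x. ennreal (exp c * s) < f x}" and y: "y \<in> {x. ennreal (exp d * s) < g x}"
      obtain t where t: "t > s" "ennreal (exp c * t) < f x" using gap[of "exp c" "f x"] x by auto
      obtain t' where t': "t' > s" "ennreal (exp d * t') < g y" using gap[of "exp d" "g y"] y by auto
      define m where "m = min t t'"
      have m: "m > s" "ennreal (exp c * m) \<le> ennreal (exp c * t)" "ennreal (exp d * m) \<le> ennreal (exp d * t')"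
        using t t' by (auto simp: m_def intro!: ennreal_leI)
      have "ennreal (E * s) < ennreal (E * m)" using m s by (auto simp: ennreal_less_iff E_def)
      also have "\<dots> \<le> h ((1 - l) * x + l * y)"
        using m s t t' by (intro step le_less_trans[OF m(2) t(2)] le_less_trans[OF m(3) t'(2)]) auto
      finally show "(1 - l) * x + l * y \<in> {x. ennreal (E * s) < h x}" by simp
    qed (use l c(2) d(2) s in auto)
    then show ?thesis using s by simp
  qed
  have [measurable]: "(\<lambda>s. ?D u k s) \<in> borel_measurable lborel" if [measurable]: "u \<in> borel_measurable borel" for u k
    by measurable
  have "ennreal (1 - l) * ennreal (exp (a - c)) + ennreal l * ennreal (exp (b - d)) \<le> ennreal (1 - l) * (\<integral>\<^sup>+ s. ?D f (exp c) s \<partial>lborel) + ennreal l * (\<integral>\<^sup>+ s. ?D g (exp d) s \<partial>lborel)"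
  proof (intro add_mono mult_left_mono)
    have *: "ennreal (exp (a - c)) \<le> X" if "exp a < ennreal (exp c) * X" for X a c
    proof -
      have "ennreal (exp (a - c)) = ennreal (exp (- c)) * exp a" by (simp add: exp_diff exp_minus field_simps flip: ennreal_mult)
      also have "\<dots> \<le> ennreal (exp (- c)) * (ennreal (exp c) * X)" using that by (intro mult_left_mono) auto
      also have "\<dots> = X" by (simp add: mult.assoc[symmetric] exp_minus flip: ennreal_mult)
      finally show ?thesis .
    qed
    have L: "sigma_finite_measure (lborel :: real measure)" ..
    show "ennreal (exp (a - c)) \<le> (\<integral>\<^sup>+ s. ?D f (exp c) s \<partial>lborel)"
      by (rule *) (use F nn_integral_eq_layer_cake_scaled[OF L, of f "exp c"] in simp)
    show "ennreal (exp (b - d)) \<le> (\<integral>\<^sup>+ s. ?D g (exp d) s \<partial>lborel)"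
      by (rule *) (use G nn_integral_eq_layer_cake_scaled[OF L, of g "exp d"] in simp)
  qed auto
  also have "\<dots> = (\<integral>\<^sup>+ s. ennreal (1 - l) * ?D f (exp c) s + ennreal l * ?D g (exp d) s \<partial>lborel)"
    by (subst nn_integral_add) (auto simp: nn_integral_cmult)
  also have "\<dots> \<le> (\<integral>\<^sup>+ s. ?D h E s \<partial>lborel)"
    by (intro nn_integral_mono key)
  finally have 1: "ennreal (1 - l) * ennreal (exp (a - c)) + ennreal l * ennreal (exp (b - d)) \<le> (\<integral>\<^sup>+ s. ?D h E s \<partial>lborel)" .
  \<comment> \<open>The arithmetic-geometric mean inequality, as convexity of
    \<open>exp\<close>.\<close>
  have cvx: "exp ((1 - l) * (a - c) + l * (b - d)) \<le> (1 - l) * exp (a - c) + l * exp (b - d)"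
    using convex_onD[OF exp_convex, of l "a - c" "b - d"] l by simp
  have "ennreal (exp ((1 - l) * a + l * b)) = ennreal E * ennreal (exp ((1 - l) * (a - c) + l * (b - d)))"
    unfolding E_def by (simp add: ennreal_mult[symmetric] mult_exp_exp algebra_simps)
  also have "\<dots> \<le> ennreal E * (ennreal (1 - l) * ennreal (exp (a - c)) + ennreal l * ennreal (exp (b - d)))"
    using l cvx by (intro mult_left_mono) (auto simp: ennreal_mult[symmetric] ennreal_plus[symmetric] simp del: ennreal_plus intro!: ennreal_leI)
  also have "\<dots> \<le> ennreal E * (\<integral>\<^sup>+ s. ?D h E s \<partial>lborel)"
    using 1 by (rule mult_left_mono) simp
  also have "\<dots> = (\<integral>\<^sup>+ x. h x \<partial>lborel)"
    by (rule nn_integral_eq_layer_cake_scaled[symmetric]) (auto simp: E_def intro: lborel.sigma_finite_measure_axioms)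
  finally show ?thesis .
qed

text \<open>Truncation at a large height keeps the integrals above \<open>exp a\<close> and
  \<open>exp b\<close> by monotone convergence, and the pointwise hypothesis survives because it
  only has to hold for smaller \<open>f\<close> and \<open>g\<close>.\<close>

lemma prekopa_leindler_real:
  fixes f g h :: "real \<Rightarrow> ennreal"
  assumes f[measurable]: "f \<in> borel_measurable borel" and g[measurable]: "g \<in> borel_measurable borel"
    and h[measurable]: "h \<in> borel_measurable borel" and l: "0 < l" "l < 1"
    and fgh: "\<And>x y a b. exp a < f x \<Longrightarrow> exp b < g y \<Longrightarrow> exp ((1 - l) * a + l * b) \<le> h ((1 - l) * x + l * y)"
    and F: "exp a < (\<integral>\<^sup>+ x. f x \<partial>lborel)" and G: "exp b < (\<integral>\<^sup>+ x. g x \<partial>lborel)"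
  shows "exp ((1 - l) * a + l * b) \<le> (\<integral>\<^sup>+ x. h x \<partial>lborel)"
proof -
  have trunc: "\<exists>B. exp a < (\<integral>\<^sup>+ x. min (u x) (of_nat B) \<partial>lborel)"
    if [measurable]: "u \<in> borel_measurable borel" and U: "exp a < (\<integral>\<^sup>+ x. u x \<partial>lborel)" for u :: "real \<Rightarrow> ennreal" and a
  proof -
    have pt: "(SUP B. min (u x) (of_nat B)) = u x" for x
    proof (rule antisym)
      show "u x \<le> (SUP B. min (u x) (of_nat B))"
      proof (cases "u x = \<infinity>")
        case True
        then show ?thesis by (simp add: ennreal_SUP_of_nat_eq_top)
      next
        case False
        then obtain B :: nat where "u x \<le> of_nat B" using ennreal_Ex_less_of_nat[of "u x"] by (auto simp: less_top intro: less_imp_le)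
        then show ?thesis by (intro SUP_upper2[of B]) auto
      qed
    qed (auto intro: SUP_least)
    have "(\<integral>\<^sup>+ x. u x \<partial>lborel) = (SUP B. \<integral>\<^sup>+ x. min (u x) (of_nat B) \<partial>lborel)"
      by (subst nn_integral_monotone_convergence_SUP[symmetric])
         (auto simp: pt incseq_def le_fun_def intro: min.coboundedI2 of_nat_mono)
    with U show ?thesis by (auto simp: less_SUP_iff)
  qed
  obtain B where B: "exp a < (\<integral>\<^sup>+ x. min (f x) (of_nat B) \<partial>lborel)" using trunc[OF f F] by auto
  obtain B' where B': "exp b < (\<integral>\<^sup>+ x. min (g x) (of_nat B') \<partial>lborel)" using trunc[OF g G] by auto
  show ?thesis
  proof (rule prekopa_leindler_real_bounded[OF _ _ h l _ _ _ B B'])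
    show "min (f x) (of_nat B) \<le> ennreal (real (max B B'))" for x
      by (rule order_trans[OF min.cobounded2]) (simp add: ennreal_of_nat_eq_real_of_nat del: of_nat_max)
    show "min (g x) (of_nat B') \<le> ennreal (real (max B B'))" for x
      by (rule order_trans[OF min.cobounded2]) (simp add: ennreal_of_nat_eq_real_of_nat del: of_nat_max)
  qed (auto intro: fgh)
qed

text \<open>Induction on the coordinates: the conclusion of the one-dimensional case, read for the
  integrals over one coordinate, has exactly the form of the pointwise hypothesis in the remaining
  coordinates.\<close>

lemma prekopa_leindler_PiM:
  fixes f g h :: "('i \<Rightarrow> real) \<Rightarrow> ennreal"
  assumes I: "finite I" and l: "0 < l" "l < 1"
    and "f \<in> borel_measurable (PiM I (\<lambda>_. lborel))" "g \<in> borel_measurable (PiM I (\<lambda>_. lborel))"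
      "h \<in> borel_measurable (PiM I (\<lambda>_. lborel))"
    and "\<And>x y a b. x \<in> extensional I \<Longrightarrow> y \<in> extensional I \<Longrightarrow> exp a < f x \<Longrightarrow> exp b < g y \<Longrightarrow> exp ((1 - l) * a + l * b) \<le> h (\<lambda>i\<in>I. (1 - l) * x i + l * y i)"
    and "exp a < (\<integral>\<^sup>+ x. f x \<partial>PiM I (\<lambda>_. lborel))" "exp b < (\<integral>\<^sup>+ x. g x \<partial>PiM I (\<lambda>_. lborel))"
  shows "exp ((1 - l) * a + l * b) \<le> (\<integral>\<^sup>+ x. h x \<partial>PiM I (\<lambda>_. lborel))"
  using I assms(4-)
proof (induction I arbitrary: f g h a b)
  case empty
  interpret P: product_sigma_finite "\<lambda>_. lborel :: real measure" by (rule product_sigma_finite_lborel)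
  show ?case using empty.prems by (simp add: P.nn_integral_empty restrict_def)
next
  case (insert j I)
  interpret P: product_sigma_finite "\<lambda>_. lborel :: real measure" by (rule product_sigma_finite_lborel)
  note insert.prems(1-3)[measurable] insert.hyps(1)[simp]
  let ?m = "\<lambda>u x. \<integral>\<^sup>+ t. u (x(j := t)) \<partial>(lborel :: real measure)"
  have fold: "(\<integral>\<^sup>+ x. u x \<partial>PiM (insert j I) (\<lambda>_. lborel)) = (\<integral>\<^sup>+ x. ?m u x \<partial>PiM I (\<lambda>_. lborel))"
    if "u \<in> borel_measurable (PiM (insert j I) (\<lambda>_. lborel))" for u :: "('i \<Rightarrow> real) \<Rightarrow> ennreal"
    using that insert.hyps by (rule_tac P.product_nn_integral_insert) auto
  have sec: "(\<lambda>t. u (x(j := t))) \<in> borel_measurable borel"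
    if "x \<in> extensional I" "u \<in> borel_measurable (PiM (insert j I) (\<lambda>_. lborel))" for u :: "('i \<Rightarrow> real) \<Rightarrow> ennreal" and x
    using measurable_comp[OF measurable_component_update[of x I "\<lambda>_. lborel" j] that(2)] that(1) insert.hyps(2)
    by (auto simp: comp_def space_PiM PiE_def)
  show ?case
    unfolding fold[OF insert.prems(3)]
  proof (rule insert.IH)
    fix x y :: "'i \<Rightarrow> real" and a b assume xy: "x \<in> extensional I" "y \<in> extensional I" and "exp a < ?m f x" "exp b < ?m g y"
    then show "exp ((1 - l) * a + l * b) \<le> ?m h (\<lambda>i\<in>I. (1 - l) * x i + l * y i)"
    proof (intro prekopa_leindler_real[where f="\<lambda>t. f (x(j := t))" and g="\<lambda>t. g (y(j := t))"])
      fix s t a b assume "exp a < f (x(j := s))" "exp b < g (y(j := t))"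
      then have "exp ((1 - l) * a + l * b) \<le> h (\<lambda>i\<in>insert j I. (1 - l) * (x(j := s)) i + l * (y(j := t)) i)"
        using xy by (intro insert.prems(4)) (auto simp: extensional_def fun_upd_def)
      also have "(\<lambda>i\<in>insert j I. (1 - l) * (x(j := s)) i + l * (y(j := t)) i) = (\<lambda>i\<in>I. (1 - l) * x i + l * y i)(j := (1 - l) * s + l * t)"
        using insert.hyps by (auto simp: fun_eq_iff)
      finally show "exp ((1 - l) * a + l * b) \<le> h ((\<lambda>i\<in>I. (1 - l) * x i + l * y i)(j := (1 - l) * s + l * t))" .
    qed (use l in \<open>auto intro!: sec insert.prems(1-3)\<close>)
  next
    show "exp a < (\<integral>\<^sup>+ x. ?m f x \<partial>PiM I (\<lambda>_. lborel))" "exp b < (\<integral>\<^sup>+ x. ?m g x \<partial>PiM I (\<lambda>_. lborel))"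
      using insert.prems(5,6) by (simp_all only: fold insert.prems(1-3))
  qed measurable
qed

section \<open>Unimodality under box averages\<close>

text \<open>The property concerns averages and not values because it has to survive integration over
  a parameter: it is linear in \<open>W\<close>, whereas log-concavity and quasi-concavity are lost
  under sums. Boxes are enough, since the rearrangement below moves products of intervals by a
  common factor.\<close>

definition box_unimodal :: "'j set \<Rightarrow> (('j \<Rightarrow> real) \<Rightarrow> ennreal) \<Rightarrow> bool" where
  "box_unimodal J W \<longleftrightarrow> (\<forall>a r s. 0 \<le> s \<and> s \<le> 1 \<longrightarrow>
     (\<integral>\<^sup>+ t. W t * (\<Prod>j\<in>J. indicator {a j - r j..a j + r j} (t j)) \<partial>PiM J (\<lambda>_. lborel))
   \<le> (\<integral>\<^sup>+ t. W t * (\<Prod>j\<in>J. indicator {s * a j - r j..s * a j + r j} (t j)) \<partial>PiM J (\<lambda>_. lborel)))"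

lemma borel_measurable_prod_indicator_PiM:
  assumes "\<And>j. j \<in> J \<Longrightarrow> A j \<in> sets M"
  shows "(\<lambda>x. (\<Prod>j\<in>J. indicator (A j) (x j)) :: ennreal) \<in> borel_measurable (PiM J (\<lambda>_. M))"
  using assms by (intro borel_measurable_prod_ennreal)
    (auto intro!: measurable_compose[OF measurable_component_singleton] borel_measurable_indicator)

lemma nn_integral_PiM_lborel_uminus:
  fixes F :: "('i \<Rightarrow> real) \<Rightarrow> ennreal"
  assumes "finite I" "F \<in> borel_measurable (PiM I (\<lambda>_. lborel))"
  shows "(\<integral>\<^sup>+ x. F (\<lambda>i\<in>I. - x i) \<partial>PiM I (\<lambda>_. lborel)) = (\<integral>\<^sup>+ x. F x \<partial>PiM I (\<lambda>_. lborel))"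
proof -
  have L: "sigma_finite_measure (lborel :: real measure)" ..
  have "(\<integral>\<^sup>+ x. F (\<lambda>i\<in>I. - x i) \<partial>PiM I (\<lambda>_. lborel)) = 1 ^ card I * (\<integral>\<^sup>+ x. F x \<partial>PiM I (\<lambda>_. lborel))"
  proof (rule nn_integral_PiM_comp[OF L L])
    fix g :: "real \<Rightarrow> ennreal" assume g: "g \<in> borel_measurable lborel"
    show "(\<integral>\<^sup>+ z. g (- z) \<partial>lborel) = 1 * (\<integral>\<^sup>+ z. g z \<partial>lborel)"
      using g by (subst (2) nn_integral_real_affine[where c="-1" and t=0]) auto
  qed (use assms in auto)
  then show ?thesis by simp
qed

lemma ennreal_le_if_exp_le:
  fixes x y :: ennreal
  assumes "\<And>a. exp a < x \<Longrightarrow> exp a \<le> y"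
  shows "x \<le> y"
proof (rule dense_le)
  fix c assume c: "c < x"
  then obtain r where r: "c = ennreal r" "0 \<le> r" by (cases c) auto
  show "c \<le> y"
  proof (cases "r = 0")
    case False
    then show ?thesis using assms[of "ln r"] r c by simp
  qed (use r in simp)
qed

text \<open>\<open>K\<close> describes a convex set symmetric about the origin, so the measure of
  its sections is even and, by Prekopa--Leindler, log-concave in \<open>t\<close>. The box at s a
  contains the convex combination of the boxes at a and -a; a second application of
  Prekopa--Leindler bounds its integral from below by a geometric mean of two integrals that are
  equal by evenness.\<close>

lemma box_unimodal_section:
  fixes K :: "('j \<Rightarrow> real) \<Rightarrow> ('i \<Rightarrow> real) \<Rightarrow> bool"
  assumes J: "finite J" and I: "finite I"
    and meas[measurable]: "Measurable.pred (PiM J (\<lambda>_. lborel) \<Otimes>\<^sub>M PiM I (\<lambda>_. lborel)) (\<lambda>z. K (fst z) (snd z))"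
    and conv: "\<And>t t' v v' l. \<lbrakk>t \<in> extensional J; t' \<in> extensional J; v \<in> extensional I; v' \<in> extensional I; 0 < l; l < 1; K t v; K t' v'\<rbrakk>
        \<Longrightarrow> K (\<lambda>j\<in>J. (1 - l) * t j + l * t' j) (\<lambda>i\<in>I. (1 - l) * v i + l * v' i)"
    and sym: "\<And>t v. \<lbrakk>t \<in> extensional J; v \<in> extensional I; K t v\<rbrakk> \<Longrightarrow> K (\<lambda>j\<in>J. - t j) (\<lambda>i\<in>I. - v i)"
  shows "box_unimodal J (\<lambda>t. \<integral>\<^sup>+ v. indicator {v. K t v} v \<partial>PiM I (\<lambda>_. lborel))"
  unfolding box_unimodal_def
proof (intro allI impI)
  fix a r :: "'j \<Rightarrow> real" and s :: real assume s: "0 \<le> s \<and> s \<le> 1"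
  interpret I: sigma_finite_measure "PiM I (\<lambda>_. lborel :: real measure)" by (rule sigma_finite_PiM_lborel[OF I])
  let ?W = "\<lambda>t. \<integral>\<^sup>+ v. indicator {v. K t v} v \<partial>PiM I (\<lambda>_. lborel)"
  let ?b = "\<lambda>a t. (\<Prod>j\<in>J. indicator {a j - r j..a j + r j} (t j)) :: ennreal"
  let ?N = "\<lambda>a. \<integral>\<^sup>+ t. ?W t * ?b a t \<partial>PiM J (\<lambda>_. lborel)"
  have mW[measurable]: "?W \<in> borel_measurable (PiM J (\<lambda>_. lborel))"
    by measurable
  have mb[measurable]: "?b a \<in> borel_measurable (PiM J (\<lambda>_. lborel))" for a
    by (rule borel_measurable_prod_indicator_PiM) auto
  have mI: "(\<lambda>v. indicator {v. K t v} v :: ennreal) \<in> borel_measurable (PiM I (\<lambda>_. lborel))" if "t \<in> extensional J" for t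
  proof -
    have "t \<in> space (PiM J (\<lambda>_. lborel :: real measure))" using that by (auto simp: space_PiM PiE_def)
    from measurable_compose[OF measurable_Pair1'[OF this] meas]
    have [measurable]: "Measurable.pred (PiM I (\<lambda>_. lborel)) (K t)" by simp
    show ?thesis by measurable
  qed
  have b1: "?b a t = (if \<forall>j\<in>J. \<bar>t j - a j\<bar> \<le> r j then 1 else 0)" for a t
    using J by (auto simp: indicator_def abs_le_iff algebra_simps intro!: prod.neutral)
  show "?N a \<le> ?N (\<lambda>j. s * a j)"
  proof (cases "s = 1")
    case False
    \<comment> \<open>Solves (1 - l) a + l (- a) = s a.\<close>
    define l where "l = (1 - s) / 2"
    have l: "0 < l" "l < 1" using s False by (auto simp: l_def)
    have eq: "?N (\<lambda>j. - a j) = ?N a"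
    proof -
      have "?N (\<lambda>j. - a j) = (\<integral>\<^sup>+ t. ?W (\<lambda>j\<in>J. - t j) * ?b (\<lambda>j. - a j) (\<lambda>j\<in>J. - t j) \<partial>PiM J (\<lambda>_. lborel))"
        by (rule nn_integral_PiM_lborel_uminus[symmetric]) (use J in auto)
      also have "\<dots> = ?N a"
      proof (rule nn_integral_cong)
        fix t assume "t \<in> space (PiM J (\<lambda>_. lborel :: real measure))"
        then have t: "t \<in> extensional J" by (auto simp: space_PiM PiE_def)
        let ?t = "\<lambda>j\<in>J. - t j"
        have "?W ?t = (\<integral>\<^sup>+ v. indicator {v. K ?t v} (\<lambda>i\<in>I. - v i) \<partial>PiM I (\<lambda>_. lborel))"
          by (rule nn_integral_PiM_lborel_uminus[symmetric]) (use I mI in auto)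
        also have "\<dots> = ?W t"
        proof (rule nn_integral_cong)
          fix v assume "v \<in> space (PiM I (\<lambda>_. lborel :: real measure))"
          then have v: "v \<in> extensional I" by (auto simp: space_PiM PiE_def)
          have "(\<lambda>j\<in>J. - ?t j) = t" "(\<lambda>i\<in>I. - (\<lambda>i\<in>I. - v i) i) = v"
            using t v by (auto simp: fun_eq_iff extensional_def)
          then have "K ?t (\<lambda>i\<in>I. - v i) \<longleftrightarrow> K t v"
            using sym[OF t v] sym[of ?t "\<lambda>i\<in>I. - v i"] by auto
          then show "indicator {v. K ?t v} (\<lambda>i\<in>I. - v i) = (indicator {v. K t v} v :: ennreal)"
            by (simp add: indicator_def)
        qed
        finally have "?W ?t = ?W t" .
        moreover have "?b (\<lambda>j. - a j) ?t = ?b a t"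
          by (simp only: b1) (auto simp: abs_minus_commute)
        ultimately show "?W ?t * ?b (\<lambda>j. - a j) ?t = ?W t * ?b a t" by simp
      qed
      finally show ?thesis .
    qed
    show ?thesis
    proof (rule ennreal_le_if_exp_le)
      fix c assume c: "exp c < ?N a"
      have "exp ((1 - l) * c + l * c) \<le> ?N (\<lambda>j. s * a j)"
      proof (rule prekopa_leindler_PiM[OF J l, where f="\<lambda>t. ?W t * ?b a t" and g="\<lambda>t. ?W t * ?b (\<lambda>j. - a j) t"])
        fix t t' :: "'j \<Rightarrow> real" and \<alpha> \<beta> :: real
        assume t: "t \<in> extensional J" "t' \<in> extensional J"
          and A: "exp \<alpha> < ?W t * ?b a t" and B: "exp \<beta> < ?W t' * ?b (\<lambda>j. - a j) t'"
        let ?t = "\<lambda>j\<in>J. (1 - l) * t j + l * t' j"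
        have ba: "\<forall>j\<in>J. \<bar>t j - a j\<bar> \<le> r j" using A by (auto simp only: b1 split: if_splits) auto
        have bb: "\<forall>j\<in>J. \<bar>t' j - - a j\<bar> \<le> r j" using B by (auto simp only: b1 split: if_splits) auto
        have "\<bar>?t j - s * a j\<bar> \<le> r j" if j: "j \<in> J" for j
        proof -
          have "?t j - s * a j = (1 - l) * (t j - a j) + l * (t' j - - a j)"
            using j by (simp add: l_def field_simps)
          also have "\<bar>\<dots>\<bar> \<le> (1 - l) * \<bar>t j - a j\<bar> + l * \<bar>t' j - - a j\<bar>"
            using l by (intro order_trans[OF abs_triangle_ineq]) (simp add: abs_mult)
          also have "\<dots> \<le> (1 - l) * r j + l * r j"
            using l ba bb j by (intro add_mono mult_left_mono) auto
          finally show ?thesis by (simp add: algebra_simps)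
        qed
        then have b: "?b (\<lambda>j. s * a j) ?t = 1" by (simp only: b1) simp
        have "?b a t = 1" unfolding b1 by (rule if_P) (rule ba)
        moreover have "?b (\<lambda>j. - a j) t' = 1" unfolding b1 by (rule if_P) (rule bb)
        ultimately have A': "exp \<alpha> < ?W t" and B': "exp \<beta> < ?W t'" using A B by simp_all
        \<comment> \<open>The inner application, in \<open>v\<close> with \<open>t\<close> and
          \<open>t'\<close> fixed: an indicator above \<open>exp x\<close> has the value 1, so
          \<open>x\<close> is negative and the convexity of \<open>K\<close> is all that is
          needed.\<close>
        have "exp ((1 - l) * \<alpha> + l * \<beta>) \<le> ?W ?t"
        proof (rule prekopa_leindler_PiM[OF I l, where f="\<lambda>v. indicator {v. K t v} v" and g="\<lambda>v. indicator {v. K t' v} v"])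
          fix v v' :: "'i \<Rightarrow> real" and x y :: real
          assume v: "v \<in> extensional I" "v' \<in> extensional I" and x: "exp x < (indicator {v. K t v} v :: ennreal)" and y: "exp y < (indicator {v. K t' v} v' :: ennreal)"
          have K: "K t v" "K t' v'" using x y by (cases "K t v"; cases "K t' v'"; simp)+
          have "x < 0" "y < 0" using x y K by auto
          then have "(1 - l) * x + l * y \<le> 0" using l by (intro add_nonpos_nonpos mult_nonneg_nonpos) auto
          then show "exp ((1 - l) * x + l * y) \<le> (indicator {v. K ?t v} (\<lambda>i\<in>I. (1 - l) * v i + l * v' i) :: ennreal)"
            using conv[OF t v l K] by simp
        qed (use A' B' t in \<open>auto intro!: mI\<close>)
        then show "exp ((1 - l) * \<alpha> + l * \<beta>) \<le> ?W ?t * ?b (\<lambda>j. s * a j) ?t" using b by simp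
      qed (use c eq in auto)
      then show "exp c \<le> ?N (\<lambda>j. s * a j)" by (simp add: algebra_simps)
    qed
  qed simp
qed

lemma box_unimodal_nn_integral:
  fixes W :: "('j \<Rightarrow> real) \<Rightarrow> 'b \<Rightarrow> ennreal"
  assumes J: "finite J" and N: "sigma_finite_measure N"
    and W[measurable]: "case_prod W \<in> borel_measurable (PiM J (\<lambda>_. lborel) \<Otimes>\<^sub>M N)"
    and u: "\<And>s. s \<in> space N \<Longrightarrow> box_unimodal J (\<lambda>t. W t s)"
  shows "box_unimodal J (\<lambda>t. \<integral>\<^sup>+ s. W t s \<partial>N)"
  unfolding box_unimodal_def
proof (intro allI impI)
  fix a r :: "'j \<Rightarrow> real" and s :: real assume s: "0 \<le> s \<and> s \<le> 1"
  interpret N: sigma_finite_measure N by fact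
  interpret J: sigma_finite_measure "PiM J (\<lambda>_. lborel :: real measure)" by (rule sigma_finite_PiM_lborel[OF J])
  interpret P: pair_sigma_finite "PiM J (\<lambda>_. lborel :: real measure)" N ..
  let ?b = "\<lambda>a t. (\<Prod>j\<in>J. indicator {a j - r j..a j + r j} (t j)) :: ennreal"
  have mb[measurable]: "?b a \<in> borel_measurable (PiM J (\<lambda>_. lborel))" for a
    by (rule borel_measurable_prod_indicator_PiM) auto
  have eq: "(\<integral>\<^sup>+ t. (\<integral>\<^sup>+ s. W t s \<partial>N) * ?b a t \<partial>PiM J (\<lambda>_. lborel)) = (\<integral>\<^sup>+ s. (\<integral>\<^sup>+ t. W t s * ?b a t \<partial>PiM J (\<lambda>_. lborel)) \<partial>N)" for a
  proof -
    have "(\<integral>\<^sup>+ t. (\<integral>\<^sup>+ s. W t s \<partial>N) * ?b a t \<partial>PiM J (\<lambda>_. lborel)) = (\<integral>\<^sup>+ t. (\<integral>\<^sup>+ s. W t s * ?b a t \<partial>N) \<partial>PiM J (\<lambda>_. lborel))"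
      by (intro nn_integral_cong nn_integral_multc[symmetric]) measurable
    also have "\<dots> = (\<integral>\<^sup>+ s. (\<integral>\<^sup>+ t. W t s * ?b a t \<partial>PiM J (\<lambda>_. lborel)) \<partial>N)"
      by (rule P.Fubini'[symmetric]) measurable
    finally show ?thesis .
  qed
  show "(\<integral>\<^sup>+ t. (\<integral>\<^sup>+ s. W t s \<partial>N) * ?b a t \<partial>PiM J (\<lambda>_. lborel)) \<le> (\<integral>\<^sup>+ t. (\<integral>\<^sup>+ s. W t s \<partial>N) * ?b (\<lambda>j. s * a j) t \<partial>PiM J (\<lambda>_. lborel))"
    unfolding eq by (rule nn_integral_mono) (use u s in \<open>unfold box_unimodal_def, blast\<close>)
qed

lemma box_unimodal_cmult:
  assumes W[measurable]: "W \<in> borel_measurable (PiM J (\<lambda>_. lborel))" and u: "box_unimodal J W"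
  shows "box_unimodal J (\<lambda>t. c * W t)"
proof -
  have [measurable]: "(\<lambda>t. (\<Prod>j\<in>J. indicator {a j - r j..a j + r j} (t j)) :: ennreal) \<in> borel_measurable (PiM J (\<lambda>_. lborel))" for a r :: "_ \<Rightarrow> real"
    by (rule borel_measurable_prod_indicator_PiM) auto
  show ?thesis
    using u unfolding box_unimodal_def by (simp add: mult.assoc nn_integral_cmult mult_left_mono)
qed

section \<open>Rearrangement on the line\<close>

text \<open>A pair \<open>(c, r)\<close> stands for the interval with centre \<open>c\<close> and radius \<open>r\<close>.\<close>

definition interval :: "real \<times> real \<Rightarrow> real set" where
  "interval x = {fst x - snd x..fst x + snd x}"

text \<open>Common endpoints are permitted, so that a family remains admissible at the moment when
  two of its intervals meet.\<close>

definition nonoverlapping :: "(real \<times> real) set \<Rightarrow> bool" where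
  "nonoverlapping S \<longleftrightarrow> finite S \<and> (\<forall>x\<in>S. 0 < snd x)
     \<and> (\<forall>x\<in>S. \<forall>y\<in>S. x \<noteq> y \<longrightarrow> snd x + snd y \<le> \<bar>fst x - fst y\<bar>)"

lemma interval_sets[measurable, simp]: "interval x \<in> sets borel"
  by (simp add: interval_def)

text \<open>The product of sums expands into one box for every choice of an interval from each
  family, and \<open>box_unimodal\<close> applies to all these boxes with the same factor
  \<open>s\<close>.\<close>

lemma nn_integral_intervals_contract:
  assumes J: "finite J" and W[measurable]: "W \<in> borel_measurable (PiM J (\<lambda>_. lborel))" and u: "box_unimodal J W"
    and S: "\<And>j. j \<in> J \<Longrightarrow> finite (S j)" and s: "0 \<le> s" "s \<le> 1"
  shows "(\<integral>\<^sup>+ t. W t * (\<Prod>j\<in>J. \<Sum>x\<in>S j. indicator (interval x) (t j)) \<partial>PiM J (\<lambda>_. lborel))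
      \<le> (\<integral>\<^sup>+ t. W t * (\<Prod>j\<in>J. \<Sum>x\<in>S j. indicator (interval (s * fst x, snd x)) (t j)) \<partial>PiM J (\<lambda>_. lborel))"
proof -
  have [measurable]: "(\<lambda>t. (\<Prod>j\<in>J. indicator (interval (I j)) (t j)) :: ennreal) \<in> borel_measurable (PiM J (\<lambda>_. lborel))" for I
    by (rule borel_measurable_prod_indicator_PiM) auto
  have eq: "(\<integral>\<^sup>+ t. W t * (\<Prod>j\<in>J. \<Sum>x\<in>S j. indicator (interval (F x)) (t j)) \<partial>PiM J (\<lambda>_. lborel))
     = (\<Sum>\<gamma>\<in>PiE J S. \<integral>\<^sup>+ t. W t * (\<Prod>j\<in>J. indicator (interval (F (\<gamma> j))) (t j)) \<partial>PiM J (\<lambda>_. lborel))" for F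
    using J S by (simp add: prod_sum_PiE sum_distrib_left nn_integral_sum)
  have "(\<integral>\<^sup>+ t. W t * (\<Prod>j\<in>J. indicator (interval (\<gamma> j)) (t j)) \<partial>PiM J (\<lambda>_. lborel))
      \<le> (\<integral>\<^sup>+ t. W t * (\<Prod>j\<in>J. indicator (interval (s * fst (\<gamma> j), snd (\<gamma> j))) (t j)) \<partial>PiM J (\<lambda>_. lborel))" for \<gamma>
    using u[unfolded box_unimodal_def, rule_format, of s "\<lambda>j. fst (\<gamma> j)" "\<lambda>j. snd (\<gamma> j)"] s
    by (simp add: interval_def)
  then show ?thesis
    using eq[of "\<lambda>x. x"] eq[of "\<lambda>x. (s * fst x, snd x)"] by (simp add: sum_mono)
qed

text \<open>Two touching intervals are replaced by their union \<open>m\<close>; only at the common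
  endpoint do the sums of indicators differ. The total length is kept and one interval is saved,
  which drives the induction below.\<close>

lemma nonoverlapping_merge:
  assumes S: "nonoverlapping S" and x: "x \<in> S" and y: "y \<in> S" and lt: "fst x < fst y"
    and touch: "fst y - fst x = snd x + snd y"
  obtains S' where "nonoverlapping S'" "card S' < card S" "sum snd S' = sum snd S"
    "AE t in lborel. (\<Sum>z\<in>S. indicator (interval z) t) = (\<Sum>z\<in>S'. indicator (interval z) t :: ennreal)"
proof
  define m where "m = ((fst x - snd x + fst y + snd y) / 2, snd x + snd y)"
  define S0 where "S0 = S - {x, y}"
  have fin: "finite S0" "finite S" and pos: "\<And>z. z \<in> S \<Longrightarrow> 0 < snd z"
    and dist: "\<And>z w. z \<in> S \<Longrightarrow> w \<in> S \<Longrightarrow> z \<noteq> w \<Longrightarrow> snd z + snd w \<le> \<bar>fst z - fst w\<bar>"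
    using S by (auto simp: nonoverlapping_def S0_def)
  have xy: "x \<noteq> y" using lt by auto
  have S_eq: "S = insert x (insert y S0)" "x \<notin> insert y S0" "y \<notin> S0"
    using x y xy by (auto simp: S0_def)
  \<comment> \<open>No third interval fits between \<open>x\<close> and \<open>y\<close>, because
    they touch; one that overlaps neither of them lies entirely to one side of their union.\<close>
  have far: "snd z + snd m \<le> \<bar>fst z - fst m\<bar>" if z: "z \<in> S0" for z
  proof -
    have "0 < snd z" "snd z + snd x \<le> \<bar>fst z - fst x\<bar>" "snd z + snd y \<le> \<bar>fst z - fst y\<bar>"
      using z pos dist x y by (auto simp: S0_def)
    moreover have "0 < snd x" "0 < snd y" using pos x y by auto
    ultimately show ?thesis using touch unfolding m_def by (auto simp: abs_if field_simps split: if_splits)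
  qed
  have m0: "0 < snd m" using pos[OF x] pos[OF y] by (simp add: m_def)
  have m_new: "m \<notin> S0" using far[of m] m0 by fastforce
  show "nonoverlapping (insert m S0)"
    unfolding nonoverlapping_def
  proof (intro conjI ballI impI)
    fix z w assume "z \<in> insert m S0" "w \<in> insert m S0" "z \<noteq> w"
    then consider "z = m" "w \<in> S0" | "w = m" "z \<in> S0" | "z \<in> S" "w \<in> S" by (auto simp: S0_def)
    then show "snd z + snd w \<le> \<bar>fst z - fst w\<bar>"
    proof cases
      case 1
      then show ?thesis using far[of w] by (simp add: add.commute abs_minus_commute)
    qed (use far[of z] dist[of z w] \<open>z \<noteq> w\<close> in auto)
  qed (use fin pos m0 in \<open>auto simp: S0_def\<close>)
  show "card (insert m S0) < card S"
    using S_eq fin m_new by simp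
  show "sum snd (insert m S0) = sum snd S"
    using S_eq fin m_new by (simp add: m_def)
  have "AE t in lborel. t \<noteq> fst x + snd x" by (rule AE_lborel_singleton)
  then show "AE t in lborel. (\<Sum>z\<in>S. indicator (interval z) t) = (\<Sum>z\<in>insert m S0. indicator (interval z) t :: ennreal)"
  proof (rule AE_mp, intro AE_I2 impI)
    fix t assume t: "t \<noteq> fst x + snd x"
    have "indicator (interval x) t + indicator (interval y) t = (indicator (interval m) t :: ennreal)"
      using t touch pos[OF x] pos[OF y] by (auto simp: interval_def m_def indicator_def field_simps)
    then show "(\<Sum>z\<in>S. indicator (interval z) t) = (\<Sum>z\<in>insert m S0. indicator (interval z) t :: ennreal)"
      using S_eq fin m_new by (simp add: add.assoc[symmetric])
  qed
qed

lemma nonoverlapping_scale: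
  assumes S: "nonoverlapping S" and s: "0 < s"
    and d: "\<And>x y. x \<in> S \<Longrightarrow> y \<in> S \<Longrightarrow> x \<noteq> y \<Longrightarrow> snd x + snd y \<le> s * \<bar>fst x - fst y\<bar>"
  defines "g \<equiv> \<lambda>x. (s * fst x, snd x)"
  shows "nonoverlapping (g ` S)" "inj_on g S" "card (g ` S) = card S" "sum snd (g ` S) = sum snd S"
    "(\<Sum>z\<in>g ` S. indicator (interval z) t) = (\<Sum>x\<in>S. indicator (interval (s * fst x, snd x)) t :: ennreal)"
proof -
  show inj: "inj_on g S" using s by (auto simp: inj_on_def g_def prod_eq_iff)
  then show "card (g ` S) = card S" "sum snd (g ` S) = sum snd S"
    "(\<Sum>z\<in>g ` S. indicator (interval z) t) = (\<Sum>x\<in>S. indicator (interval (s * fst x, snd x)) t :: ennreal)"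
    by (auto simp: card_image sum.reindex g_def)
  have "snd x + snd y \<le> \<bar>s * fst x - s * fst y\<bar>" if "x \<in> S" "y \<in> S" "x \<noteq> y" for x y
    using d[OF that] s by (simp add: right_diff_distrib[symmetric] abs_mult)
  then show "nonoverlapping (g ` S)"
    using S unfolding nonoverlapping_def g_def by auto
qed

text \<open>All intervals are moved towards the origin by a common factor until two intervals of the same
  family touch; these are then merged.\<close>
lemma nn_integral_intervals_le_centred:
  assumes J: "finite J" and W[measurable]: "W \<in> borel_measurable (PiM J (\<lambda>_. lborel))" and u: "box_unimodal J W"
    and S: "\<And>j. j \<in> J \<Longrightarrow> nonoverlapping (S j)"
  shows "(\<integral>\<^sup>+ t. W t * (\<Prod>j\<in>J. \<Sum>x\<in>S j. indicator (interval x) (t j)) \<partial>PiM J (\<lambda>_. lborel))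
      \<le> (\<integral>\<^sup>+ t. W t * (\<Prod>j\<in>J. indicator (interval (0, sum snd (S j))) (t j)) \<partial>PiM J (\<lambda>_. lborel))"
  using S
proof (induction "\<Sum>j\<in>J. card (S j)" arbitrary: S rule: less_induct)
  case less
  have L: "sigma_finite_measure (lborel :: real measure)" ..
  have fin: "finite (S j)" if "j \<in> J" for j using less.prems[OF that] by (auto simp: nonoverlapping_def)
  \<comment> \<open>Two intervals of one family touch when the centres have been multiplied by this
    ratio. As the factor decreases from 1, the largest ratio is the first one to be met.\<close>
  define P where "P = {(snd x + snd y) / \<bar>fst x - fst y\<bar> | j x y. j \<in> J \<and> x \<in> S j \<and> y \<in> S j \<and> x \<noteq> y}"
  consider (e) j where "j \<in> J" "S j = {}" | (s) "\<And>j. j \<in> J \<Longrightarrow> S j \<noteq> {}" "P = {}" | (p) "P \<noteq> {}" by blast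
  then show ?case
  proof cases
    case e
    then have "(\<Prod>j\<in>J. \<Sum>x\<in>S j. indicator (interval x) (t j)) = (0::ennreal)" for t
      using J by (auto intro!: prod_zero bexI[of _ j])
    then show ?thesis by (simp only: mult_zero_right mult_zero_left nn_integral_const zero_le)
  next
    case s
    \<comment> \<open>Every family consists of a single interval, so nothing can collide and the
      factor 0 is admissible.\<close>
    have "(\<integral>\<^sup>+ t. W t * (\<Prod>j\<in>J. \<Sum>x\<in>S j. indicator (interval x) (t j)) \<partial>PiM J (\<lambda>_. lborel))
       \<le> (\<integral>\<^sup>+ t. W t * (\<Prod>j\<in>J. \<Sum>x\<in>S j. indicator (interval (0 * fst x, snd x)) (t j)) \<partial>PiM J (\<lambda>_. lborel))"
      by (rule nn_integral_intervals_contract[OF J W u fin]) auto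
    also have "\<dots> = (\<integral>\<^sup>+ t. W t * (\<Prod>j\<in>J. indicator (interval (0, sum snd (S j))) (t j)) \<partial>PiM J (\<lambda>_. lborel))"
    proof (intro nn_integral_cong arg_cong2[where f="(*)"] prod.cong refl)
      fix t :: "_ \<Rightarrow> real" and j assume j: "j \<in> J"
      obtain x where "S j = {x}" using s j unfolding P_def by blast
      then show "(\<Sum>x\<in>S j. indicator (interval (0 * fst x, snd x)) (t j)) = (indicator (interval (0, sum snd (S j))) (t j) :: ennreal)"
        by simp
    qed
    finally show ?thesis .
  next
    case p
    have pos: "0 < snd x" if "j \<in> J" "x \<in> S j" for j x using less.prems[OF that(1)] that(2) by (auto simp: nonoverlapping_def)
    have dist: "snd x + snd y \<le> \<bar>fst x - fst y\<bar>" if "j \<in> J" "x \<in> S j" "y \<in> S j" "x \<noteq> y" for j x y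
      using less.prems[OF that(1)] that by (auto simp: nonoverlapping_def)
    have ne: "0 < \<bar>fst x - fst y\<bar>" if "j \<in> J" "x \<in> S j" "y \<in> S j" "x \<noteq> y" for j x y
      using dist[OF that] pos[OF that(1,2)] pos[OF that(1,3)] by linarith
    have "P \<subseteq> (\<lambda>(x, y). (snd x + snd y) / \<bar>fst x - fst y\<bar>) ` ((\<Union>j\<in>J. S j) \<times> (\<Union>j\<in>J. S j))"
      unfolding P_def by force
    then have finP: "finite P" by (rule finite_subset) (use J fin in auto)
    define s where "s = Max P"
    have "s \<in> P" unfolding s_def using finP p by (rule Max_in)
    then obtain j0 x0 y0 where 0: "j0 \<in> J" "x0 \<in> S j0" "y0 \<in> S j0" "x0 \<noteq> y0" "s = (snd x0 + snd y0) / \<bar>fst x0 - fst y0\<bar>"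
      unfolding P_def by blast
    have s1: "0 < s" "s \<le> 1"
      unfolding 0(5) using ne[OF 0(1-4)] dist[OF 0(1-4)] pos[OF 0(1,2)] pos[OF 0(1,3)]
      by (auto intro!: divide_pos_pos simp: divide_le_eq_1)
    have sd: "snd x + snd y \<le> s * \<bar>fst x - fst y\<bar>" if "j \<in> J" "x \<in> S j" "y \<in> S j" "x \<noteq> y" for j x y
    proof -
      have "(snd x + snd y) / \<bar>fst x - fst y\<bar> \<in> P" unfolding P_def using that by blast
      then have "(snd x + snd y) / \<bar>fst x - fst y\<bar> \<le> s"
        unfolding s_def by (rule Max_ge[OF finP])
      then show ?thesis using ne[OF that] by (simp add: field_simps)
    qed
    define g where "g x = (s * fst x, snd x)" for x :: "real \<times> real"
    define T where "T j = g ` S j" for j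
    have T: "nonoverlapping (T j)" "card (T j) = card (S j)" "sum snd (T j) = sum snd (S j)"
      "(\<Sum>z\<in>T j. indicator (interval z) t) = (\<Sum>x\<in>S j. indicator (interval (s * fst x, snd x)) t :: ennreal)" if "j \<in> J" for j t
      unfolding T_def g_def
      using nonoverlapping_scale[OF less.prems[OF that] s1(1) sd[OF that]] by auto
    obtain x y where xy: "x \<in> T j0" "y \<in> T j0" "fst x < fst y" "fst y - fst x = snd x + snd y"
    proof -
      have e: "s * \<bar>fst x0 - fst y0\<bar> = snd x0 + snd y0" using 0(5) ne[OF 0(1-4)] by simp
      have mem: "g x0 \<in> T j0" "g y0 \<in> T j0" using 0 by (auto simp: T_def)
      consider "fst x0 < fst y0" | "fst y0 < fst x0" using ne[OF 0(1-4)] by fastforce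
      then show thesis
      proof cases
        case 1
        then have "fst (g x0) < fst (g y0)" "fst (g y0) - fst (g x0) = snd (g x0) + snd (g y0)"
          using e s1 by (simp_all add: g_def right_diff_distrib)
        then show thesis using that mem by blast
      next
        case 2
        then have "fst (g y0) < fst (g x0)" "fst (g x0) - fst (g y0) = snd (g y0) + snd (g x0)"
          using e s1 by (simp_all add: g_def right_diff_distrib)
        then show thesis using that mem by blast
      qed
    qed
    obtain S' where S': "nonoverlapping S'" "card S' < card (T j0)" "sum snd S' = sum snd (T j0)"
      "AE t in lborel. (\<Sum>z\<in>T j0. indicator (interval z) t) = (\<Sum>z\<in>S'. indicator (interval z) t :: ennreal)"
      using nonoverlapping_merge[OF T(1)[OF 0(1)] xy] by blast
    define U where "U = T(j0 := S')"
    have "(\<integral>\<^sup>+ t. W t * (\<Prod>j\<in>J. \<Sum>x\<in>S j. indicator (interval x) (t j)) \<partial>PiM J (\<lambda>_. lborel))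
       \<le> (\<integral>\<^sup>+ t. W t * (\<Prod>j\<in>J. \<Sum>x\<in>S j. indicator (interval (s * fst x, snd x)) (t j)) \<partial>PiM J (\<lambda>_. lborel))"
      by (rule nn_integral_intervals_contract[OF J W u fin]) (use s1 in auto)
    also have "\<dots> = (\<integral>\<^sup>+ t. W t * (\<Prod>j\<in>J. \<Sum>x\<in>T j. indicator (interval x) (t j)) \<partial>PiM J (\<lambda>_. lborel))"
      using T(4) by (intro nn_integral_cong arg_cong2[where f="(*)"] prod.cong refl) auto
    also have "\<dots> = (\<integral>\<^sup>+ t. W t * (\<Prod>j\<in>J. \<Sum>x\<in>U j. indicator (interval x) (t j)) \<partial>PiM J (\<lambda>_. lborel))"
      by (rule nn_integral_PiM_weight_cong_AE[OF L J, where w="\<lambda>j z. \<Sum>x\<in>T j. indicator (interval x) z" and w'="\<lambda>j z. \<Sum>x\<in>U j. indicator (interval x) z"])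
         (use S'(4) in \<open>auto simp: U_def\<close>)
    also have "\<dots> \<le> (\<integral>\<^sup>+ t. W t * (\<Prod>j\<in>J. indicator (interval (0, sum snd (U j))) (t j)) \<partial>PiM J (\<lambda>_. lborel))"
    proof (rule less.hyps)
      have "(\<Sum>j\<in>J. card (U j)) < (\<Sum>j\<in>J. card (T j))"
        using 0(1) S'(2) J by (intro sum_strict_mono_ex1) (auto simp: U_def less_imp_le)
      then show "(\<Sum>j\<in>J. card (U j)) < (\<Sum>j\<in>J. card (S j))" using T(2) by simp
    qed (use T(1) S'(1) in \<open>auto simp: U_def\<close>)
    also have "\<dots> = (\<integral>\<^sup>+ t. W t * (\<Prod>j\<in>J. indicator (interval (0, sum snd (S j))) (t j)) \<partial>PiM J (\<lambda>_. lborel))"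
      using T(3) S'(3) 0(1) by (intro nn_integral_cong arg_cong2[where f="(*)"] prod.cong refl) (auto simp: U_def)
    finally show ?thesis .
  qed
qed

text \<open>Between a compact \<open>K\<close> inside \<open>B\<close> and an open \<open>Q\<close>
  around \<open>B\<close>, compactness provides a finite union \<open>U\<close> of closed intervals.
  Both errors are controlled by \<open>K \<subseteq> U \<subseteq> Q\<close>, and a division of
  \<open>U\<close> into intervals without common interior points gives \<open>S\<close>.\<close>

lemma borel_approx_nonoverlapping:
  fixes B :: "real set"
  assumes B[measurable]: "B \<in> sets borel" and fin: "emeasure lborel B < \<infinity>" and d: "0 < d"
  obtains S U where "nonoverlapping S" "U \<in> sets borel" "emeasure lborel (B - U) \<le> ennreal d" "emeasure lborel (U - B) \<le> ennreal d"
    "AE t in lborel. (\<Sum>z\<in>S. indicator (interval z) t) = (indicator U t :: ennreal)"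
    "emeasure lborel U = ennreal (2 * sum snd S)"
proof -
  obtain K where K: "compact K" "K \<subseteq> B" "emeasure lborel (B - K) \<le> ennreal d"
  proof (cases "emeasure lborel B \<le> ennreal d")
    case True
    then show thesis using that[of "{}"] by simp
  next
    case False
    let ?\<K> = "{K. compact K \<and> K \<subseteq> B \<and> K \<noteq> {}}"
    have "B \<noteq> {}" using False by auto
    have "0 < emeasure lborel B" using False by (auto simp: not_le intro: le_less_trans[OF zero_le])
    then have "emeasure lborel B - ennreal d < emeasure lborel B"
      using fin d by (intro ennreal_between) auto
    also have "\<dots> = (SUP K\<in>?\<K>. emeasure lborel K)"
      by (rule emeasure_lborel_eq_SUP_compact[OF B \<open>B \<noteq> {}\<close>])
    finally obtain K where K: "compact K" "K \<subseteq> B" "emeasure lborel B - ennreal d < emeasure lborel K"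
      by (auto simp: less_SUP_iff)
    have [measurable]: "K \<in> sets borel" using K by (auto intro: borel_closed compact_imp_closed)
    have Kf: "emeasure lborel K \<noteq> \<infinity>" using emeasure_compact_finite[OF K(1)] by simp
    have "emeasure lborel (B - K) = emeasure lborel B - emeasure lborel K"
      using K Kf by (intro emeasure_Diff) auto
    also have "\<dots> \<le> ennreal d"
      using K(3)[THEN less_imp_le] fin Kf by (auto simp: ennreal_minus_le_iff add.commute)
    finally show thesis using that K by blast
  qed
  obtain Q where Q: "open Q" "B \<subseteq> Q" "emeasure lborel (Q - B) < ennreal d"
    using outer_regular_lborel[OF B d] by blast
  have "\<exists>e>0. cball x e \<subseteq> Q" if "x \<in> K" for x
    using open_contains_cball[of Q] Q that K by auto
  then obtain e where e: "\<And>x. x \<in> K \<Longrightarrow> 0 < e x" "\<And>x. x \<in> K \<Longrightarrow> cball x (e x) \<subseteq> Q" by metis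
  have "K \<subseteq> (\<Union>x\<in>K. ball x (e x))" using e by force
  then obtain D where D: "D \<subseteq> K" "finite D" "K \<subseteq> (\<Union>x\<in>D. ball x (e x))"
    by (rule compactE_image[OF K(1), of K "\<lambda>x. ball x (e x)", rotated]) auto
  define F where "F = (\<lambda>x. cball x (e x)) ` D"
  have F: "\<exists>a b. k = cbox a b" if "k \<in> F" for k
  proof -
    obtain x where "k = {x - e x..x + e x}" using \<open>k \<in> F\<close> by (auto simp: F_def cball_eq_atLeastAtMost)
    then show ?thesis by (auto simp only: box_real(2)[symmetric])
  qed
  have "finite F" using D by (simp add: F_def)
  from elementary_unions_intervals[OF this F] obtain p where p: "p division_of (\<Union>F)" by blast
  define U where "U = \<Union>F"
  have Up: "\<Union>p = U" using division_ofD(6)[OF p] by (simp add: U_def)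
  have KU: "K \<subseteq> U" "U \<subseteq> Q" using D e by (force simp: U_def F_def)+
  \<comment> \<open>Degenerate pieces are discarded, since \<open>nonoverlapping\<close> requires
    positive radii.\<close>
  define q where "q = {k\<in>p. interior k \<noteq> {}}"
  define \<Phi> where "\<Phi> k = ((Inf k + Sup k) / 2, (Sup k - Inf k) / 2)" for k :: "real set"
  have finp: "finite p" "finite q" using p by (auto simp: division_of_def q_def)
  have kp: "\<exists>a b. a \<le> b \<and> k = {a..b}" if "k \<in> p" for k
    using division_ofD(3,4)[OF p that] by (force simp: cbox_interval)
  have kq: "\<exists>a b. a < b \<and> k = {a..b}" if k: "k \<in> q" for k
  proof -
    have "k \<in> p" using k by (simp add: q_def)
    then obtain a b where "a \<le> b" "k = {a..b}" using kp by blast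
    moreover have "a \<noteq> b" using k \<open>k = {a..b}\<close> by (auto simp: q_def)
    ultimately show ?thesis by (auto simp: less_le)
  qed
  have iv: "interval (\<Phi> k) = k" "0 < snd (\<Phi> k)" if "k \<in> q" for k
    using kq[OF that] by (auto simp: interval_def \<Phi>_def field_simps)
  have inj: "inj_on \<Phi> q" by (rule inj_on_inverseI[of _ interval]) (rule iv(1))
  define S where "S = \<Phi> ` q"
  have dis: "interior k \<inter> interior k' = {}" if "k \<in> q" "k' \<in> q" "k \<noteq> k'" for k k'
    using p that by (auto simp: division_of_def q_def)
  have S: "nonoverlapping S"
    unfolding nonoverlapping_def
  proof (intro conjI ballI impI)
    fix x y assume x: "x \<in> S" and y: "y \<in> S" and ne: "x \<noteq> y"
    obtain k k' where k: "x = \<Phi> k" "y = \<Phi> k'" "k \<in> q" "k' \<in> q" using x y by (auto simp: S_def)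
    obtain a b where ab: "a < b" "k = {a..b}" using kq[OF k(3)] by blast
    obtain a' b' where ab': "a' < b'" "k' = {a'..b'}" using kq[OF k(4)] by blast
    note ab = ab ab'
    have "{a<..<b} \<inter> {a'<..<b'} = {}"
      using dis[of k k'] k ne ab by auto
    then have "b \<le> a' \<or> b' \<le> a"
    proof (rule_tac ccontr)
      assume "{a<..<b} \<inter> {a'<..<b'} = {}" and "\<not> (b \<le> a' \<or> b' \<le> a)"
      then have "max a a' < min b b'" using ab by auto
      then obtain z where "max a a' < z" "z < min b b'" using dense by blast
      then have "z \<in> {a<..<b} \<inter> {a'<..<b'}" by auto
      then show False using \<open>{a<..<b} \<inter> {a'<..<b'} = {}\<close> by auto
    qed
    then show "snd x + snd y \<le> \<bar>fst x - fst y\<bar>"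
      using ab k by (auto simp: \<Phi>_def abs_if field_simps)
  qed (use finp iv in \<open>auto simp: S_def\<close>)
  \<comment> \<open>Away from the finitely many endpoints, a point of \<open>U\<close> lies in
    exactly one piece, and in its interior.\<close>
  define E where "E = (\<Union>k\<in>p. {Inf k, Sup k})"
  have finE: "finite E" using finp by (auto simp: E_def)
  have ae: "AE t in lborel. (\<Sum>z\<in>S. indicator (interval z) t) = (indicator U t :: ennreal)"
  proof -
    have "AE t in lborel. t \<notin> E" using finE by (intro AE_not_in) (auto simp: finite_imp_null_set_lborel)
    then show ?thesis
    proof (rule AE_mp, intro AE_I2 impI)
      fix t assume t: "t \<notin> E"
      have int: "t \<in> interior k" if k: "k \<in> p" "t \<in> k" for k
      proof -
        obtain a b where "a \<le> b" "k = {a..b}" using kp k by blast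
        then show ?thesis using t k by (force simp: E_def)
      qed
      have "(\<Sum>z\<in>S. indicator (interval z) t) = (\<Sum>k\<in>q. indicator k t :: ennreal)"
        unfolding S_def using inj iv by (simp add: sum.reindex)
      also have "\<dots> = indicator U t"
      proof (cases "t \<in> U")
        case True
        then obtain k where k: "k \<in> p" "t \<in> k" unfolding Up[symmetric] by blast
        then have kq: "k \<in> q" using int by (auto simp: q_def)
        have "indicator k' t = (0::ennreal)" if "k' \<in> q - {k}" for k'
          using that dis[of k k'] kq int k by (auto simp: indicator_def q_def)
        then have "(\<Sum>k\<in>q. indicator k t :: ennreal) = indicator k t"
          using kq finp by (simp add: sum.remove[of q k])
        then show ?thesis using k True by simp
      next
        case False
        then have "t \<notin> k" if "k \<in> q" for k using that unfolding Up[symmetric] q_def by blast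
        then show ?thesis using False by simp
      qed
      finally show "(\<Sum>z\<in>S. indicator (interval z) t) = (indicator U t :: ennreal)" .
    qed
  qed
  have U[measurable]: "U \<in> sets borel" using D by (auto simp: U_def F_def)
  have "emeasure lborel U = (\<integral>\<^sup>+ t. indicator U t \<partial>lborel)" by simp
  also have "\<dots> = (\<integral>\<^sup>+ t. (\<Sum>z\<in>S. indicator (interval z) t) \<partial>lborel)"
    using ae by (intro nn_integral_cong_AE) (auto elim: eventually_mono)
  also have "\<dots> = (\<Sum>z\<in>S. emeasure lborel (interval z))"
    by (subst nn_integral_sum) auto
  also have "\<dots> = (\<Sum>z\<in>S. ennreal (2 * snd z))"
    using S by (intro sum.cong) (auto simp: interval_def nonoverlapping_def)
  also have "\<dots> = ennreal (2 * sum snd S)"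
    using S by (subst sum_ennreal) (auto simp: sum_distrib_left nonoverlapping_def less_imp_le)
  finally have mU: "emeasure lborel U = ennreal (2 * sum snd S)" .
  have mK: "K \<in> sets borel" "Q \<in> sets borel" using K Q by (auto intro: borel_closed compact_imp_closed)
  show thesis
  proof (rule that[OF S U _ _ ae mU])
    show "emeasure lborel (B - U) \<le> ennreal d"
      using K(3) KU mK by (intro order_trans[OF emeasure_mono K(3)]) auto
    show "emeasure lborel (U - B) \<le> ennreal d"
      using KU Q mK by (intro order_trans[OF emeasure_mono less_imp_le[OF Q(3)]]) auto
  qed
qed

text \<open>The rearrangement inequality on the line. The sets are approximated by finite unions of
  intervals, for which the sliding argument applies; the bound \<open>C\<close> makes the error
  proportional to the accuracy \<open>d\<close>.\<close>

lemma nn_integral_box_unimodal_le_centred: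
  assumes J: "finite J" and W[measurable]: "W \<in> borel_measurable (PiM J (\<lambda>_. lborel))" and u: "box_unimodal J W"
    and C: "\<And>t. t \<in> space (PiM J (\<lambda>_. lborel)) \<Longrightarrow> W t \<le> ennreal C"
    and B: "\<And>j. j \<in> J \<Longrightarrow> B j \<in> sets borel" and fin: "\<And>j. j \<in> J \<Longrightarrow> emeasure lborel (B j) < \<infinity>"
  shows "(\<integral>\<^sup>+ t. W t * (\<Prod>j\<in>J. indicator (B j) (t j)) \<partial>PiM J (\<lambda>_. lborel))
      \<le> (\<integral>\<^sup>+ t. W t * (\<Prod>j\<in>J. indicator {z. \<bar>z\<bar> < measure lborel (B j) / 2} (t j)) \<partial>PiM J (\<lambda>_. lborel))"
proof (rule ennreal_le_epsilon)
  fix e :: real assume e: "0 < e"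
  have L: "sigma_finite_measure (lborel :: real measure)" ..
  let ?I = "\<lambda>A. \<integral>\<^sup>+ t. W t * (\<Prod>j\<in>J. indicator (A j) (t j)) \<partial>PiM J (\<lambda>_. lborel)"
  \<comment> \<open>A common bound for the lengths of the \<open>B j\<close> and of the centred
    intervals, which exceed them by at most \<open>d \<le> 1\<close>; the remaining slack ensures
    \<open>1 \<le> V\<close>.\<close>
  define V where "V = 2 + (\<Sum>j\<in>J. measure lborel (B j))"
  have V: "measure lborel (B j) + 2 \<le> V" if "j \<in> J" for j
    unfolding V_def using member_le_sum[of j J "\<lambda>j. measure lborel (B j)"] that J by simp
  have V1: "1 \<le> V" unfolding V_def using sum_nonneg[of J "\<lambda>j. measure lborel (B j)"] by simp
  have emB: "emeasure lborel (B j) = ennreal (measure lborel (B j))" if "j \<in> J" for j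
    using fin[OF that] by (intro emeasure_eq_ennreal_measure) auto
  define c where "c = max 0 C * real (card J) * V ^ card J"
  have c: "0 \<le> c" using V1 by (auto simp: c_def)
  \<comment> \<open>The error \<open>c * d\<close> arises twice, once for passing from
    \<open>B\<close> to intervals and once for returning to the centred intervals of the exact
    lengths; adding 1 to \<open>c\<close> avoids a division by zero.\<close>
  define d where "d = min 1 (e / (2 * (c + 1)))"
  have d: "0 < d" "d \<le> 1" "2 * (c * d) \<le> e"
  proof -
    show "0 < d" "d \<le> 1" using e c by (auto simp: d_def)
    have "c * d \<le> c * (e / (2 * (c + 1)))" using c by (intro mult_left_mono) (auto simp: d_def)
    also have "\<dots> \<le> e / 2" using c e by (simp add: field_simps)
    finally show "2 * (c * d) \<le> e" by simp
  qed
  have err: "ennreal C * of_nat (card J) * ennreal V ^ card J * ennreal d \<le> ennreal (c * d)"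
    using V1 d unfolding c_def
    by (cases "0 \<le> C") (auto simp: ennreal_mult' ennreal_power ennreal_of_nat_eq_real_of_nat[symmetric] ennreal_neg)
  define approx where "approx j S U \<longleftrightarrow> nonoverlapping S \<and> U \<in> sets borel
    \<and> emeasure lborel (B j - U) \<le> ennreal d \<and> emeasure lborel (U - B j) \<le> ennreal d
    \<and> (AE t in lborel. (\<Sum>z\<in>S. indicator (interval z) t) = (indicator U t :: ennreal))
    \<and> emeasure lborel U = ennreal (2 * sum snd S)" for j S U
  have "\<exists>S U. approx j S U" if "j \<in> J" for j
    by (rule borel_approx_nonoverlapping[OF B[OF that] fin[OF that] d(1)]) (auto simp: approx_def)
  then obtain S U where "\<And>j. j \<in> J \<Longrightarrow> approx j (S j) (U j)"
    by metis
  then have SU: "\<And>j. j \<in> J \<Longrightarrow> nonoverlapping (S j)" "\<And>j. j \<in> J \<Longrightarrow> U j \<in> sets borel"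
    "\<And>j. j \<in> J \<Longrightarrow> emeasure lborel (B j - U j) \<le> ennreal d" "\<And>j. j \<in> J \<Longrightarrow> emeasure lborel (U j - B j) \<le> ennreal d"
    "\<And>j. j \<in> J \<Longrightarrow> (AE t in lborel. (\<Sum>z\<in>S j. indicator (interval z) t) = (indicator (U j) t :: ennreal))"
    "\<And>j. j \<in> J \<Longrightarrow> emeasure lborel (U j) = ennreal (2 * sum snd (S j))"
    unfolding approx_def by blast+
  define R where "R j = sum snd (S j)" for j
  have R: "0 \<le> R j" "2 * R j \<le> measure lborel (B j) + d" if j: "j \<in> J" for j
  proof -
    show "0 \<le> R j" using SU(1)[OF j] unfolding R_def nonoverlapping_def by (intro sum_nonneg) (auto intro: less_imp_le)
    have "ennreal (2 * R j) = emeasure lborel (U j)" using SU(6)[OF j] by (simp add: R_def)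
    also have "\<dots> \<le> emeasure lborel (B j \<union> (U j - B j))" using SU(2) B j by (intro emeasure_mono) auto
    also have "\<dots> \<le> emeasure lborel (B j) + emeasure lborel (U j - B j)"
      using SU(2) B j by (intro emeasure_subadditive) auto
    also have "\<dots> \<le> ennreal (measure lborel (B j)) + ennreal d"
      using SU(4)[OF j] emB[OF j] by (intro add_mono) auto
    also have "\<dots> = ennreal (measure lborel (B j) + d)" using d by simp
    finally have "ennreal (2 * R j) \<le> ennreal (measure lborel (B j) + d)" .
    then show "2 * R j \<le> measure lborel (B j) + d" using d by (subst (asm) ennreal_le_iff) auto
  qed
  have "?I B \<le> ?I U + ennreal C * of_nat (card J) * ennreal V ^ card J * ennreal d"
  proof (rule nn_integral_PiM_indicator_perturb[OF L J W C])
    show "emeasure lborel (B j) \<le> ennreal V" if "j \<in> J" for j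
      using emB[OF that] V[OF that] by (simp add: ennreal_leI)
  qed (use B SU V1 in auto)
  also have "?I U = (\<integral>\<^sup>+ t. W t * (\<Prod>j\<in>J. \<Sum>x\<in>S j. indicator (interval x) (t j)) \<partial>PiM J (\<lambda>_. lborel))"
    by (rule nn_integral_PiM_weight_cong_AE[OF L J, where w'="\<lambda>j z. \<Sum>x\<in>S j. indicator (interval x) z" and w="\<lambda>j z. indicator (U j) z"])
       (use SU(5) in \<open>auto simp: eq_commute\<close>)
  also have "\<dots> \<le> ?I (\<lambda>j. interval (0, R j))"
    unfolding R_def by (rule nn_integral_intervals_le_centred[OF J W u SU(1)])
  also have "\<dots> \<le> ?I (\<lambda>j. {z. \<bar>z\<bar> < measure lborel (B j) / 2}) + ennreal C * of_nat (card J) * ennreal V ^ card J * ennreal d"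
  proof (rule nn_integral_PiM_indicator_perturb[OF L J W C])
    fix j assume j: "j \<in> J"
    show "emeasure lborel (interval (0, R j)) \<le> ennreal V"
      using R[OF j] V[OF j] d by (auto simp: interval_def intro!: ennreal_leI)
    let ?m = "measure lborel (B j) / 2"
    have "emeasure lborel (interval (0, R j) - {z. \<bar>z\<bar> < ?m}) \<le> emeasure lborel ({- R j..- ?m} \<union> {?m..R j})"
      by (intro emeasure_mono) (auto simp: interval_def)
    also have "\<dots> \<le> emeasure lborel {- R j..- ?m} + emeasure lborel {?m..R j}"
      by (intro emeasure_subadditive) auto
    also have "\<dots> \<le> ennreal d"
    proof (cases "?m \<le> R j")
      case True
      then show ?thesis using R[OF j] by (auto simp: ennreal_plus[symmetric] simp del: ennreal_plus intro!: ennreal_leI)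
    qed (use d in auto)
    finally show "emeasure lborel (interval (0, R j) - {z. \<bar>z\<bar> < ?m}) \<le> ennreal d" .
  qed (use V1 in auto)
  finally have "?I B \<le> ?I (\<lambda>j. {z. \<bar>z\<bar> < measure lborel (B j) / 2}) + ennreal C * of_nat (card J) * ennreal V ^ card J * ennreal d + ennreal C * of_nat (card J) * ennreal V ^ card J * ennreal d"
    by (simp add: add_right_mono)
  also have "\<dots> \<le> ?I (\<lambda>j. {z. \<bar>z\<bar> < measure lborel (B j) / 2}) + ennreal (c * d) + ennreal (c * d)"
    by (intro add_mono err order_refl)
  also have "\<dots> = ?I (\<lambda>j. {z. \<bar>z\<bar> < measure lborel (B j) / 2}) + ennreal (2 * (c * d))"
    using c d by (simp add: add.assoc ennreal_plus[symmetric] del: ennreal_plus)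
  also have "\<dots> \<le> ?I (\<lambda>j. {z. \<bar>z\<bar> < measure lborel (B j) / 2}) + ennreal e"
    using d by (intro add_left_mono ennreal_leI) auto
  finally show "?I B \<le> ?I (\<lambda>j. {z. \<bar>z\<bar> < measure lborel (B j) / 2}) + ennreal e" .
qed

section \<open>Splitting off a coordinate\<close>

text \<open>Parametrises the hyperplane orthogonal to \<open>e\<close> by its coordinates, so that
  Lebesgue measure on it is the finite product \<open>hyp e\<close>, to which Fubini and the product
  form of Prekopa--Leindler apply.\<close>

definition emb :: "'a::euclidean_space \<Rightarrow> ('a \<Rightarrow> real) \<Rightarrow> 'a" where
  "emb e y = (\<Sum>b\<in>Basis - {e}. y b *\<^sub>R b)"

abbreviation hyp :: "'a::euclidean_space \<Rightarrow> ('a \<Rightarrow> real) measure" where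
  "hyp e \<equiv> PiM (Basis - {e}) (\<lambda>_. lborel)"

lemma sigma_finite_hyp: "sigma_finite_measure (hyp e)"
  by (rule sigma_finite_PiM_lborel) simp

lemma measurable_emb[measurable]: "emb e \<in> borel_measurable (hyp e)"
  unfolding emb_def[abs_def] by (intro borel_measurable_sum borel_measurable_scaleR) auto

lemma emb_orthogonal: "e \<in> Basis \<Longrightarrow> e \<bullet> emb e y = 0" "e \<in> Basis \<Longrightarrow> emb e y \<bullet> e = 0"
  by (auto simp: emb_def inner_sum_left inner_sum_right inner_Basis intro!: sum.neutral split: if_splits)

lemma nn_integral_lborel_split:
  fixes F :: "'a::euclidean_space \<Rightarrow> ennreal"
  assumes e: "e \<in> Basis" and F[measurable]: "F \<in> borel_measurable borel"
  shows "(\<integral>\<^sup>+ x. F x \<partial>lborel) = (\<integral>\<^sup>+ y. (\<integral>\<^sup>+ t. F (t *\<^sub>R e + emb e y) \<partial>lborel) \<partial>hyp e)"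
proof -
  interpret P: product_sigma_finite "\<lambda>_. lborel :: real measure" by (rule product_sigma_finite_lborel)
  have ins: "Basis = insert e (Basis - {e})" using e by auto
  have m: "(\<lambda>f. \<Sum>b\<in>Basis. f b *\<^sub>R b) \<in> measurable (PiM Basis (\<lambda>_. lborel)) (borel :: 'a measure)"
    by (intro borel_measurable_sum borel_measurable_scaleR) auto
  have eq: "(\<Sum>b\<in>Basis. (y(e := t)) b *\<^sub>R b) = t *\<^sub>R e + emb e y" for y t
    unfolding emb_def using e by (subst sum.remove[of Basis e]) auto
  have "(\<integral>\<^sup>+ x. F x \<partial>lborel) = (\<integral>\<^sup>+ f. F (\<Sum>b\<in>Basis. f b *\<^sub>R b) \<partial>PiM Basis (\<lambda>_. lborel))"
    using m by (subst lborel_eq, subst nn_integral_distr) auto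
  also have "\<dots> = (\<integral>\<^sup>+ f. F (\<Sum>b\<in>Basis. f b *\<^sub>R b) \<partial>PiM (insert e (Basis - {e})) (\<lambda>_. lborel))"
    using ins by simp
  also have "\<dots> = (\<integral>\<^sup>+ y. (\<integral>\<^sup>+ t. F (\<Sum>b\<in>Basis. (y(e := t)) b *\<^sub>R b) \<partial>lborel) \<partial>hyp e)"
    using m ins[symmetric] by (subst P.product_nn_integral_insert) (auto intro!: measurable_compose[OF _ F])
  finally show ?thesis unfolding eq .
qed

text \<open>One point is added at a time, and its hyperplane part has to be exchanged with the
  \<open>e\<close>-coordinates of the earlier points: in the end all \<open>e\<close>-coordinates
  are integrated first, which is the order for rearranging on lines.\<close>

lemma nn_integral_PiM_split:
  fixes F :: "('j \<Rightarrow> 'a::euclidean_space) \<Rightarrow> ennreal"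
  assumes e: "e \<in> Basis" and J: "finite J" and F: "F \<in> borel_measurable (PiM J (\<lambda>_. lborel))"
  shows "(\<integral>\<^sup>+ x. F x \<partial>PiM J (\<lambda>_. lborel))
    = (\<integral>\<^sup>+ y. (\<integral>\<^sup>+ t. F (\<lambda>j\<in>J. t j *\<^sub>R e + emb e (y j)) \<partial>PiM J (\<lambda>_. lborel)) \<partial>PiM J (\<lambda>_. hyp e))"
  using J F
proof (induction J arbitrary: F)
  case empty
  interpret PL: product_sigma_finite "\<lambda>_. lborel :: real measure" by (rule product_sigma_finite_lborel)
  interpret PA: product_sigma_finite "\<lambda>_. lborel :: 'a measure" by (rule product_sigma_finite_lborel)
  interpret PH: product_sigma_finite "\<lambda>_. hyp e" by standard (use sigma_finite_hyp in \<open>auto simp: sigma_finite_measure_def\<close>)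
  show ?case
    using PL.emeasure_PiM[of "{}"] PH.emeasure_PiM[of "{}"] by (simp add: PA.nn_integral_empty restrict_def space_PiM)
next
  case (insert j J)
  interpret PL: product_sigma_finite "\<lambda>_. lborel :: real measure" by (rule product_sigma_finite_lborel)
  interpret PA: product_sigma_finite "\<lambda>_. lborel :: 'a measure" by (rule product_sigma_finite_lborel)
  interpret PH: product_sigma_finite "\<lambda>_. hyp e" by standard (use sigma_finite_hyp in \<open>auto simp: sigma_finite_measure_def\<close>)
  interpret H: sigma_finite_measure "hyp e" by (rule sigma_finite_hyp)
  note insert.prems[measurable] insert.hyps(1)[simp]
  interpret R: sigma_finite_measure "PiM J (\<lambda>_. lborel :: real measure)" by (rule sigma_finite_PiM_lborel) simp
  interpret R1: sigma_finite_measure "PiM (insert j J) (\<lambda>_. lborel :: real measure)" by (rule sigma_finite_PiM_lborel) simp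
  interpret P: pair_sigma_finite "PiM J (\<lambda>_. lborel :: real measure)" "hyp e" ..
  let ?c = "\<lambda>y t. \<lambda>i\<in>J. t i *\<^sub>R e + emb e (y i)"
  have sec: "(\<lambda>z. F (x(j := z))) \<in> borel_measurable borel" if "x \<in> space (PiM J (\<lambda>_. lborel :: 'a measure))" for x
    using measurable_comp[OF measurable_component_update[OF that insert.hyps(2)] insert.prems]
    unfolding comp_def by simp
  have sp: "?c y t \<in> space (PiM J (\<lambda>_. lborel :: 'a measure))" for y t
    by (auto simp: space_PiM)
  have upd: "(\<lambda>i\<in>insert j J. (t(j := t')) i *\<^sub>R e + emb e ((y(j := y')) i)) = (?c y t)(j := t' *\<^sub>R e + emb e y')" for y t y' t'
    using insert.hyps(2) by (auto simp: fun_eq_iff)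
  have "(\<integral>\<^sup>+ x. F x \<partial>PiM (insert j J) (\<lambda>_. lborel)) = (\<integral>\<^sup>+ x. (\<integral>\<^sup>+ z. F (x(j := z)) \<partial>lborel) \<partial>PiM J (\<lambda>_. lborel))"
    using insert.hyps(2) by (intro PA.product_nn_integral_insert) auto
  also have "\<dots> = (\<integral>\<^sup>+ y. (\<integral>\<^sup>+ t. (\<integral>\<^sup>+ z. F ((?c y t)(j := z)) \<partial>lborel) \<partial>PiM J (\<lambda>_. lborel)) \<partial>PiM J (\<lambda>_. hyp e))"
    by (rule insert.IH) measurable
  also have "\<dots> = (\<integral>\<^sup>+ y. (\<integral>\<^sup>+ t. (\<integral>\<^sup>+ y'. (\<integral>\<^sup>+ t'. F ((?c y t)(j := t' *\<^sub>R e + emb e y')) \<partial>lborel) \<partial>hyp e) \<partial>PiM J (\<lambda>_. lborel)) \<partial>PiM J (\<lambda>_. hyp e))"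
    using nn_integral_lborel_split[OF e sec[OF sp]] by simp
  also have "\<dots> = (\<integral>\<^sup>+ y. (\<integral>\<^sup>+ y'. (\<integral>\<^sup>+ t. (\<integral>\<^sup>+ t'. F ((?c y t)(j := t' *\<^sub>R e + emb e y')) \<partial>lborel) \<partial>PiM J (\<lambda>_. lborel)) \<partial>hyp e) \<partial>PiM J (\<lambda>_. hyp e))"
  proof (rule nn_integral_cong)
    fix y assume [measurable]: "y \<in> space (PiM J (\<lambda>_. hyp e))"
    show "(\<integral>\<^sup>+ t. (\<integral>\<^sup>+ y'. (\<integral>\<^sup>+ t'. F ((?c y t)(j := t' *\<^sub>R e + emb e y')) \<partial>lborel) \<partial>hyp e) \<partial>PiM J (\<lambda>_. lborel))
       = (\<integral>\<^sup>+ y'. (\<integral>\<^sup>+ t. (\<integral>\<^sup>+ t'. F ((?c y t)(j := t' *\<^sub>R e + emb e y')) \<partial>lborel) \<partial>PiM J (\<lambda>_. lborel)) \<partial>hyp e)"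
      by (rule P.Fubini'[symmetric]) measurable
  qed
  also have "\<dots> = (\<integral>\<^sup>+ y. (\<integral>\<^sup>+ y'. (\<integral>\<^sup>+ t. F (\<lambda>i\<in>insert j J. t i *\<^sub>R e + emb e ((y(j := y')) i)) \<partial>PiM (insert j J) (\<lambda>_. lborel)) \<partial>hyp e) \<partial>PiM J (\<lambda>_. hyp e))"
  proof (intro nn_integral_cong)
    fix y y' assume [measurable]: "y \<in> space (PiM J (\<lambda>_. hyp e))" "y' \<in> space (hyp e)"
    show "(\<integral>\<^sup>+ t. (\<integral>\<^sup>+ t'. F ((?c y t)(j := t' *\<^sub>R e + emb e y')) \<partial>lborel) \<partial>PiM J (\<lambda>_. lborel))
       = (\<integral>\<^sup>+ t. F (\<lambda>i\<in>insert j J. t i *\<^sub>R e + emb e ((y(j := y')) i)) \<partial>PiM (insert j J) (\<lambda>_. lborel))"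
      using insert.hyps(2) by (subst PL.product_nn_integral_insert) (auto simp only: upd, measurable)
  qed
  also have "\<dots> = (\<integral>\<^sup>+ y. (\<integral>\<^sup>+ t. F (\<lambda>i\<in>insert j J. t i *\<^sub>R e + emb e (y i)) \<partial>PiM (insert j J) (\<lambda>_. lborel)) \<partial>PiM (insert j J) (\<lambda>_. hyp e))"
    using insert.hyps(2) by (intro PH.product_nn_integral_insert[symmetric]) (auto, measurable)
  finally show ?case .
qed

section \<open>Steiner symmetrisation\<close>

text \<open>Sections become open centred segments, and sections of length 0 become empty. As
  \<open>measure\<close> has the value 0 on sets of infinite measure, long sections would disappear;
  the estimates below therefore assume that \<open>A\<close> lies in a ball.\<close>

definition steiner :: "'a::euclidean_space \<Rightarrow> 'a set \<Rightarrow> 'a set" where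
  "steiner e A = {x. \<bar>x \<bullet> e\<bar> < measure lborel {t. t *\<^sub>R e + (x - (x \<bullet> e) *\<^sub>R e) \<in> A} / 2}"

lemma split_components:
  assumes "e \<in> Basis"
  shows "(t *\<^sub>R e + emb e y) \<bullet> e = t" "(t *\<^sub>R e + emb e y) - ((t *\<^sub>R e + emb e y) \<bullet> e) *\<^sub>R e = emb e y"
  using assms by (simp_all add: inner_add_left emb_orthogonal)

lemma steiner_section:
  assumes "e \<in> Basis"
  shows "t *\<^sub>R e + emb e y \<in> steiner e A \<longleftrightarrow> \<bar>t\<bar> < measure lborel {t. t *\<^sub>R e + emb e y \<in> A} / 2"
  using assms split_components[OF assms] by (simp add: steiner_def)

lemma norm_add_orthogonal_sq:
  assumes "e \<in> Basis" "z \<bullet> e = 0"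
  shows "(norm (t *\<^sub>R e + z))\<^sup>2 = t\<^sup>2 + (norm z)\<^sup>2"
  using assms by (simp add: power2_norm_eq_inner inner_add_left inner_add_right inner_commute[of e z]) (simp add: power2_eq_square)

lemma section_sets[measurable]:
  fixes A :: "'a::euclidean_space set"
  assumes [measurable]: "A \<in> sets borel"
  shows "{t. t *\<^sub>R e + z \<in> A} \<in> sets borel"
  by measurable

lemma nn_integral_indicator_section:
  fixes A :: "'a::euclidean_space set"
  assumes A: "A \<in> sets borel"
  shows "(\<integral>\<^sup>+ t. indicator A (t *\<^sub>R e + z) \<partial>lborel) = emeasure lborel {t. t *\<^sub>R e + z \<in> A}"
proof -
  have "(\<lambda>t. indicator A (t *\<^sub>R e + z) :: ennreal) = indicator {t. t *\<^sub>R e + z \<in> A}"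
    by (auto simp: indicator_def fun_eq_iff)
  then show ?thesis using section_sets[OF A, of e z] by simp
qed

lemma section_subset_interval:
  assumes e: "e \<in> Basis" and A: "A \<subseteq> cball 0 R"
  shows "{t. t *\<^sub>R e + z \<in> A} \<subseteq> {- (z \<bullet> e) - R..- (z \<bullet> e) + R}"
proof
  fix t assume "t \<in> {t. t *\<^sub>R e + z \<in> A}"
  then have "norm (t *\<^sub>R e + z) \<le> R" using A by auto
  moreover have "\<bar>(t *\<^sub>R e + z) \<bullet> e\<bar> \<le> norm (t *\<^sub>R e + z)" using e by (rule Basis_le_norm)
  ultimately show "t \<in> {- (z \<bullet> e) - R..- (z \<bullet> e) + R}" using e by (simp add: inner_add_left abs_le_iff)
qed

lemma emeasure_section_le:
  assumes e: "e \<in> Basis" and A: "A \<subseteq> cball 0 R" and R: "0 \<le> R"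
  shows "emeasure lborel {t. t *\<^sub>R e + z \<in> A} \<le> ennreal (2 * R)"
proof -
  have "emeasure lborel {t. t *\<^sub>R e + z \<in> A} \<le> emeasure lborel {- (z \<bullet> e) - R..- (z \<bullet> e) + R}"
    by (intro emeasure_mono section_subset_interval[OF e A]) auto
  then show ?thesis using R by simp
qed

lemma emeasure_section_eq_measure:
  assumes e: "e \<in> Basis" and A: "A \<subseteq> cball 0 R" and R: "0 \<le> R"
  shows "emeasure lborel {t. t *\<^sub>R e + z \<in> A} = ennreal (measure lborel {t. t *\<^sub>R e + z \<in> A})"
  using le_less_trans[OF emeasure_section_le[OF e A R] ennreal_less_top]
  by (intro emeasure_eq_ennreal_measure) (metis less_irrefl)

lemma steiner_sets:
  fixes A :: "'a::euclidean_space set"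
  assumes [measurable]: "A \<in> sets borel"
  shows "steiner e A \<in> sets borel"
proof -
  have "(\<lambda>x. \<integral>\<^sup>+ t. indicator A (t *\<^sub>R e + (x - (x \<bullet> e) *\<^sub>R e)) \<partial>lborel) \<in> borel_measurable borel"
    by measurable
  then have [measurable]: "(\<lambda>x. measure lborel {t. t *\<^sub>R e + (x - (x \<bullet> e) *\<^sub>R e) \<in> A}) \<in> borel_measurable borel"
    by (simp add: measure_def nn_integral_indicator_section)
  show ?thesis unfolding steiner_def by measurable
qed

lemma emeasure_eq_sections:
  fixes A :: "'a::euclidean_space set"
  assumes e: "e \<in> Basis" and [measurable]: "A \<in> sets borel"
  shows "emeasure lborel A = (\<integral>\<^sup>+ y. emeasure lborel {t. t *\<^sub>R e + emb e y \<in> A} \<partial>hyp e)"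
proof -
  have "emeasure lborel A = (\<integral>\<^sup>+ x. indicator A x \<partial>lborel)" by simp
  also have "\<dots> = (\<integral>\<^sup>+ y. (\<integral>\<^sup>+ t. indicator A (t *\<^sub>R e + emb e y) \<partial>lborel) \<partial>hyp e)"
    by (rule nn_integral_lborel_split[OF e]) measurable
  also have "\<dots> = (\<integral>\<^sup>+ y. emeasure lborel {t. t *\<^sub>R e + emb e y \<in> A} \<partial>hyp e)"
    by (simp add: nn_integral_indicator_section)
  finally show ?thesis .
qed

lemma abs_less_eq_interval: "{t::real. \<bar>t\<bar> < r} = {-r<..<r}"
  by auto

lemma emeasure_steiner:
  fixes A :: "'a::euclidean_space set"
  assumes e: "e \<in> Basis" and A[measurable]: "A \<in> sets borel" and AR: "A \<subseteq> cball 0 R" and R: "0 \<le> R"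
  shows "emeasure lborel (steiner e A) = emeasure lborel A"
proof -
  note steiner_sets[measurable]
  have "emeasure lborel (steiner e A) = (\<integral>\<^sup>+ y. emeasure lborel {t. \<bar>t\<bar> < measure lborel {t. t *\<^sub>R e + emb e y \<in> A} / 2} \<partial>hyp e)"
    by (simp add: emeasure_eq_sections[OF e] steiner_section[OF e])
  also have "\<dots> = (\<integral>\<^sup>+ y. emeasure lborel {t. t *\<^sub>R e + emb e y \<in> A} \<partial>hyp e)"
    by (intro nn_integral_cong, subst abs_less_eq_interval) (simp add: emeasure_section_eq_measure[OF e AR R])
  finally show ?thesis by (simp add: emeasure_eq_sections[OF e A])
qed

text \<open>Each section of \<open>A\<close> lies in a chord of the ball centred on the hyperplane,
  hence so does the centred segment of the same length.\<close>

lemma steiner_subset_cball: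
  fixes A :: "'a::euclidean_space set"
  assumes e: "e \<in> Basis" and A[measurable]: "A \<in> sets borel" and AR: "A \<subseteq> cball 0 R" and R: "0 \<le> R"
  shows "steiner e A \<subseteq> cball 0 R"
proof
  fix x assume x: "x \<in> steiner e A"
  let ?z = "x - (x \<bullet> e) *\<^sub>R e"
  have z: "?z \<bullet> e = 0" using e by (simp add: inner_diff_left)
  let ?S = "{t. t *\<^sub>R e + ?z \<in> A}"
  have xS: "\<bar>x \<bullet> e\<bar> < measure lborel ?S / 2" using x by (simp add: steiner_def)
  have "?S \<noteq> {}"
  proof
    assume *: "?S = {}"
    have "measure lborel ?S = 0" unfolding * by simp
    then show False using xS by linarith
  qed
  then obtain t0 where "t0 *\<^sub>R e + ?z \<in> A" by auto
  then have "norm (t0 *\<^sub>R e + ?z) \<le> R" using AR by auto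
  then have "(norm (t0 *\<^sub>R e + ?z))\<^sup>2 \<le> R\<^sup>2" by (intro power_mono) auto
  then have z2: "(norm ?z)\<^sup>2 \<le> R\<^sup>2" using norm_add_orthogonal_sq[OF e z, of t0] by (smt (verit) zero_le_power2)
  \<comment> \<open>Half the length of the chord that the ball of radius \<open>R\<close> cuts from
    the line through \<open>x\<close> parallel to \<open>e\<close>.\<close>
  define w where "w = sqrt (R\<^sup>2 - (norm ?z)\<^sup>2)"
  have w: "0 \<le> w" "w\<^sup>2 = R\<^sup>2 - (norm ?z)\<^sup>2" using z2 by (auto simp: w_def)
  have "?S \<subseteq> {-w..w}"
  proof
    fix t assume "t \<in> ?S"
    then have "norm (t *\<^sub>R e + ?z) \<le> R" using AR by auto
    then have "(norm (t *\<^sub>R e + ?z))\<^sup>2 \<le> R\<^sup>2" by (intro power_mono) auto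
    then have "t\<^sup>2 \<le> w\<^sup>2" using norm_add_orthogonal_sq[OF e z, of t] w by simp
    then show "t \<in> {-w..w}" using w abs_le_square_iff[of t w] by (auto simp: abs_le_iff)
  qed
  then have "emeasure lborel ?S \<le> emeasure lborel {-w..w}" by (intro emeasure_mono) auto
  then have "ennreal (measure lborel ?S) \<le> ennreal (2 * w)"
    using w by (simp add: emeasure_section_eq_measure[OF e AR R])
  then have "measure lborel ?S \<le> 2 * w" using w by (simp add: ennreal_le_iff)
  then have "\<bar>x \<bullet> e\<bar> \<le> \<bar>w\<bar>" using xS w by simp
  then have "(x \<bullet> e)\<^sup>2 \<le> w\<^sup>2" by (simp add: abs_le_square_iff)
  then have "(norm ((x \<bullet> e) *\<^sub>R e + ?z))\<^sup>2 \<le> R\<^sup>2" using norm_add_orthogonal_sq[OF e z, of "x \<bullet> e"] w by simp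
  then have "(norm x)\<^sup>2 \<le> R\<^sup>2" by simp
  then have "norm x \<le> R" using R by (rule power2_le_imp_le)
  then show "x \<in> cball 0 R" by simp
qed

text \<open>With the hyperplane parts of all points fixed, the integral over their
  \<open>e\<close>-coordinates is of the type treated on the line, and the sections of the
  symmetrised sets are precisely the centred intervals that occur there.\<close>

lemma nn_integral_steiner_mono:
  fixes \<Psi> :: "('j \<Rightarrow> 'a::euclidean_space) \<Rightarrow> ennreal"
  assumes e: "e \<in> Basis" and J: "finite J" and \<Psi>[measurable]: "\<Psi> \<in> borel_measurable (PiM J (\<lambda>_. lborel))"
    and C: "\<And>x. \<Psi> x \<le> ennreal C"
    and u: "\<And>y. box_unimodal J (\<lambda>t. \<Psi> (\<lambda>j\<in>J. t j *\<^sub>R e + emb e (y j)))"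
    and A: "\<And>j. j \<in> J \<Longrightarrow> A j \<in> sets borel" and AR: "\<And>j. j \<in> J \<Longrightarrow> A j \<subseteq> cball 0 R" and R: "0 \<le> R"
  shows "(\<integral>\<^sup>+ x. \<Psi> x * (\<Prod>j\<in>J. indicator (A j) (x j)) \<partial>PiM J (\<lambda>_. lborel))
      \<le> (\<integral>\<^sup>+ x. \<Psi> x * (\<Prod>j\<in>J. indicator (steiner e (A j)) (x j)) \<partial>PiM J (\<lambda>_. lborel))"
proof -
  let ?c = "\<lambda>y t. \<lambda>j\<in>J. t j *\<^sub>R e + emb e (y j)"
  have eq: "(\<integral>\<^sup>+ x. \<Psi> x * (\<Prod>j\<in>J. indicator (B j) (x j)) \<partial>PiM J (\<lambda>_. lborel))
     = (\<integral>\<^sup>+ y. (\<integral>\<^sup>+ t. \<Psi> (?c y t) * (\<Prod>j\<in>J. indicator {t. t *\<^sub>R e + emb e (y j) \<in> B j} (t j)) \<partial>PiM J (\<lambda>_. lborel)) \<partial>PiM J (\<lambda>_. hyp e))"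
    if B: "\<And>j. j \<in> J \<Longrightarrow> B j \<in> sets borel" for B
  proof -
    have [measurable]: "(\<lambda>x. (\<Prod>j\<in>J. indicator (B j) (x j)) :: ennreal) \<in> borel_measurable (PiM J (\<lambda>_. lborel))"
      using B by (intro borel_measurable_prod_indicator_PiM) auto
    have "(\<lambda>x. \<Psi> x * (\<Prod>j\<in>J. indicator (B j) (x j))) \<in> borel_measurable (PiM J (\<lambda>_. lborel))" by measurable
    from nn_integral_PiM_split[OF e J this] show ?thesis
      by (subst \<open>_ = _\<close>) (intro nn_integral_cong arg_cong2[where f="(*)"] refl prod.cong, auto simp: indicator_def)
  qed
  have "(\<integral>\<^sup>+ t. \<Psi> (?c y t) * (\<Prod>j\<in>J. indicator {t. t *\<^sub>R e + emb e (y j) \<in> A j} (t j)) \<partial>PiM J (\<lambda>_. lborel))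
      \<le> (\<integral>\<^sup>+ t. \<Psi> (?c y t) * (\<Prod>j\<in>J. indicator {t. t *\<^sub>R e + emb e (y j) \<in> steiner e (A j)} (t j)) \<partial>PiM J (\<lambda>_. lborel))" for y
  proof -
    have m: "?c y \<in> measurable (PiM J (\<lambda>_. lborel)) (PiM J (\<lambda>_. lborel))"
      by (intro measurable_restrict) auto
    show ?thesis
      unfolding steiner_section[OF e]
      by (rule nn_integral_box_unimodal_le_centred[OF J measurable_compose[OF m \<Psi>] u C])
         (use A AR R in \<open>auto intro!: section_sets le_less_trans[OF emeasure_section_le[OF e AR R]]\<close>)
  qed
  note le = nn_integral_mono[OF this]
  show ?thesis
    by (subst eq, rule A, assumption, subst eq, rule steiner_sets, rule A, assumption) (rule le)
qed

section \<open>Decrease of the distance to a ball under symmetrisation\<close>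

lemma emeasure_ball_section:
  fixes e :: "'a::euclidean_space"
  assumes e: "e \<in> Basis"
  obtains b where "0 \<le> b" "{t. t *\<^sub>R e + emb e y \<in> ball 0 \<rho>} = {t. \<bar>t\<bar> < b}"
proof -
  \<comment> \<open>Half the chord length; the value 0 covers both an empty ball and a line that
    misses the ball.\<close>
  define b where "b = (if 0 < \<rho> then sqrt (max 0 (\<rho>\<^sup>2 - (norm (emb e y))\<^sup>2)) else 0)"
  have "norm (t *\<^sub>R e + emb e y) < \<rho> \<longleftrightarrow> \<bar>t\<bar> < b" for t
  proof (cases "0 < \<rho>")
    case True
    have "norm (t *\<^sub>R e + emb e y) < \<rho> \<longleftrightarrow> (norm (t *\<^sub>R e + emb e y))\<^sup>2 < \<rho>\<^sup>2"
      using True by (auto intro: power_strict_mono power2_less_imp_less[OF _ less_imp_le[OF True]])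
    also have "\<dots> \<longleftrightarrow> t\<^sup>2 < max 0 (\<rho>\<^sup>2 - (norm (emb e y))\<^sup>2)"
      using norm_add_orthogonal_sq[OF e emb_orthogonal(2)[OF e], of t y] by (auto simp: max_def) (smt (verit) zero_le_power2)+
    also have "\<dots> \<longleftrightarrow> \<bar>t\<bar> < b"
      using True real_less_rsqrt real_sqrt_less_iff[of "t\<^sup>2" "max 0 (\<rho>\<^sup>2 - (norm (emb e y))\<^sup>2)"] by (simp add: b_def)
    finally show ?thesis .
  qed (use norm_ge_zero[of "t *\<^sub>R e + emb e y"] in \<open>auto simp: b_def not_less intro: order_trans\<close>)
  then show thesis using that[of b] by (auto simp: b_def)
qed

text \<open>On every line parallel to \<open>e\<close>, symmetrisation removes the smaller of the two parts of the
  symmetric difference with the ball; the product bounds the minimum since both parts have length at most \<open>2 * R\<close>.\<close>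
lemma steiner_section_contract:
  fixes A :: "'a::euclidean_space set"
  assumes e: "e \<in> Basis" and A[measurable]: "A \<in> sets borel" and AR: "A \<subseteq> cball 0 R" and R: "0 < R" and \<rho>: "\<rho> \<le> R"
  defines "B \<equiv> ball 0 \<rho>"
  defines "S \<equiv> \<lambda>A y. {t. t *\<^sub>R e + emb e y \<in> A}"
  shows "emeasure lborel (S (steiner e A - B) y) + ennreal (1 / (2 * R)) * (emeasure lborel (S (A - B) y) * emeasure lborel (S (B - A) y))
     \<le> emeasure lborel (S (A - B) y)"
proof -
  have B[measurable]: "B \<in> sets borel" and BR: "B \<subseteq> cball 0 R" using \<rho> by (auto simp: B_def)
  have fin: "emeasure lborel (S X y) = ennreal (measure lborel (S X y))" "measure lborel (S X y) \<le> 2 * R" if "X \<subseteq> cball 0 R" for X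
  proof -
    show eq: "emeasure lborel (S X y) = ennreal (measure lborel (S X y))"
      unfolding S_def using emeasure_section_eq_measure[OF e that] R by simp
    have "ennreal (measure lborel (S X y)) \<le> ennreal (2 * R)"
      unfolding eq[symmetric] unfolding S_def using emeasure_section_le[OF e that] R by simp
    then show "measure lborel (S X y) \<le> 2 * R" using R by (simp add: ennreal_le_iff)
  qed
  have AB: "A - B \<subseteq> cball 0 R" "B - A \<subseteq> cball 0 R" using AR BR by blast+
  define a b c where "a = measure lborel (S (A - B) y)" and "b = measure lborel (S (B - A) y)" and "c = measure lborel (S (A \<inter> B) y)"
  have abc: "0 \<le> a" "0 \<le> b" "a \<le> 2 * R" "b \<le> 2 * R"
    using fin(2)[of "A - B"] fin(2)[of "B - A"] AR BR by (auto simp: a_def b_def)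
  have Sm: "S X y \<in> sets borel" if "X \<in> sets borel" for X unfolding S_def using that by (rule section_sets)
  have un: "measure lborel (S X y) = measure lborel (S (X - Y) y) + measure lborel (S (X \<inter> Y) y)"
    if "X \<in> sets borel" "Y \<in> sets borel" "X \<subseteq> cball 0 R" for X Y
  proof -
    have "S X y = S (X - Y) y \<union> S (X \<inter> Y) y" by (auto simp: S_def)
    moreover have "X - Y \<subseteq> cball 0 R" "X \<inter> Y \<subseteq> cball 0 R" using that by auto
    note fin(1)[OF this(1)] fin(1)[OF this(2)]
    ultimately show ?thesis
      using that by (simp add: measure_Union Sm disjoint_iff) (auto intro!: measure_Union Sm simp: S_def)
  qed
  have \<alpha>: "measure lborel (S A y) = a + c" using un[of A B] AR by (simp add: a_def c_def)
  have \<beta>: "measure lborel (S B y) = b + c" using un[of B A] BR by (simp add: b_def c_def Int_commute)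
  obtain h where h: "0 \<le> h" "S B y = {t. \<bar>t\<bar> < h}"
    using emeasure_ball_section[OF e, of y \<rho>] by (auto simp: B_def S_def)
  have "measure lborel (S B y) = 2 * h"
    unfolding h(2) abs_less_eq_interval using h(1) by simp
  then have h2: "h = (b + c) / 2" using \<beta> by simp
  \<comment> \<open>Both sections are now centred intervals, of lengths a + c and b + c. One
    contains the other, so the excess over the ball has length at most a - b if this is positive,
    and is empty otherwise.\<close>
  have eqS: "S (steiner e A - B) y = {t. \<bar>t\<bar> < (a + c) / 2} - {t. \<bar>t\<bar> < (b + c) / 2}"
  proof -
    have "S (steiner e A - B) y = S (steiner e A) y - S B y" by (auto simp: S_def)
    also have "S (steiner e A) y = {t. \<bar>t\<bar> < (a + c) / 2}"
      using \<alpha> by (simp add: S_def steiner_section[OF e])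
    finally show ?thesis using h h2 by simp
  qed
  have "emeasure lborel (S (steiner e A - B) y) \<le> ennreal (max 0 (a - b))"
  proof (cases "a \<le> b")
    case True
    then have "S (steiner e A - B) y = {}" unfolding eqS by auto
    then show ?thesis by simp
  next
    case False
    have c0: "0 \<le> c" by (simp add: c_def)
    have "emeasure lborel (S (steiner e A - B) y) \<le> emeasure lborel ({- ((a + c) / 2)..- ((b + c) / 2)} \<union> {(b + c) / 2..(a + c) / 2})"
    proof (intro emeasure_mono subsetI)
      fix t assume "t \<in> S (steiner e A - B) y"
      then have "(b + c) / 2 \<le> \<bar>t\<bar>" "\<bar>t\<bar> < (a + c) / 2" by (auto simp: eqS)
      then show "t \<in> {- ((a + c) / 2)..- ((b + c) / 2)} \<union> {(b + c) / 2..(a + c) / 2}"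
        unfolding Un_iff atLeastAtMost_iff by linarith
    qed auto
    also have "\<dots> \<le> emeasure lborel {- ((a + c) / 2)..- ((b + c) / 2)} + emeasure lborel {(b + c) / 2..(a + c) / 2}"
      by (intro emeasure_subadditive) auto
    also have "\<dots> = ennreal (a - b)"
      using False by (simp add: ennreal_plus[symmetric] diff_divide_distrib[symmetric] del: ennreal_plus)
    finally show ?thesis using False by simp
  qed
  then have "emeasure lborel (S (steiner e A - B) y) + ennreal (1 / (2 * R)) * (emeasure lborel (S (A - B) y) * emeasure lborel (S (B - A) y))
     \<le> ennreal (max 0 (a - b)) + ennreal (1 / (2 * R)) * (ennreal a * ennreal b)"
    using fin(1)[OF AB(1)] fin(1)[OF AB(2)] by (intro add_mono) (auto simp: a_def b_def)
  also have "\<dots> = ennreal (max 0 (a - b) + a * b / (2 * R))"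
    using abc R by (simp add: ennreal_mult[symmetric] ennreal_plus[symmetric] del: ennreal_plus)
  also have "\<dots> \<le> ennreal a"
  proof (rule ennreal_leI, cases "a \<le> b")
    case True
    have "a * b \<le> a * (2 * R)" using abc by (intro mult_left_mono) auto
    then show "max 0 (a - b) + a * b / (2 * R) \<le> a" using True R by (simp add: field_simps)
  next
    case False
    have "a * b \<le> 2 * R * b" using abc by (intro mult_right_mono) auto
    then have "a * b / (2 * R) \<le> b" using R by (simp add: field_simps)
    then show "max 0 (a - b) + a * b / (2 * R) \<le> a" using False by simp
  qed
  also have "\<dots> = emeasure lborel (S (A - B) y)"
    using fin(1)[OF AB(1)] by (simp add: a_def)
  finally show ?thesis .
qed

lemma emeasure_shift_eq:
  fixes P Q :: "'a::euclidean_space set"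
  assumes [measurable]: "P \<in> sets borel" "Q \<in> sets borel"
  shows "emeasure lborel {x\<in>P. x + z \<in> Q} = (\<integral>\<^sup>+ x. indicator P x * indicator Q (x + z) \<partial>lborel)"
proof -
  have "(\<lambda>x. indicator P x * indicator Q (x + z) :: ennreal) = indicator {x\<in>P. x + z \<in> Q}"
    by (auto simp: indicator_def fun_eq_iff)
  moreover have "{x\<in>P. x + z \<in> Q} \<in> sets borel" by measurable
  ultimately show ?thesis by simp
qed

text \<open>Both sides count pairs of points of \<open>P\<close> and \<open>Q\<close> on a common
  line parallel to \<open>e\<close>; the substitution of t + s for s decouples them. The left side,
  written with displacements, makes sense in every direction and can be averaged.\<close>

lemma nn_integral_section_product:
  fixes P Q :: "'a::euclidean_space set"
  assumes e: "e \<in> Basis" and P[measurable]: "P \<in> sets borel" and Q[measurable]: "Q \<in> sets borel"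
  shows "(\<integral>\<^sup>+ s. emeasure lborel {x\<in>P. x + s *\<^sub>R e \<in> Q} \<partial>lborel)
    = (\<integral>\<^sup>+ y. emeasure lborel {t. t *\<^sub>R e + emb e y \<in> P} * emeasure lborel {t. t *\<^sub>R e + emb e y \<in> Q} \<partial>hyp e)"
proof -
  interpret H: sigma_finite_measure "hyp e" by (rule sigma_finite_hyp)
  interpret HP: pair_sigma_finite lborel "hyp e" ..
  let ?i = "\<lambda>y t. indicator P (t *\<^sub>R e + emb e y) :: ennreal" and ?q = "\<lambda>y t. indicator Q (t *\<^sub>R e + emb e y) :: ennreal"
  have "(\<integral>\<^sup>+ s. emeasure lborel {x\<in>P. x + s *\<^sub>R e \<in> Q} \<partial>lborel)
      = (\<integral>\<^sup>+ s. (\<integral>\<^sup>+ x. indicator P x * indicator Q (x + s *\<^sub>R e) \<partial>lborel) \<partial>lborel)"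
    by (simp only: emeasure_shift_eq[OF P Q])
  also have "\<dots> = (\<integral>\<^sup>+ s. (\<integral>\<^sup>+ y. (\<integral>\<^sup>+ t. ?i y t * indicator Q ((t *\<^sub>R e + emb e y) + s *\<^sub>R e) \<partial>lborel) \<partial>hyp e) \<partial>lborel)"
    by (intro nn_integral_cong nn_integral_lborel_split[OF e]) measurable
  also have "\<dots> = (\<integral>\<^sup>+ y. (\<integral>\<^sup>+ s. (\<integral>\<^sup>+ t. ?i y t * indicator Q ((t *\<^sub>R e + emb e y) + s *\<^sub>R e) \<partial>lborel) \<partial>lborel) \<partial>hyp e)"
    by (rule HP.Fubini'[symmetric]) measurable
  also have "\<dots> = (\<integral>\<^sup>+ y. (\<integral>\<^sup>+ t. ?i y t \<partial>lborel) * (\<integral>\<^sup>+ t. ?q y t \<partial>lborel) \<partial>hyp e)"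
  proof (rule nn_integral_cong)
    fix y assume [measurable]: "y \<in> space (hyp e)"
    have "(\<integral>\<^sup>+ s. (\<integral>\<^sup>+ t. ?i y t * indicator Q ((t *\<^sub>R e + emb e y) + s *\<^sub>R e) \<partial>lborel) \<partial>lborel)
       = (\<integral>\<^sup>+ t. (\<integral>\<^sup>+ s. ?i y t * indicator Q ((t *\<^sub>R e + emb e y) + s *\<^sub>R e) \<partial>lborel) \<partial>lborel)"
      by (rule lborel_pair.Fubini') measurable
    also have "\<dots> = (\<integral>\<^sup>+ t. ?i y t * (\<integral>\<^sup>+ s. ?q y s \<partial>lborel) \<partial>lborel)"
    proof (rule nn_integral_cong)
      fix t :: real
      have "(\<integral>\<^sup>+ s. ?i y t * indicator Q ((t *\<^sub>R e + emb e y) + s *\<^sub>R e) \<partial>lborel) = ?i y t * (\<integral>\<^sup>+ s. ?q y (t + 1 * s) \<partial>lborel)"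
        by (subst nn_integral_cmult[symmetric]) (auto simp: algebra_simps)
      also have "(\<integral>\<^sup>+ s. ?q y (t + 1 * s) \<partial>lborel) = (\<integral>\<^sup>+ s. ?q y s \<partial>lborel)"
        by (subst (2) nn_integral_real_affine[where c=1 and t=t]) auto
      finally show "(\<integral>\<^sup>+ s. ?i y t * indicator Q ((t *\<^sub>R e + emb e y) + s *\<^sub>R e) \<partial>lborel) = ?i y t * (\<integral>\<^sup>+ s. ?q y s \<partial>lborel)" .
    qed
    also have "\<dots> = (\<integral>\<^sup>+ t. ?i y t \<partial>lborel) * (\<integral>\<^sup>+ t. ?q y t \<partial>lborel)"
      by (rule nn_integral_multc) measurable
    finally show "(\<integral>\<^sup>+ s. (\<integral>\<^sup>+ t. ?i y t * indicator Q ((t *\<^sub>R e + emb e y) + s *\<^sub>R e) \<partial>lborel) \<partial>lborel)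
      = (\<integral>\<^sup>+ t. ?i y t \<partial>lborel) * (\<integral>\<^sup>+ t. ?q y t \<partial>lborel)" .
  qed
  also have "(\<lambda>y. (\<integral>\<^sup>+ t. ?i y t \<partial>lborel) * (\<integral>\<^sup>+ t. ?q y t \<partial>lborel)) = (\<lambda>y. emeasure lborel {t. t *\<^sub>R e + emb e y \<in> P} * emeasure lborel {t. t *\<^sub>R e + emb e y \<in> Q})"
  proof
    fix y
    show "(\<integral>\<^sup>+ t. ?i y t \<partial>lborel) * (\<integral>\<^sup>+ t. ?q y t \<partial>lborel) = emeasure lborel {t. t *\<^sub>R e + emb e y \<in> P} * emeasure lborel {t. t *\<^sub>R e + emb e y \<in> Q}"
      by (simp add: nn_integral_indicator_section)
  qed
  finally show ?thesis .
qed

lemma steiner_contract: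
  fixes A :: "'a::euclidean_space set"
  assumes e: "e \<in> Basis" and A[measurable]: "A \<in> sets borel" and AR: "A \<subseteq> cball 0 R" and R: "0 < R" and \<rho>: "\<rho> \<le> R"
  defines "B \<equiv> ball 0 \<rho>"
  shows "emeasure lborel (steiner e A - B) + ennreal (1 / (2 * R)) * (\<integral>\<^sup>+ s. emeasure lborel {x\<in>A - B. x + s *\<^sub>R e \<in> B - A} \<partial>lborel)
     \<le> emeasure lborel (A - B)"
proof -
  let ?S = "\<lambda>A y. emeasure lborel {t. t *\<^sub>R e + emb e y \<in> A}"
  have B[measurable]: "B \<in> sets borel" by (simp add: B_def)
  note steiner_sets[measurable]
  have Sm[measurable]: "?S X \<in> borel_measurable (hyp e)" if [measurable]: "X \<in> sets borel" for X
  proof -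
    have "(\<lambda>y. \<integral>\<^sup>+ t. indicator X (t *\<^sub>R e + emb e y) \<partial>lborel) \<in> borel_measurable (hyp e)" by measurable
    then show ?thesis by (simp add: nn_integral_indicator_section)
  qed
  have "emeasure lborel (steiner e A - B) + ennreal (1 / (2 * R)) * (\<integral>\<^sup>+ s. emeasure lborel {x\<in>A - B. x + s *\<^sub>R e \<in> B - A} \<partial>lborel)
     = (\<integral>\<^sup>+ y. ?S (steiner e A - B) y \<partial>hyp e) + ennreal (1 / (2 * R)) * (\<integral>\<^sup>+ y. ?S (A - B) y * ?S (B - A) y \<partial>hyp e)"
    by (subst emeasure_eq_sections[OF e], measurable, subst nn_integral_section_product[OF e], measurable)
  also have "\<dots> = (\<integral>\<^sup>+ y. ?S (steiner e A - B) y + ennreal (1 / (2 * R)) * (?S (A - B) y * ?S (B - A) y) \<partial>hyp e)"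
    by (subst nn_integral_add) (auto simp: nn_integral_cmult)
  also have "\<dots> \<le> (\<integral>\<^sup>+ y. ?S (A - B) y \<partial>hyp e)"
    unfolding B_def by (intro nn_integral_mono steiner_section_contract[OF e A AR R \<rho>])
  also have "\<dots> = emeasure lborel (A - B)"
    by (rule emeasure_eq_sections[OF e, symmetric]) measurable
  finally show ?thesis .
qed

section \<open>Choosing a direction\<close>

lemma nn_integral_lborel_translate:
  fixes f :: "'a::euclidean_space \<Rightarrow> ennreal"
  assumes f: "f \<in> borel_measurable borel"
  shows "(\<integral>\<^sup>+ z. f (c + z) \<partial>lborel) = (\<integral>\<^sup>+ z. f z \<partial>lborel)"
proof -
  have "(\<integral>\<^sup>+ z. f z \<partial>lborel) = (\<integral>\<^sup>+ z. f z \<partial>distr lborel borel ((+) c))"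
    by (simp only: lborel_distr_plus)
  also have "\<dots> = (\<integral>\<^sup>+ z. f (c + z) \<partial>lborel)"
    using f by (subst nn_integral_distr) auto
  finally show ?thesis by simp
qed

lemma nn_integral_lborel_scaleR:
  fixes f :: "'a::euclidean_space \<Rightarrow> ennreal"
  assumes f: "f \<in> borel_measurable borel" and c: "c \<noteq> 0"
  shows "(\<integral>\<^sup>+ z. f z \<partial>lborel) = ennreal (\<bar>c\<bar> ^ DIM('a)) * (\<integral>\<^sup>+ z. f (c *\<^sub>R z) \<partial>lborel)"
  using f by (subst lborel_affine[OF c, of 0]) (simp add: nn_integral_density nn_integral_distr nn_integral_cmult)

text \<open>Averaging over directions, in the form of an integral over the annulus \<open>1 < norm w < 2\<close>.\<close>
lemma exists_good_direction:
  fixes P Q :: "'j \<Rightarrow> 'a::euclidean_space set"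
  assumes J: "finite J" and R: "0 < R"
    and P: "\<And>j. j \<in> J \<Longrightarrow> P j \<in> sets borel" "\<And>j. j \<in> J \<Longrightarrow> P j \<subseteq> cball 0 R"
    and Q: "\<And>j. j \<in> J \<Longrightarrow> Q j \<in> sets borel" "\<And>j. j \<in> J \<Longrightarrow> Q j \<subseteq> cball 0 R"
  defines "\<kappa> \<equiv> 1 / (4 * (2 * R) ^ (DIM('a) - 1) * measure lborel (ball (0::'a) 2))"
  shows "\<exists>\<theta>. norm \<theta> = 1 \<and> ennreal \<kappa> * (\<Sum>j\<in>J. emeasure lborel (P j) * emeasure lborel (Q j))
     \<le> (\<Sum>j\<in>J. \<integral>\<^sup>+ s. emeasure lborel {x\<in>P j. x + s *\<^sub>R \<theta> \<in> Q j} \<partial>lborel)"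
proof -
  define v where "v = measure lborel (ball (0::'a) 2)"
  have v: "0 < v" unfolding v_def by (rule content_ball_pos) simp
  \<comment> \<open>2 \<kappa> v is the lower bound that the averaging yields for norms up to 2 R.
    The factor 2 is the margin that makes the final comparison contradictory.\<close>
  have \<kappa>: "0 < \<kappa>" "2 * \<kappa> * v = 1 / (2 * (2 * R) ^ (DIM('a) - 1))"
    using R v by (auto simp: \<kappa>_def v_def[symmetric] field_simps)
  \<comment> \<open>The sum of the correlations of the pairs \<open>P j\<close>, \<open>Q j\<close>.
    Its total integral is \<open>S\<close>, its integrals along lines through the origin are the
    quantities to be bounded from below, and it vanishes beyond norm 2 R.\<close>
  define g where "g z = (\<Sum>j\<in>J. \<integral>\<^sup>+ x. indicator (P j) x * indicator (Q j) (x + z) \<partial>lborel)" for z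
  have g[measurable]: "g \<in> borel_measurable borel"
    unfolding g_def[abs_def]
  proof (intro borel_measurable_sum)
    fix j assume "j \<in> J"
    then have [measurable]: "P j \<in> sets borel" "Q j \<in> sets borel" using P Q by auto
    show "(\<lambda>z. \<integral>\<^sup>+ x. indicator (P j) x * indicator (Q j) (x + z) \<partial>lborel) \<in> borel_measurable borel" by measurable
  qed
  have g_eq: "(\<integral>\<^sup>+ s. g (s *\<^sub>R \<theta>) \<partial>lborel) = (\<Sum>j\<in>J. \<integral>\<^sup>+ s. emeasure lborel {x\<in>P j. x + s *\<^sub>R \<theta> \<in> Q j} \<partial>lborel)" for \<theta>
  proof -
    have "(\<integral>\<^sup>+ s. g (s *\<^sub>R \<theta>) \<partial>lborel) = (\<Sum>j\<in>J. \<integral>\<^sup>+ s. (\<integral>\<^sup>+ x. indicator (P j) x * indicator (Q j) (x + s *\<^sub>R \<theta>) \<partial>lborel) \<partial>lborel)"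
      unfolding g_def
    proof (rule nn_integral_sum)
      fix j assume "j \<in> J"
      then have [measurable]: "P j \<in> sets borel" "Q j \<in> sets borel" using P Q by auto
      show "(\<lambda>s. \<integral>\<^sup>+ x. indicator (P j) x * indicator (Q j) (x + s *\<^sub>R \<theta>) \<partial>lborel) \<in> borel_measurable lborel" by measurable
    qed
    also have "\<dots> = (\<Sum>j\<in>J. \<integral>\<^sup>+ s. emeasure lborel {x\<in>P j. x + s *\<^sub>R \<theta> \<in> Q j} \<partial>lborel)"
      using P Q by (intro sum.cong refl) (simp only: emeasure_shift_eq)
    finally show ?thesis .
  qed
  define S where "S = (\<Sum>j\<in>J. emeasure lborel (P j) * emeasure lborel (Q j))"
  have gS: "(\<integral>\<^sup>+ z. g z \<partial>lborel) = S"
  proof -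
    have "(\<integral>\<^sup>+ z. g z \<partial>lborel) = (\<Sum>j\<in>J. \<integral>\<^sup>+ z. (\<integral>\<^sup>+ x. indicator (P j) x * indicator (Q j) (x + z) \<partial>lborel) \<partial>lborel)"
      unfolding g_def
    proof (rule nn_integral_sum)
      fix j assume "j \<in> J"
      then have [measurable]: "P j \<in> sets borel" "Q j \<in> sets borel" using P Q by auto
      show "(\<lambda>z. \<integral>\<^sup>+ x. indicator (P j) x * indicator (Q j) (x + z) \<partial>lborel) \<in> borel_measurable lborel" by measurable
    qed
    also have "\<dots> = S"
      unfolding S_def
    proof (rule sum.cong[OF refl])
      fix j assume "j \<in> J"
      then have [measurable]: "P j \<in> sets borel" "Q j \<in> sets borel" using P Q by auto
      have "(\<integral>\<^sup>+ z. (\<integral>\<^sup>+ x. indicator (P j) x * indicator (Q j) (x + z) \<partial>lborel) \<partial>lborel)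
         = (\<integral>\<^sup>+ x. (\<integral>\<^sup>+ z. indicator (P j) x * indicator (Q j) (x + z) \<partial>lborel) \<partial>lborel)"
        by (rule lborel_pair.Fubini') measurable
      also have "\<dots> = (\<integral>\<^sup>+ x. indicator (P j) x * emeasure lborel (Q j) \<partial>lborel)"
        by (simp add: nn_integral_cmult nn_integral_lborel_translate)
      also have "\<dots> = emeasure lborel (P j) * emeasure lborel (Q j)"
        by (simp add: nn_integral_multc)
      finally show "(\<integral>\<^sup>+ z. (\<integral>\<^sup>+ x. indicator (P j) x * indicator (Q j) (x + z) \<partial>lborel) \<partial>lborel) = emeasure lborel (P j) * emeasure lborel (Q j)" .
    qed
    finally show ?thesis .
  qed
  have Sfin: "S < \<infinity>"
  proof -
    have "emeasure lborel X < \<infinity>" if "X \<subseteq> cball 0 R" for X :: "'a set"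
      using emeasure_bounded_finite[OF bounded_subset[OF bounded_cball that]] by simp
    then show ?thesis unfolding S_def using J P Q by (simp add: ennreal_mult_less_top)
  qed
  have g0: "g z = 0" if z: "2 * R < norm z" for z
  proof -
    have "indicator (P j) x * indicator (Q j) (x + z) = (0::ennreal)" if "j \<in> J" for j x
    proof (rule ccontr)
      assume "indicator (P j) x * indicator (Q j) (x + z) \<noteq> (0::ennreal)"
      then have "x \<in> P j" "x + z \<in> Q j" by (auto simp: indicator_def split: if_splits)
      then have "norm x \<le> R" "norm (x + z) \<le> R" using P(2)[OF \<open>j \<in> J\<close>] Q(2)[OF \<open>j \<in> J\<close>] by auto
      moreover have "norm z \<le> norm (x + z) + norm x" using norm_triangle_ineq4[of "x + z" x] by simp
      ultimately show False using z by simp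
    qed
    then show ?thesis
      unfolding g_def by (intro sum.neutral ballI) (simp only: nn_integral_const mult_zero_left)
  qed
  have "\<exists>\<theta>. norm \<theta> = 1 \<and> ennreal \<kappa> * S \<le> (\<integral>\<^sup>+ s. g (s *\<^sub>R \<theta>) \<partial>lborel)"
  proof (rule ccontr)
    assume "\<not> ?thesis"
    then have small: "(\<integral>\<^sup>+ s. g (s *\<^sub>R \<theta>) \<partial>lborel) < ennreal \<kappa> * S" if "norm \<theta> = 1" for \<theta>
      using that by (auto simp: not_le)
    obtain b :: 'a where "b \<in> Basis" using nonempty_Basis by blast
    then have "ennreal \<kappa> * S \<noteq> 0" using small[of b] by auto
    define X where "X = (\<integral>\<^sup>+ w. (\<integral>\<^sup>+ s. indicator {w. 1 < norm w \<and> norm w < 2} w * (indicator {0<..} s * g (s *\<^sub>R w)) \<partial>lborel) \<partial>(lborel :: 'a measure))"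
    \<comment> \<open>Upper bound for \<open>X\<close>: stretching the inner variable replaces w by
      the unit vector w / |w| at the cost of a factor |w| >= 1, and the annulus is contained in the
      ball of volume \<open>v\<close>.\<close>
    have "X \<le> (\<integral>\<^sup>+ w. ennreal \<kappa> * S * indicator (ball 0 2) w \<partial>(lborel :: 'a measure))"
      unfolding X_def
    proof (rule nn_integral_mono)
      fix w :: 'a
      show "(\<integral>\<^sup>+ s. indicator {w. 1 < norm w \<and> norm w < 2} w * (indicator {0<..} s * g (s *\<^sub>R w)) \<partial>lborel) \<le> ennreal \<kappa> * S * indicator (ball 0 2) w"
      proof (cases "1 < norm w \<and> norm w < 2")
        case True
        let ?\<theta> = "w /\<^sub>R norm w"
        have "(\<integral>\<^sup>+ s. indicator {w. 1 < norm w \<and> norm w < 2} w * (indicator {0<..} s * g (s *\<^sub>R w)) \<partial>lborel) \<le> (\<integral>\<^sup>+ s. g (s *\<^sub>R w) \<partial>lborel)"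
          by (intro nn_integral_mono) (auto simp: indicator_def)
        also have "\<dots> \<le> ennreal \<bar>norm w\<bar> * (\<integral>\<^sup>+ s. g (s *\<^sub>R w) \<partial>lborel)"
        proof -
          have "1 \<le> ennreal \<bar>norm w\<bar>" using True ennreal_leI[of 1 "norm w"] by simp
          from mult_right_mono[OF this, of "\<integral>\<^sup>+ s. g (s *\<^sub>R w) \<partial>lborel"] show ?thesis by simp
        qed
        also have "\<dots> = ennreal \<bar>norm w\<bar> * (\<integral>\<^sup>+ s. g ((0 + norm w * s) *\<^sub>R ?\<theta>) \<partial>lborel)"
        proof -
          have eq: "(0 + norm w * s) *\<^sub>R ?\<theta> = s *\<^sub>R w" for s
            using True by (simp add: field_simps)
          show ?thesis by (simp only: eq)
        qed
        also have "\<dots> = (\<integral>\<^sup>+ s. g (s *\<^sub>R ?\<theta>) \<partial>lborel)"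
          using True by (intro nn_integral_real_affine[symmetric]) auto
        also have "\<dots> \<le> ennreal \<kappa> * S"
        proof -
          have "norm w \<noteq> 0" using True by auto
          then have "norm ?\<theta> = 1" by simp
          from less_imp_le[OF small[OF this]] show ?thesis .
        qed
        finally show ?thesis using True by simp
      qed simp
    qed
    also have "\<dots> = ennreal \<kappa> * S * emeasure lborel (ball (0::'a) 2)"
      by (rule nn_integral_cmult_indicator) simp
    also have "emeasure lborel (ball (0::'a) 2) = ennreal v"
      unfolding v_def using emeasure_bounded_finite[OF bounded_ball, of "0::'a" 2]
      by (intro emeasure_eq_ennreal_measure) auto
    finally have upper: "X \<le> ennreal \<kappa> * S * ennreal v" .
    \<comment> \<open>Lower bound for \<open>X\<close> in the other order, with z = s w and Jacobian
      s^(-n): for 0 < |z| <= 2 R the integral of s^(-n) over |z| / 2 < s < |z| is at least |z|^(1-n)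
      / 2, hence at least 2 \<kappa> v.\<close>
    have "ennreal (2 * \<kappa> * v) * S = (\<integral>\<^sup>+ z. ennreal (2 * \<kappa> * v) * g z \<partial>lborel)"
      by (simp add: nn_integral_cmult gS)
    also have "\<dots> \<le> (\<integral>\<^sup>+ z. (\<integral>\<^sup>+ s. indicator {0<..} s * (ennreal (1 / s ^ DIM('a)) * (indicator {z. s < norm z \<and> norm z < 2 * s} z * g z)) \<partial>lborel) \<partial>(lborel :: 'a measure))"
    proof (rule nn_integral_mono_AE)
      have "AE z in lborel. z \<noteq> (0::'a)" by (rule AE_lborel_singleton)
      then show "AE z in lborel. ennreal (2 * \<kappa> * v) * g z \<le> (\<integral>\<^sup>+ s. indicator {0<..} s * (ennreal (1 / s ^ DIM('a)) * (indicator {z. s < norm z \<and> norm z < 2 * s} z * g z)) \<partial>lborel)"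
      proof (rule AE_mp, intro AE_I2 impI)
        fix z :: 'a assume z: "z \<noteq> 0"
        show "ennreal (2 * \<kappa> * v) * g z \<le> (\<integral>\<^sup>+ s. indicator {0<..} s * (ennreal (1 / s ^ DIM('a)) * (indicator {z. s < norm z \<and> norm z < 2 * s} z * g z)) \<partial>lborel)"
        proof (cases "norm z \<le> 2 * R")
          case True
          let ?r = "norm z"
          have dim: "?r ^ DIM('a) = ?r * ?r ^ (DIM('a) - 1)" by (simp add: power_Suc[symmetric] del: power_Suc)
          have "2 * \<kappa> * v \<le> 1 / (2 * ?r ^ (DIM('a) - 1))"
            unfolding \<kappa>(2) using True z R by (intro divide_left_mono mult_left_mono power_mono) auto
          also have "\<dots> = 1 / ?r ^ DIM('a) * (?r / 2)" using z unfolding dim by simp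
          finally have "ennreal (2 * \<kappa> * v) * g z \<le> ennreal (1 / ?r ^ DIM('a) * (?r / 2)) * g z"
            by (intro mult_right_mono ennreal_leI) auto
          also have "\<dots> = (\<integral>\<^sup>+ s. ennreal (1 / ?r ^ DIM('a)) * g z * indicator {?r / 2<..<?r} s \<partial>lborel)"
            by (subst nn_integral_cmult_indicator, simp, subst ennreal_mult) (simp_all add: mult_ac)
          also have "\<dots> \<le> (\<integral>\<^sup>+ s. indicator {0<..} s * (ennreal (1 / s ^ DIM('a)) * (indicator {z. s < norm z \<and> norm z < 2 * s} z * g z)) \<partial>lborel)"
          proof (rule nn_integral_mono)
            fix s :: real
            show "ennreal (1 / ?r ^ DIM('a)) * g z * indicator {?r / 2<..<?r} s \<le> indicator {0<..} s * (ennreal (1 / s ^ DIM('a)) * (indicator {z. s < norm z \<and> norm z < 2 * s} z * g z))"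
            proof (cases "s \<in> {?r / 2<..<?r}")
              case True
              then have s: "0 < s" "s < ?r" "?r < 2 * s" using z by (auto intro: le_less_trans[of 0 "?r / 2"])
              then have "1 / ?r ^ DIM('a) \<le> 1 / s ^ DIM('a)"
                using z by (intro divide_left_mono power_mono mult_pos_pos) auto
              then show ?thesis using True s by (auto intro!: mult_right_mono ennreal_leI)
            qed simp
          qed
          finally show ?thesis .
        qed (simp add: g0)
      qed
    qed
    also have "\<dots> = (\<integral>\<^sup>+ s. (\<integral>\<^sup>+ z. indicator {0<..} s * (ennreal (1 / s ^ DIM('a)) * (indicator {z. s < norm z \<and> norm z < 2 * s} z * g z)) \<partial>lborel) \<partial>lborel)"
      by (rule lborel_pair.Fubini') measurable
    also have "\<dots> = (\<integral>\<^sup>+ s. (\<integral>\<^sup>+ w. indicator {w. 1 < norm w \<and> norm w < 2} w * (indicator {0<..} s * g (s *\<^sub>R w)) \<partial>lborel) \<partial>lborel)"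
    proof (rule nn_integral_cong)
      fix s :: real
      show "(\<integral>\<^sup>+ z. indicator {0<..} s * (ennreal (1 / s ^ DIM('a)) * (indicator {z. s < norm z \<and> norm z < 2 * s} z * g z)) \<partial>lborel)
        = (\<integral>\<^sup>+ w. indicator {w. 1 < norm w \<and> norm w < 2} w * (indicator {0<..} s * g (s *\<^sub>R w)) \<partial>lborel)"
      proof (cases "0 < s")
        case True
        have "(\<integral>\<^sup>+ z. indicator {0<..} s * (ennreal (1 / s ^ DIM('a)) * (indicator {z. s < norm z \<and> norm z < 2 * s} z * g z)) \<partial>lborel)
          = ennreal (1 / s ^ DIM('a)) * (\<integral>\<^sup>+ z. indicator {z. s < norm z \<and> norm z < 2 * s} z * g z \<partial>lborel)"
          using True by (simp add: nn_integral_cmult)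
        also have "(\<integral>\<^sup>+ z. indicator {z. s < norm z \<and> norm z < 2 * s} z * g z \<partial>lborel)
          = ennreal (\<bar>s\<bar> ^ DIM('a)) * (\<integral>\<^sup>+ z. indicator {z. s < norm z \<and> norm z < 2 * s} (s *\<^sub>R z) * g (s *\<^sub>R z) \<partial>(lborel :: 'a measure))"
          using True by (intro nn_integral_lborel_scaleR) auto
        also have "ennreal (1 / s ^ DIM('a)) * (ennreal (\<bar>s\<bar> ^ DIM('a)) * (\<integral>\<^sup>+ z. indicator {z. s < norm z \<and> norm z < 2 * s} (s *\<^sub>R z) * g (s *\<^sub>R z) \<partial>(lborel :: 'a measure)))
          = (\<integral>\<^sup>+ z. indicator {z. s < norm z \<and> norm z < 2 * s} (s *\<^sub>R z) * g (s *\<^sub>R z) \<partial>(lborel :: 'a measure))"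
          using True by (simp add: mult.assoc[symmetric] ennreal_mult[symmetric])
        also have "\<dots> = (\<integral>\<^sup>+ w. indicator {w. 1 < norm w \<and> norm w < 2} w * (indicator {0<..} s * g (s *\<^sub>R w)) \<partial>lborel)"
          using True by (intro nn_integral_cong) (auto simp: indicator_def)
        finally show ?thesis .
      qed simp
    qed
    also have "\<dots> = X"
      unfolding X_def by (rule lborel_pair.Fubini'[symmetric]) measurable
    finally have "ennreal (2 * \<kappa> * v) * S \<le> ennreal \<kappa> * S * ennreal v" using upper by (rule order_trans)
    moreover obtain r where r: "S = ennreal r" "0 \<le> r" using Sfin by (cases S) auto
    moreover have "r \<noteq> 0" using \<open>ennreal \<kappa> * S \<noteq> 0\<close> r by auto
    ultimately show False using \<kappa>(1) v by (simp add: ennreal_mult[symmetric] ennreal_le_iff)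
  qed
  then show ?thesis unfolding g_eq S_def .
qed

section \<open>Rotations\<close>

lemma orthogonal_transformation_measurable:
  fixes T :: "'a::euclidean_space \<Rightarrow> 'a"
  assumes "orthogonal_transformation T"
  shows "T \<in> borel_measurable borel"
  using assms by (intro borel_measurable_continuous_onI linear_continuous_on)
    (simp add: orthogonal_transformation_linear linear_conv_bounded_linear[symmetric])

text \<open>Both \<open>\<lambda>g. \<integral> g\<close> and \<open>\<lambda>g. \<integral> g \<circ> T\<close> are translation invariant, so they agree up to a factor,
  which is 1 because \<open>T\<close> preserves the unit ball.\<close>
lemma nn_integral_orthogonal:
  fixes T :: "'a::euclidean_space \<Rightarrow> 'a" and f :: "'a \<Rightarrow> ennreal"
  assumes T: "orthogonal_transformation T" and f[measurable]: "f \<in> borel_measurable borel"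
  shows "(\<integral>\<^sup>+ z. f (T z) \<partial>lborel) = (\<integral>\<^sup>+ z. f z \<partial>lborel)"
proof -
  note [measurable] = orthogonal_transformation_measurable[OF T]
  define g :: "'a \<Rightarrow> ennreal" where "g = indicator (ball 0 1)"
  have g[measurable]: "g \<in> borel_measurable borel" unfolding g_def by (rule borel_measurable_indicator) simp
  have gT: "g (T z) = g z" for z using T by (simp add: g_def indicator_def orthogonal_transformation_norm)
  have lin: "linear T" using T by (rule orthogonal_transformation_linear)
  have refl: "(\<integral>\<^sup>+ y. f (c - y) \<partial>lborel) = (\<integral>\<^sup>+ y. f y \<partial>lborel)" for c
    using nn_integral_lborel_scaleR[of "\<lambda>y. f (c + y)" "-1"] nn_integral_lborel_translate[OF f, of c] by simp
  \<comment> \<open>The double integral of f(T x) g(T x + y) is evaluated twice: integrating over y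
    at once yields the integral of f o T times that of g, and shifting x by the preimage of y
    beforehand yields the integral of f times that of g o T.\<close>
  have "(\<integral>\<^sup>+ x. f (T x) \<partial>lborel) * (\<integral>\<^sup>+ y. g y \<partial>lborel) = (\<integral>\<^sup>+ x. f (T x) * (\<integral>\<^sup>+ y. g (T x + y) \<partial>lborel) \<partial>lborel)"
    by (simp add: nn_integral_lborel_translate nn_integral_multc)
  also have "\<dots> = (\<integral>\<^sup>+ x. (\<integral>\<^sup>+ y. f (T x) * g (T x + y) \<partial>lborel) \<partial>lborel)"
    by (simp add: nn_integral_cmult)
  also have "\<dots> = (\<integral>\<^sup>+ y. (\<integral>\<^sup>+ x. f (T x) * g (T x + y) \<partial>lborel) \<partial>lborel)"
    by (rule lborel_pair.Fubini'[symmetric]) measurable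
  also have "\<dots> = (\<integral>\<^sup>+ y. (\<integral>\<^sup>+ x. f (T x - y) * g (T x) \<partial>lborel) \<partial>lborel)"
  proof (rule nn_integral_cong)
    fix y :: 'a
    obtain w where w: "y = T w" using orthogonal_transformation_surj[OF T] by (metis surjD)
    have "(\<integral>\<^sup>+ x. f (T x) * g (T x + y) \<partial>lborel) = (\<integral>\<^sup>+ x. f (T (- w + x)) * g (T (- w + x) + y) \<partial>lborel)"
      by (rule nn_integral_lborel_translate[symmetric]) measurable
    also have "\<dots> = (\<integral>\<^sup>+ x. f (T x - y) * g (T x) \<partial>lborel)"
      by (simp add: linear_add[OF lin] linear_diff[OF lin] linear_neg[OF lin] w)
    finally show "(\<integral>\<^sup>+ x. f (T x) * g (T x + y) \<partial>lborel) = (\<integral>\<^sup>+ x. f (T x - y) * g (T x) \<partial>lborel)" .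
  qed
  also have "\<dots> = (\<integral>\<^sup>+ x. (\<integral>\<^sup>+ y. f (T x - y) * g (T x) \<partial>lborel) \<partial>lborel)"
    by (rule lborel_pair.Fubini') measurable
  also have "\<dots> = (\<integral>\<^sup>+ x. (\<integral>\<^sup>+ y. f y \<partial>lborel) * g (T x) \<partial>lborel)"
    by (simp add: nn_integral_multc refl)
  also have "\<dots> = (\<integral>\<^sup>+ y. f y \<partial>lborel) * (\<integral>\<^sup>+ x. g x \<partial>lborel)"
    by (simp add: nn_integral_cmult gT)
  finally have eq: "(\<integral>\<^sup>+ x. f (T x) \<partial>lborel) * (\<integral>\<^sup>+ y. g y \<partial>lborel) = (\<integral>\<^sup>+ y. f y \<partial>lborel) * (\<integral>\<^sup>+ x. g x \<partial>lborel)" .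
  have "(\<integral>\<^sup>+ x. g x \<partial>lborel) = ennreal (measure lborel (ball (0::'a) 1))"
    using emeasure_bounded_finite[OF bounded_ball, of "0::'a" 1] by (simp add: g_def emeasure_eq_ennreal_measure)
  moreover have "0 < measure lborel (ball (0::'a) 1)" by (rule content_ball_pos) simp
  ultimately show ?thesis using eq
    by (metis ennreal_eq_0_iff ennreal_mult_cancel_left ennreal_neq_top mult.commute not_less)
qed

lemma emeasure_orthogonal_vimage:
  fixes T :: "'a::euclidean_space \<Rightarrow> 'a"
  assumes T: "orthogonal_transformation T" and A[measurable]: "A \<in> sets borel"
  shows "T -` A \<in> sets borel" "emeasure lborel (T -` A) = emeasure lborel A"
proof -
  note [measurable] = orthogonal_transformation_measurable[OF T]
  show m: "T -` A \<in> sets borel" using measurable_sets[OF orthogonal_transformation_measurable[OF T] A] by simp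
  have "(\<lambda>z. indicator A (T z) :: ennreal) = indicator (T -` A)" by (auto simp: indicator_def)
  then show "emeasure lborel (T -` A) = emeasure lborel A"
    using nn_integral_orthogonal[OF T, of "indicator A"] m by simp
qed

lemma nn_integral_PiM_orthogonal:
  fixes \<Psi> :: "('j \<Rightarrow> 'a::euclidean_space) \<Rightarrow> ennreal"
  assumes J: "finite J" and \<Psi>[measurable]: "\<Psi> \<in> borel_measurable (PiM J (\<lambda>_. lborel))"
    and T: "orthogonal_transformation T"
    and inv: "\<And>x. x \<in> extensional J \<Longrightarrow> \<Psi> (\<lambda>j\<in>J. T (x j)) = \<Psi> x"
    and X: "\<And>j. j \<in> J \<Longrightarrow> X j \<in> sets borel"
  shows "(\<integral>\<^sup>+ x. \<Psi> x * (\<Prod>j\<in>J. indicator (T -` X j) (x j)) \<partial>PiM J (\<lambda>_. lborel))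
       = (\<integral>\<^sup>+ x. \<Psi> x * (\<Prod>j\<in>J. indicator (X j) (x j)) \<partial>PiM J (\<lambda>_. lborel))"
proof -
  note [measurable] = orthogonal_transformation_measurable[OF T]
  have [measurable]: "(\<lambda>x. (\<Prod>j\<in>J. indicator (X j) (x j)) :: ennreal) \<in> borel_measurable (PiM J (\<lambda>_. lborel))"
    using X by (intro borel_measurable_prod_indicator_PiM) auto
  let ?F = "\<lambda>x. \<Psi> x * (\<Prod>j\<in>J. indicator (X j) (x j))"
  have "(\<integral>\<^sup>+ x. ?F (\<lambda>j\<in>J. T (x j)) \<partial>PiM J (\<lambda>_. lborel)) = 1 ^ card J * (\<integral>\<^sup>+ x. ?F x \<partial>PiM J (\<lambda>_. lborel))"
    by (rule nn_integral_PiM_comp) (auto simp: J nn_integral_orthogonal[OF T] lborel.sigma_finite_measure_axioms)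
  moreover have "(\<integral>\<^sup>+ x. ?F (\<lambda>j\<in>J. T (x j)) \<partial>PiM J (\<lambda>_. lborel)) = (\<integral>\<^sup>+ x. \<Psi> x * (\<Prod>j\<in>J. indicator (T -` X j) (x j)) \<partial>PiM J (\<lambda>_. lborel))"
    by (intro nn_integral_cong arg_cong2[where f="(*)"] inv prod.cong) (auto simp: space_PiM PiE_def indicator_def)
  ultimately show ?thesis by simp
qed

lemma emeasure_Diff_eq_swap:
  assumes "A \<in> sets M" "B \<in> sets M" "emeasure M A = emeasure M B" "emeasure M A < \<infinity>"
  shows "emeasure M (A - B) = emeasure M (B - A)"
proof -
  have "emeasure M (X - Y) = emeasure M X - emeasure M (X \<inter> Y)"
    if "X \<in> sets M" "Y \<in> sets M" "emeasure M X < \<infinity>" for X Y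
  proof -
    have "X - Y = X - (X \<inter> Y)" by auto
    moreover have "emeasure M (X \<inter> Y) \<noteq> \<infinity>"
      using that le_less_trans[OF emeasure_mono[of "X \<inter> Y" X M] that(3)] by auto
    ultimately show ?thesis using that by (simp add: emeasure_Diff)
  qed
  from this[of A B] this[of B A] show ?thesis using assms by (simp add: Int_commute)
qed

text \<open>All sets are symmetrised along one common direction, since \<open>\<Psi>\<close> is
  invariant only under simultaneous rotation of its points; a good direction for the whole sum is
  rotated to \<open>e\<close> and back. In the gain, \<kappa> stems from averaging and 1 / (2 R)
  from the estimate on lines. It is quadratic because equal volumes make the two parts of the
  symmetric difference equally large.\<close>

lemma steiner_step:
  fixes D :: "'j \<Rightarrow> (real^'n) set" and \<rho> :: "'j \<Rightarrow> real"
  assumes e: "e \<in> Basis" and J: "finite J" and \<Psi>[measurable]: "\<Psi> \<in> borel_measurable (PiM J (\<lambda>_. lborel))"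
    and C: "\<And>x. \<Psi> x \<le> ennreal C"
    and inv: "\<And>T x. orthogonal_transformation T \<Longrightarrow> x \<in> extensional J \<Longrightarrow> \<Psi> (\<lambda>j\<in>J. T (x j)) = \<Psi> x"
    and u: "\<And>y. box_unimodal J (\<lambda>t. \<Psi> (\<lambda>j\<in>J. t j *\<^sub>R e + emb e (y j)))"
    and R: "0 < R" and D: "\<And>j. j \<in> J \<Longrightarrow> D j \<in> sets borel" and DR: "\<And>j. j \<in> J \<Longrightarrow> D j \<subseteq> cball 0 R"
    and \<rho>: "\<And>j. j \<in> J \<Longrightarrow> \<rho> j \<le> R"
    and vol: "\<And>j. j \<in> J \<Longrightarrow> emeasure lborel (D j) = emeasure lborel (ball (0::real^'n) (\<rho> j))"
  defines "\<kappa> \<equiv> 1 / (4 * (2 * R) ^ (DIM(real^'n) - 1) * measure lborel (ball (0::real^'n) 2))"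
  obtains D' where "\<And>j. j \<in> J \<Longrightarrow> D' j \<in> sets borel" "\<And>j. j \<in> J \<Longrightarrow> D' j \<subseteq> cball 0 R"
    "\<And>j. j \<in> J \<Longrightarrow> emeasure lborel (D' j) = emeasure lborel (D j)"
    "(\<integral>\<^sup>+ x. \<Psi> x * (\<Prod>j\<in>J. indicator (D j) (x j)) \<partial>PiM J (\<lambda>_. lborel))
      \<le> (\<integral>\<^sup>+ x. \<Psi> x * (\<Prod>j\<in>J. indicator (D' j) (x j)) \<partial>PiM J (\<lambda>_. lborel))"
    "(\<Sum>j\<in>J. emeasure lborel (D' j - ball 0 (\<rho> j))) + ennreal (\<kappa> / (2 * R)) * (\<Sum>j\<in>J. (emeasure lborel (D j - ball 0 (\<rho> j)))\<^sup>2)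
      \<le> (\<Sum>j\<in>J. emeasure lborel (D j - ball 0 (\<rho> j)))"
proof -
  define B where "B j = ball (0::real^'n) (\<rho> j)" for j
  have B: "B j \<in> sets borel" for j by (simp add: B_def)
  have BR: "B j \<subseteq> cball 0 R" if "j \<in> J" for j using \<rho>[OF that] by (auto simp: B_def)
  have DB: "D j - B j \<subseteq> cball 0 R" "B j - D j \<subseteq> cball 0 R" if "j \<in> J" for j
    using DR[OF that] BR[OF that] by blast+
  have "\<exists>\<theta>. norm \<theta> = 1 \<and> ennreal \<kappa> * (\<Sum>j\<in>J. emeasure lborel (D j - B j) * emeasure lborel (B j - D j))
     \<le> (\<Sum>j\<in>J. \<integral>\<^sup>+ s. emeasure lborel {x\<in>D j - B j. x + s *\<^sub>R \<theta> \<in> B j - D j} \<partial>lborel)"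
    unfolding \<kappa>_def
    by (rule exists_good_direction[OF J R]) (use D B DB in auto)
  then obtain \<theta> where \<theta>: "norm \<theta> = 1" "ennreal \<kappa> * (\<Sum>j\<in>J. emeasure lborel (D j - B j) * emeasure lborel (B j - D j))
     \<le> (\<Sum>j\<in>J. \<integral>\<^sup>+ s. emeasure lborel {x\<in>D j - B j. x + s *\<^sub>R \<theta> \<in> B j - D j} \<partial>lborel)" by blast
  have "norm e = norm \<theta>" using \<theta> e by simp
  then obtain T where T: "orthogonal_transformation T" "T e = \<theta>"
    by (rule orthogonal_transformation_exists)
  define T' where "T' = inv T"
  have T': "orthogonal_transformation T'" unfolding T'_def by (rule orthogonal_transformation_inv[OF T(1)])
  have lin: "linear T" using T(1) by (rule orthogonal_transformation_linear)
  define E where "E j = T -` D j" for j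
  \<comment> \<open>\<open>T'\<close> is the inverse of \<open>T\<close>, so this preimage is the
    image under \<open>T\<close> of the symmetrised set: \<open>D j\<close> symmetrised along
    \<theta>.\<close>
  define D' where "D' j = T' -` steiner e (E j)" for j
  have E: "E j \<in> sets borel" "E j \<subseteq> cball 0 R" if "j \<in> J" for j
    using emeasure_orthogonal_vimage(1)[OF T(1) D[OF that]] DR[OF that] T(1)
    by (auto simp: E_def orthogonal_transformation_norm subset_iff)
  have BT: "T -` B j = B j" "T' -` B j = B j" for j
    using T(1) T' by (auto simp: B_def orthogonal_transformation_norm)
  have SE: "steiner e (E j) \<in> sets borel" "steiner e (E j) \<subseteq> cball 0 R" if "j \<in> J" for j
    using steiner_sets[OF E(1)[OF that]] steiner_subset_cball[OF e E[OF that]] R by auto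
  have D'1: "D' j \<in> sets borel" if "j \<in> J" for j
    unfolding D'_def by (rule emeasure_orthogonal_vimage(1)[OF T' SE(1)[OF that]])
  have D'2: "D' j \<subseteq> cball 0 R" if "j \<in> J" for j
    using SE(2)[OF that] T' by (auto simp: D'_def orthogonal_transformation_norm subset_iff)
  have D'3: "emeasure lborel (D' j) = emeasure lborel (D j)" if "j \<in> J" for j
  proof -
    have "emeasure lborel (D' j) = emeasure lborel (steiner e (E j))"
      unfolding D'_def by (rule emeasure_orthogonal_vimage(2)[OF T' SE(1)[OF that]])
    also have "\<dots> = emeasure lborel (E j)" using emeasure_steiner[OF e E[OF that]] R by simp
    also have "\<dots> = emeasure lborel (D j)" unfolding E_def by (rule emeasure_orthogonal_vimage(2)[OF T(1) D[OF that]])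
    finally show ?thesis .
  qed
  let ?I = "\<lambda>A. \<integral>\<^sup>+ x. \<Psi> x * (\<Prod>j\<in>J. indicator (A j) (x j)) \<partial>PiM J (\<lambda>_. lborel)"
  have "?I D = ?I E"
    unfolding E_def by (rule nn_integral_PiM_orthogonal[OF J \<Psi> T(1) inv[OF T(1)] D, symmetric])
  also have "\<dots> \<le> ?I (\<lambda>j. steiner e (E j))"
    by (rule nn_integral_steiner_mono[OF e J \<Psi> C u]) (use E R in auto)
  also have "\<dots> = ?I D'"
    unfolding D'_def by (rule nn_integral_PiM_orthogonal[OF J \<Psi> T' inv[OF T'] SE(1), symmetric])
  finally have D'4: "?I D \<le> ?I D'" .
  have contr: "emeasure lborel (D' j - B j) + ennreal (1 / (2 * R)) * (\<integral>\<^sup>+ s. emeasure lborel {x\<in>D j - B j. x + s *\<^sub>R \<theta> \<in> B j - D j} \<partial>lborel)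
     \<le> emeasure lborel (D j - B j)" if j: "j \<in> J" for j
  proof -
    have "D' j - B j = T' -` (steiner e (E j) - B j)" using BT(2)[of j] by (auto simp: D'_def)
    then have 1: "emeasure lborel (D' j - B j) = emeasure lborel (steiner e (E j) - B j)"
      using emeasure_orthogonal_vimage(2)[OF T', of "steiner e (E j) - B j"] SE(1)[OF j] B by auto
    have "E j - B j = T -` (D j - B j)" using BT(1)[of j] by (auto simp: E_def)
    then have 2: "emeasure lborel (E j - B j) = emeasure lborel (D j - B j)"
      using emeasure_orthogonal_vimage(2)[OF T(1), of "D j - B j"] D[OF j] B by auto
    have 3: "emeasure lborel {x\<in>E j - B j. x + s *\<^sub>R e \<in> B j - E j} = emeasure lborel {x\<in>D j - B j. x + s *\<^sub>R \<theta> \<in> B j - D j}" for s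
    proof -
      have TB: "T x \<in> B j \<longleftrightarrow> x \<in> B j" for x using BT(1)[of j] by (metis vimage_eq)
      have Ts: "T x + s *\<^sub>R \<theta> = T (x + s *\<^sub>R e)" for x
        by (simp add: linear_add[OF lin] linear_cmul[OF lin] T(2))
      have "{x\<in>E j - B j. x + s *\<^sub>R e \<in> B j - E j} = T -` {x\<in>D j - B j. x + s *\<^sub>R \<theta> \<in> B j - D j}"
        by (simp add: E_def set_eq_iff TB Ts)
      moreover have "{x\<in>D j - B j. x + s *\<^sub>R \<theta> \<in> B j - D j} \<in> sets borel"
        using D[OF j] B[of j] by measurable
      ultimately show ?thesis by (simp only: emeasure_orthogonal_vimage(2)[OF T(1)])
    qed
    show ?thesis
      using steiner_contract[OF e E[OF j] R \<rho>[OF j]] unfolding B_def[symmetric] 1 2 3 .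
  qed
  have swap: "emeasure lborel (B j - D j) = emeasure lborel (D j - B j)" if j: "j \<in> J" for j
    using D[OF j] B vol[OF j] emeasure_lborel_ball_finite[of "0::real^'n" "\<rho> j"]
    by (intro emeasure_Diff_eq_swap) (auto simp: B_def)
  have "(\<Sum>j\<in>J. emeasure lborel (D' j - B j)) + ennreal (\<kappa> / (2 * R)) * (\<Sum>j\<in>J. (emeasure lborel (D j - B j))\<^sup>2)
     = (\<Sum>j\<in>J. emeasure lborel (D' j - B j)) + ennreal (1 / (2 * R)) * (ennreal \<kappa> * (\<Sum>j\<in>J. emeasure lborel (D j - B j) * emeasure lborel (B j - D j)))"
    using R by (simp add: swap power2_eq_square mult.assoc[symmetric] ennreal_mult'[symmetric] cong: sum.cong)
  also have "\<dots> \<le> (\<Sum>j\<in>J. emeasure lborel (D' j - B j)) + ennreal (1 / (2 * R)) * (\<Sum>j\<in>J. \<integral>\<^sup>+ s. emeasure lborel {x\<in>D j - B j. x + s *\<^sub>R \<theta> \<in> B j - D j} \<partial>lborel)"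
    by (intro add_left_mono mult_left_mono \<theta>(2)) auto
  also have "\<dots> = (\<Sum>j\<in>J. emeasure lborel (D' j - B j) + ennreal (1 / (2 * R)) * (\<integral>\<^sup>+ s. emeasure lborel {x\<in>D j - B j. x + s *\<^sub>R \<theta> \<in> B j - D j} \<partial>lborel))"
    by (simp add: sum.distrib sum_distrib_left)
  also have "\<dots> \<le> (\<Sum>j\<in>J. emeasure lborel (D j - B j))"
    by (intro sum_mono contr)
  finally show thesis
    using that[of D'] D'1 D'2 D'3 D'4 unfolding B_def by blast
qed

section \<open>Convergence to balls\<close>

text \<open>Among the families that compete with \<open>A\<close>, the infimum of the distance to
  the balls is zero by the quadratic gain; boundedness of \<open>\<Psi>\<close> then makes the
  integral for a family close to the balls almost at most the one for the balls.\<close>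

lemma nn_integral_le_balls_bounded:
  fixes A :: "'j \<Rightarrow> (real^'n) set" and \<rho> :: "'j \<Rightarrow> real"
  assumes e: "e \<in> Basis" and J: "finite J" and \<Psi>[measurable]: "\<Psi> \<in> borel_measurable (PiM J (\<lambda>_. lborel))"
    and C: "\<And>x. \<Psi> x \<le> ennreal C"
    and inv: "\<And>T x. orthogonal_transformation T \<Longrightarrow> x \<in> extensional J \<Longrightarrow> \<Psi> (\<lambda>j\<in>J. T (x j)) = \<Psi> x"
    and u: "\<And>y. box_unimodal J (\<lambda>t. \<Psi> (\<lambda>j\<in>J. t j *\<^sub>R e + emb e (y j)))"
    and R: "0 < R" and A: "\<And>j. j \<in> J \<Longrightarrow> A j \<in> sets borel" and AR: "\<And>j. j \<in> J \<Longrightarrow> A j \<subseteq> cball 0 R"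
    and \<rho>: "\<And>j. j \<in> J \<Longrightarrow> \<rho> j \<le> R"
    and vol: "\<And>j. j \<in> J \<Longrightarrow> emeasure lborel (A j) = emeasure lborel (ball (0::real^'n) (\<rho> j))"
  shows "(\<integral>\<^sup>+ x. \<Psi> x * (\<Prod>j\<in>J. indicator (A j) (x j)) \<partial>PiM J (\<lambda>_. lborel))
      \<le> (\<integral>\<^sup>+ x. \<Psi> x * (\<Prod>j\<in>J. indicator (ball 0 (\<rho> j)) (x j)) \<partial>PiM J (\<lambda>_. lborel))"
proof (cases "J = {}")
  case False
  have L: "sigma_finite_measure (lborel :: (real^'n) measure)" ..
  define B where "B j = ball (0::real^'n) (\<rho> j)" for j
  have B: "B j \<in> sets borel" for j by (simp add: B_def)
  let ?I = "\<lambda>A. \<integral>\<^sup>+ x. \<Psi> x * (\<Prod>j\<in>J. indicator (A j) (x j)) \<partial>PiM J (\<lambda>_. lborel)"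
  define \<kappa> where "\<kappa> = 1 / (4 * (2 * R) ^ (DIM(real^'n) - 1) * measure lborel (ball (0::real^'n) 2))"
  have "0 < measure lborel (ball (0::real^'n) 2)" by (rule content_ball_pos) simp
  then have \<kappa>: "0 < \<kappa>" using R by (simp add: \<kappa>_def)
  \<comment> \<open>Only the properties that a symmetrisation step preserves are recorded;
    membership does not require a history of symmetrisations.\<close>
  define S where "S = {D. (\<forall>j\<in>J. D j \<in> sets borel \<and> D j \<subseteq> cball 0 R \<and> emeasure lborel (D j) = emeasure lborel (B j)) \<and> ?I A \<le> ?I D}"
  \<comment> \<open>One half of the symmetric difference is enough: \<open>D j - B j\<close> is what
    the perturbation estimate charges, and by equality of volumes the other half has the same
    size.\<close>
  define d where "d D = (\<Sum>j\<in>J. measure lborel (D j - B j))" for D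
  \<comment> \<open>The factor \<open>card J\<close> comes from Cauchy--Schwarz, which bounds the
    square of a sum by the sum of squares.\<close>
  define K where "K = \<kappa> / (2 * R) / real (card J)"
  have K: "0 < K" using \<kappa> R False J by (simp add: K_def card_gt_0_iff)
  have d0: "0 \<le> d D" for D by (simp add: d_def sum_nonneg)
  have AS: "A \<in> S" using A AR vol by (auto simp: S_def B_def)
  have fin: "emeasure lborel (D j - B j) = ennreal (measure lborel (D j - B j))" if "D \<in> S" "j \<in> J" for D j
  proof -
    have "D j - B j \<subseteq> cball 0 R" using that by (auto simp: S_def)
    then have "emeasure lborel (D j - B j) < \<infinity>" by (intro emeasure_bounded_finite bounded_subset[OF bounded_cball])
    then show ?thesis by (intro emeasure_eq_ennreal_measure) auto
  qed
  have step: "\<exists>D'\<in>S. d D' + K * (d D)\<^sup>2 \<le> d D" if D: "D \<in> S" for D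
  proof -
    have D1: "\<And>j. j \<in> J \<Longrightarrow> D j \<in> sets borel" "\<And>j. j \<in> J \<Longrightarrow> D j \<subseteq> cball 0 R"
      "\<And>j. j \<in> J \<Longrightarrow> emeasure lborel (D j) = emeasure lborel (ball (0::real^'n) (\<rho> j))" "?I A \<le> ?I D"
      using D by (auto simp: S_def B_def)
    define better where "better D' \<longleftrightarrow> (\<forall>j\<in>J. D' j \<in> sets borel) \<and> (\<forall>j\<in>J. D' j \<subseteq> cball 0 R)
      \<and> (\<forall>j\<in>J. emeasure lborel (D' j) = emeasure lborel (D j)) \<and> ?I D \<le> ?I D'
      \<and> (\<Sum>j\<in>J. emeasure lborel (D' j - B j)) + ennreal (\<kappa> / (2 * R)) * (\<Sum>j\<in>J. (emeasure lborel (D j - B j))\<^sup>2)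
        \<le> (\<Sum>j\<in>J. emeasure lborel (D j - B j))" for D'
    have "\<exists>D'. better D'"
      by (rule steiner_step[where D=D and \<rho>=\<rho> and R=R and \<Psi>=\<Psi>, OF e J \<Psi> C, folded B_def \<kappa>_def];
          (fact inv u R D1 \<rho> | (unfold better_def, blast) | (unfold B_def, fact D1)))
    then obtain D' where D': "\<And>j. j \<in> J \<Longrightarrow> D' j \<in> sets borel" "\<And>j. j \<in> J \<Longrightarrow> D' j \<subseteq> cball 0 R"
      "\<And>j. j \<in> J \<Longrightarrow> emeasure lborel (D' j) = emeasure lborel (D j)" "?I D \<le> ?I D'"
      "(\<Sum>j\<in>J. emeasure lborel (D' j - B j)) + ennreal (\<kappa> / (2 * R)) * (\<Sum>j\<in>J. (emeasure lborel (D j - B j))\<^sup>2)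
        \<le> (\<Sum>j\<in>J. emeasure lborel (D j - B j))"
      unfolding better_def by blast
    have D'S: "D' \<in> S" using D'(1-4) D1 by (auto simp: S_def B_def intro: order_trans)
    have sums: "(\<Sum>j\<in>J. emeasure lborel (X j - B j)) = ennreal (d X)" if "X \<in> S" for X
      using fin[OF that] by (simp add: d_def)
    have "(\<Sum>j\<in>J. (emeasure lborel (D j - B j))\<^sup>2) = ennreal (\<Sum>j\<in>J. (measure lborel (D j - B j))\<^sup>2)"
      using fin[OF D] by (simp add: ennreal_power cong: sum.cong)
    from D'(5)[unfolded this sums[OF D] sums[OF D'S]]
    have "ennreal (d D' + \<kappa> / (2 * R) * (\<Sum>j\<in>J. (measure lborel (D j - B j))\<^sup>2)) \<le> ennreal (d D)"
      using \<kappa> R d0[of D'] by (subst ennreal_plus) (auto simp: ennreal_mult[symmetric] sum_nonneg simp del: ennreal_plus)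
    then have le: "d D' + \<kappa> / (2 * R) * (\<Sum>j\<in>J. (measure lborel (D j - B j))\<^sup>2) \<le> d D"
      using d0 by (subst (asm) ennreal_le_iff) auto
    have "(d D)\<^sup>2 \<le> (\<Sum>j\<in>J. (measure lborel (D j - B j))\<^sup>2) * card J"
      unfolding d_def by (rule sum_squared_le_sum_of_squares)
    from mult_left_mono[OF this, of K] K
    have "K * (d D)\<^sup>2 \<le> K * ((\<Sum>j\<in>J. (measure lborel (D j - B j))\<^sup>2) * card J)" by simp
    also have "\<dots> = \<kappa> / (2 * R) * (\<Sum>j\<in>J. (measure lborel (D j - B j))\<^sup>2)"
      using False J by (simp add: K_def)
    finally have "K * (d D)\<^sup>2 \<le> \<kappa> / (2 * R) * (\<Sum>j\<in>J. (measure lborel (D j - B j))\<^sup>2)" .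
    then show ?thesis using le D'S by (intro bexI[of _ D']) auto
  qed
  have small: "\<exists>D\<in>S. d D < \<epsilon>" if "0 < \<epsilon>" for \<epsilon>
  proof (rule ccontr)
    assume "\<not> ?thesis"
    then have big: "\<epsilon> \<le> d D" if "D \<in> S" for D using that by (auto simp: not_less)
    define \<delta> where "\<delta> = (INF D\<in>S. d D)"
    have bdd: "bdd_below (d ` S)" using d0 by (auto intro: bdd_belowI[of _ 0])
    have "\<epsilon> \<le> \<delta>" unfolding \<delta>_def using AS big by (intro cINF_greatest) auto
    then have \<delta>: "0 < \<delta>" using that by simp
    \<comment> \<open>A family with distance below this value loses at least K \<delta>^2 in the
      next step and falls below the infimum.\<close>
    have "\<delta> < \<delta> + K * \<delta>\<^sup>2" using \<delta> K by simp
    then obtain D where D: "D \<in> S" "d D < \<delta> + K * \<delta>\<^sup>2"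
      unfolding \<delta>_def using AS bdd by (subst (asm) cINF_less_iff) auto
    obtain D' where D': "D' \<in> S" "d D' + K * (d D)\<^sup>2 \<le> d D" using step[OF D(1)] by blast
    have "\<delta> \<le> d D" "\<delta> \<le> d D'" unfolding \<delta>_def using D D' bdd by (auto intro: cINF_lower)
    then have "K * \<delta>\<^sup>2 \<le> K * (d D)\<^sup>2" using \<delta> K by (intro mult_left_mono power_mono) auto
    then show False using D D' \<open>\<delta> \<le> d D'\<close> by linarith
  qed
  have "?I A \<le> ?I B"
  proof (rule ennreal_le_epsilon)
    fix \<epsilon> :: real assume \<epsilon>: "0 < \<epsilon>"
    define V where "V = 1 + measure lborel (cball (0::real^'n) R)"
    have V: "1 \<le> V" by (simp add: V_def)
    define c where "c = max 0 C * real (card J) * V ^ card J"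
    have c: "0 \<le> c" using V by (simp add: c_def)
    obtain D where D: "D \<in> S" "d D < \<epsilon> / (c + 1)" using small[of "\<epsilon> / (c + 1)"] \<epsilon> c by auto
    have "?I A \<le> ?I D" using D by (simp add: S_def)
    also have "\<dots> \<le> ?I B + ennreal C * of_nat (card J) * ennreal V ^ card J * ennreal (d D)"
    proof (rule nn_integral_PiM_indicator_perturb[OF L J \<Psi> C])
      fix j assume j: "j \<in> J"
      show "D j \<in> sets lborel" "B j \<in> sets lborel" using D j B by (auto simp: S_def)
      have "emeasure lborel (D j) \<le> emeasure lborel (cball (0::real^'n) R)"
        using D j by (intro emeasure_mono) (auto simp: S_def)
      also have "\<dots> = ennreal (measure lborel (cball (0::real^'n) R))"
        using emeasure_bounded_finite[OF bounded_cball, of "0::real^'n" R] by (intro emeasure_eq_ennreal_measure) auto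
      also have "\<dots> \<le> ennreal V" by (intro ennreal_leI) (simp add: V_def)
      finally show "emeasure lborel (D j) \<le> ennreal V" .
      have "measure lborel (D j - B j) \<le> d D" unfolding d_def using J j by (intro member_le_sum) auto
      then show "emeasure lborel (D j - B j) \<le> ennreal (d D)" using fin[OF D(1) j] by (simp add: ennreal_leI)
    qed (use V in auto)
    also have "ennreal C * of_nat (card J) * ennreal V ^ card J * ennreal (d D) \<le> ennreal (c * d D)"
      using V d0[of D] unfolding c_def
      by (cases "0 \<le> C") (auto simp: ennreal_mult' ennreal_power ennreal_of_nat_eq_real_of_nat[symmetric] ennreal_neg)
    also have "c * d D \<le> \<epsilon>"
    proof -
      have "c * d D \<le> (c + 1) * (\<epsilon> / (c + 1))" using c d0[of D] D by (intro mult_mono) auto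
      then show ?thesis using c by simp
    qed
    finally show "?I A \<le> ?I B + ennreal \<epsilon>" by (simp add: ennreal_leI add_left_mono)
  qed
  then show ?thesis unfolding B_def .
qed simp

lemma content_ball_vec: 
  assumes "0 \<le> r"
  shows "emeasure lborel (ball (0::real^'n) r) = ennreal (measure lebesgue (ball (0::real^'n) 1) * r ^ CARD('n))"
proof -
  have "measure lebesgue (ball (0::real^'n) r) = r ^ DIM(real^'n) * measure lebesgue (ball (0::real^'n) 1)"
    using content_ball_conv_unit_ball[OF assms, of "0::real^'n"] by (simp add: mult.commute)
  moreover have "emeasure lborel (ball (0::real^'n) r) = ennreal (measure lborel (ball (0::real^'n) r))"
    using emeasure_bounded_finite[OF bounded_ball, of "0::real^'n" r] by (intro emeasure_eq_ennreal_measure) auto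
  ultimately show ?thesis by (simp add: mult.commute)
qed

lemma sym_ball_eq_ball:
  fixes A :: "(real^'n) set"
  assumes A: "A \<in> sets borel" and fin: "emeasure lborel A < \<infinity>"
  obtains r where "0 \<le> r" "sym_ball A = ball 0 r" "emeasure lborel (ball (0::real^'n) r) = emeasure lborel A"
proof -
  define m where "m = measure lborel A"
  have m: "emeasure lborel A = ennreal m" unfolding m_def using fin by (intro emeasure_eq_ennreal_measure) auto
  have m0: "0 \<le> m" by (simp add: m_def)
  let ?v = "measure lebesgue (ball (0::real^'n) 1)"
  have "0 < measure lborel (ball (0::real^'n) 1)" by (rule content_ball_pos) simp
  then have v: "0 < ?v" by simp
  define r where "r = (m / ?v) powr (1 / real CARD('n))"
  have "r ^ CARD('n) = m / ?v"
  proof (cases "m = 0")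
    case True
    then show ?thesis by (simp add: r_def)
  next
    case False
    then have "r ^ CARD('n) = r powr real CARD('n)" using m0 v by (simp add: r_def powr_realpow)
    also have "\<dots> = m / ?v" using m0 v False by (simp add: r_def powr_powr)
    finally show ?thesis .
  qed
  then have "emeasure lborel (ball (0::real^'n) r) = emeasure lborel A"
    using v by (simp add: content_ball_vec m r_def)
  moreover have "sym_ball A = ball 0 r"
    using A m m0 by (simp add: sym_ball_def r_def)
  ultimately show thesis using that[of r] by (simp add: r_def)
qed

section \<open>Volume of star-shaped sets\<close>

text \<open>The antiderivative t^n / n accounts for 1 / n and the two signs of t for the factor 2.
  The infinite value of \<open>g\<close> follows by monotonicity from the finite ones.\<close>

lemma nn_integral_abs_power_superlevel:
  fixes g :: ennreal
  assumes n: "0 < n"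
  shows "(\<integral>\<^sup>+ t. ennreal (\<bar>t\<bar> ^ (n - 1)) * indicator {t. ennreal (\<bar>t\<bar> ^ n) < g} t \<partial>(lborel :: real measure)) = ennreal (2 / real n) * g"
proof -
  have fin: "(\<integral>\<^sup>+ t. ennreal (\<bar>t\<bar> ^ (n - 1)) * indicator {t. ennreal (\<bar>t\<bar> ^ n) < ennreal r} t \<partial>(lborel :: real measure)) = ennreal (2 / real n) * ennreal r"
    if r: "0 \<le> r" for r
  proof -
    define b where "b = root n r"
    have b: "0 \<le> b" "b ^ n = r" using r n by (auto simp: b_def real_root_pow_pos2)
    have set_eq: "{t. ennreal (\<bar>t\<bar> ^ n) < ennreal r} = {t. \<bar>t\<bar> < b}"
    proof -
      have "ennreal (\<bar>t\<bar> ^ n) < ennreal r \<longleftrightarrow> \<bar>t\<bar> < b" for t :: real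
        unfolding b(2)[symmetric]
        using power_less_imp_less_base[OF _ b(1), of "\<bar>t\<bar>" n] power_strict_mono[of "\<bar>t\<bar>" b n] n
        by (auto simp: ennreal_less_iff)
      then show ?thesis by auto
    qed
    let ?h = "\<lambda>t::real. ennreal (t ^ (n - 1)) * indicator {0..b} t"
    have "(\<integral>\<^sup>+ t. ennreal (\<bar>t\<bar> ^ (n - 1)) * indicator {t. \<bar>t\<bar> < b} t \<partial>lborel) = (\<integral>\<^sup>+ t. ?h t + ?h (- t) \<partial>lborel)"
    proof (rule nn_integral_cong_AE)
      have "AE t in lborel. t \<noteq> 0" "AE t in lborel. t \<noteq> b" "AE t in lborel. t \<noteq> - b" by (rule AE_lborel_singleton)+
      then show "AE t in lborel. ennreal (\<bar>t\<bar> ^ (n - 1)) * indicator {t. \<bar>t\<bar> < b} t = ?h t + ?h (- t)"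
      proof eventually_elim
        case (elim t)
        then show ?case by (cases "0 \<le> t") (auto simp: indicator_def abs_if)
      qed
    qed
    also have "\<dots> = (\<integral>\<^sup>+ t. ?h t \<partial>lborel) + (\<integral>\<^sup>+ t. ?h (- t) \<partial>lborel)"
      by (intro nn_integral_add) measurable
    also have "(\<integral>\<^sup>+ t. ?h (- t) \<partial>lborel) = (\<integral>\<^sup>+ t. ?h t \<partial>lborel)"
      by (subst (2) nn_integral_real_affine[where c="-1" and t=0]) auto
    also have "(\<integral>\<^sup>+ t. ?h t \<partial>lborel) = ennreal (b ^ n / real n - 0 ^ n / real n)"
    proof (rule nn_integral_FTC_Icc)
      show "((\<lambda>t. t ^ n / real n) has_real_derivative t ^ (n - 1)) (at t)" for t
        using n by (auto intro!: derivative_eq_intros)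
    qed (use b in auto)
    also have "\<dots> = ennreal (r / real n)" using b n by (simp add: zero_power)
    also have "ennreal (r / real n) + ennreal (r / real n) = ennreal (2 / real n) * ennreal r"
      using r by (simp add: ennreal_plus[symmetric] ennreal_mult'[symmetric] del: ennreal_plus)
    finally show ?thesis unfolding set_eq .
  qed
  show ?thesis
  proof (cases g)
    case (real r)
    then show ?thesis using fin by simp
  next
    case top
    let ?X = "\<integral>\<^sup>+ t. ennreal (\<bar>t\<bar> ^ (n - 1)) * indicator {t. ennreal (\<bar>t\<bar> ^ n) < g} t \<partial>(lborel :: real measure)"
    have "of_nat m \<le> ?X" for m
    proof -
      have "of_nat m = ennreal (2 / real n) * ennreal (real n / 2 * real m)"
        using n by (simp add: ennreal_mult'[symmetric] ennreal_of_nat_eq_real_of_nat)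
      also have "\<dots> \<le> ?X"
        unfolding top by (subst fin[symmetric]) (auto intro!: nn_integral_mono simp: indicator_def)
      finally show ?thesis .
    qed
    then have "?X = \<infinity>" by (metis ennreal_Ex_less_of_nat infinity_ennreal_def less_top not_less)
    then show ?thesis using top n by (simp add: ennreal_mult_top)
  qed
qed

lemma emb_scale: "emb e (\<lambda>i\<in>Basis - {e}. c * v i) = c *\<^sub>R emb e v"
  by (simp add: emb_def scaleR_sum_right)

lemma nn_integral_hyp_scale:
  fixes F :: "('a::euclidean_space \<Rightarrow> real) \<Rightarrow> ennreal"
  assumes e: "e \<in> Basis" and F: "F \<in> borel_measurable (hyp e)" and c: "c \<noteq> 0"
  shows "(\<integral>\<^sup>+ y. F y \<partial>hyp e) = ennreal (\<bar>c\<bar> ^ (DIM('a) - 1)) * (\<integral>\<^sup>+ v. F (\<lambda>i\<in>Basis - {e}. c * v i) \<partial>hyp e)"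
proof -
  have L: "sigma_finite_measure (lborel :: real measure)" ..
  have "(\<integral>\<^sup>+ v. F (\<lambda>i\<in>Basis - {e}. c * v i) \<partial>hyp e) = ennreal (1 / \<bar>c\<bar>) ^ card (Basis - {e}) * (\<integral>\<^sup>+ y. F y \<partial>hyp e)"
  proof (rule nn_integral_PiM_comp[OF L L])
    fix g :: "real \<Rightarrow> ennreal" assume g: "g \<in> borel_measurable lborel"
    show "(\<integral>\<^sup>+ z. g (c * z) \<partial>lborel) = ennreal (1 / \<bar>c\<bar>) * (\<integral>\<^sup>+ z. g z \<partial>lborel)"
      using g c by (subst (2) nn_integral_real_affine[where c=c and t=0]) (auto simp: mult.assoc[symmetric] ennreal_mult[symmetric])
  qed (use F in auto)
  moreover have "card (Basis - {e}) = DIM('a) - 1" using e by simp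
  ultimately show ?thesis
    using c by (simp add: mult.assoc[symmetric] ennreal_power ennreal_mult[symmetric] power_mult_distrib[symmetric] del: power_one_over)
qed

text \<open>Polar coordinates in a projective chart: almost every point is t (e + v) with t nonzero,
  the Jacobian is |t|^(n-1), and homogeneity turns membership into |t|^n < G(e + v). The integral
  over t can then be computed.\<close>

lemma emeasure_superlevel_homogeneous:
  fixes G :: "'a::euclidean_space \<Rightarrow> ennreal"
  assumes e: "e \<in> Basis" and G[measurable]: "G \<in> borel_measurable borel"
    and hom: "\<And>c u. c \<noteq> 0 \<Longrightarrow> G (c *\<^sub>R u) = ennreal (1 / \<bar>c\<bar> ^ DIM('a)) * G u"
  shows "emeasure lborel {u. 1 < G u} = ennreal (2 / real DIM('a)) * (\<integral>\<^sup>+ v. G (e + emb e v) \<partial>hyp e)"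
proof -
  let ?n = "DIM('a)"
  interpret H: sigma_finite_measure "hyp e" by (rule sigma_finite_hyp)
  interpret HP: pair_sigma_finite lborel "hyp e" ..
  have le_iff: "1 < ennreal (1 / \<bar>t\<bar> ^ ?n) * g \<longleftrightarrow> ennreal (\<bar>t\<bar> ^ ?n) < g" if t: "t \<noteq> 0" for t :: real and g
  proof (cases g)
    case (real r)
    then show ?thesis using t
      by (simp add: ennreal_mult[symmetric] ennreal_less_iff ennreal_1[symmetric] field_simps del: ennreal_1)
  qed (use t in \<open>simp add: ennreal_mult_top\<close>)
  have "emeasure lborel {u. 1 < G u} = (\<integral>\<^sup>+ x. indicator {u. 1 < G u} x \<partial>lborel)" by simp
  also have "\<dots> = (\<integral>\<^sup>+ y. (\<integral>\<^sup>+ t. indicator {u. 1 < G u} (t *\<^sub>R e + emb e y) \<partial>lborel) \<partial>hyp e)"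
    by (rule nn_integral_lborel_split[OF e]) measurable
  also have "\<dots> = (\<integral>\<^sup>+ t. (\<integral>\<^sup>+ y. indicator {u. 1 < G u} (t *\<^sub>R e + emb e y) \<partial>hyp e) \<partial>lborel)"
    by (rule HP.Fubini') measurable
  also have "\<dots> = (\<integral>\<^sup>+ t. (\<integral>\<^sup>+ v. ennreal (\<bar>t\<bar> ^ (?n - 1)) * indicator {t. ennreal (\<bar>t\<bar> ^ ?n) < G (e + emb e v)} t \<partial>hyp e) \<partial>lborel)"
  proof (rule nn_integral_cong_AE)
    have "AE t in lborel. t \<noteq> (0::real)" by (rule AE_lborel_singleton)
    then show "AE t in lborel. (\<integral>\<^sup>+ y. indicator {u. 1 < G u} (t *\<^sub>R e + emb e y) \<partial>hyp e) = (\<integral>\<^sup>+ v. ennreal (\<bar>t\<bar> ^ (?n - 1)) * indicator {t. ennreal (\<bar>t\<bar> ^ ?n) < G (e + emb e v)} t \<partial>hyp e)"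
    proof eventually_elim
      case (elim t)
      have "(\<integral>\<^sup>+ y. indicator {u. 1 < G u} (t *\<^sub>R e + emb e y) \<partial>hyp e)
        = ennreal (\<bar>t\<bar> ^ (?n - 1)) * (\<integral>\<^sup>+ v. indicator {u. 1 < G u} (t *\<^sub>R e + emb e (\<lambda>i\<in>Basis - {e}. t * v i)) \<partial>hyp e)"
        by (rule nn_integral_hyp_scale[OF e _ elim]) measurable
      also have "(\<lambda>v. indicator {u. 1 < G u} (t *\<^sub>R e + emb e (\<lambda>i\<in>Basis - {e}. t * v i)) :: ennreal) = (\<lambda>v. indicator {t. ennreal (\<bar>t\<bar> ^ ?n) < G (e + emb e v)} t)"
        using hom[OF elim] le_iff[OF elim] by (simp add: emb_scale indicator_def scaleR_right_distrib[symmetric])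
      also have "ennreal (\<bar>t\<bar> ^ (?n - 1)) * (\<integral>\<^sup>+ v. indicator {t. ennreal (\<bar>t\<bar> ^ ?n) < G (e + emb e v)} t \<partial>hyp e)
         = (\<integral>\<^sup>+ v. ennreal (\<bar>t\<bar> ^ (?n - 1)) * indicator {t. ennreal (\<bar>t\<bar> ^ ?n) < G (e + emb e v)} t \<partial>hyp e)"
        by (rule nn_integral_cmult[symmetric]) measurable
      finally show ?case .
    qed
  qed
  also have "\<dots> = (\<integral>\<^sup>+ v. (\<integral>\<^sup>+ t. ennreal (\<bar>t\<bar> ^ (?n - 1)) * indicator {t. ennreal (\<bar>t\<bar> ^ ?n) < G (e + emb e v)} t \<partial>lborel) \<partial>hyp e)"
    by (rule HP.Fubini'[symmetric]) measurable
  also have "\<dots> = (\<integral>\<^sup>+ v. ennreal (2 / real ?n) * G (e + emb e v) \<partial>hyp e)"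
    by (intro nn_integral_cong nn_integral_abs_power_superlevel) simp
  also have "\<dots> = ennreal (2 / real ?n) * (\<integral>\<^sup>+ v. G (e + emb e v) \<partial>hyp e)"
    by (rule nn_integral_cmult) measurable
  finally show ?thesis .
qed

section \<open>Kernels built from gauges\<close>

text \<open>\<open>J\<close> indexes all points and \<open>L\<close> the k factors of the expanded
  power. A factor sees the points only through the numbers <x_j, u>, to which it applies the
  seminorm \<open>H l\<close>; several factors may read the same points.\<close>

locale gauge_family =
  fixes J :: "'j set" and L :: "'l set" and H :: "'l \<Rightarrow> ('j \<Rightarrow> real) \<Rightarrow> real" and q :: real
  assumes finite_J: "finite J" and finite_L: "finite L" and q_pos: "0 < q"
    and H_measurable: "l \<in> L \<Longrightarrow> H l \<in> borel_measurable (PiM J (\<lambda>_. borel))"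
    and H_nonneg: "l \<in> L \<Longrightarrow> 0 \<le> H l y"
    and H_convex: "\<lbrakk>l \<in> L; 0 < c; c < 1; y \<in> extensional J; z \<in> extensional J\<rbrakk>
        \<Longrightarrow> H l (\<lambda>j\<in>J. (1 - c) * y j + c * z j) \<le> (1 - c) * H l y + c * H l z"
    and H_hom: "\<lbrakk>l \<in> L; y \<in> extensional J\<rbrakk> \<Longrightarrow> H l (\<lambda>j\<in>J. c * y j) = \<bar>c\<bar> * H l y"
begin

text \<open>The summand \<open>\<epsilon> * norm u\<close> has the same degree of homogeneity as the
  gauge, is convex and rotation invariant, and for positive \<epsilon> keeps the base of the power
  away from 0 at every nonzero u.\<close>

definition kernel :: "real \<Rightarrow> ('j \<Rightarrow> 'a::euclidean_space) \<Rightarrow> 'a \<Rightarrow> ennreal" where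
  "kernel \<epsilon> x u = (\<Prod>l\<in>L. ennreal ((H l (\<lambda>j\<in>J. x j \<bullet> u) + \<epsilon> * norm u) powr (- q)))"

text \<open>Defined as a volume and not by the chart formula: rotation invariance is then immediate,
  and the formula becomes available for each \<open>e\<close>.\<close>

definition Psi :: "real \<Rightarrow> ('j \<Rightarrow> 'a::euclidean_space) \<Rightarrow> ennreal" where
  "Psi \<epsilon> x = emeasure lborel {u. 1 < kernel \<epsilon> x u}"

lemma kernel_measurable_pair:
  "(\<lambda>z. kernel \<epsilon> (fst z) (snd z)) \<in> borel_measurable (PiM J (\<lambda>_. lborel :: 'a::euclidean_space measure) \<Otimes>\<^sub>M borel)"
proof -
  have "(\<lambda>z. \<lambda>j\<in>J. fst z j \<bullet> (snd z :: 'a)) \<in> measurable (PiM J (\<lambda>_. lborel) \<Otimes>\<^sub>M borel) (PiM J (\<lambda>_. borel))"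
    by (rule measurable_restrict) measurable
  note [measurable] = measurable_compose[OF this H_measurable]
  show ?thesis unfolding kernel_def by measurable
qed

lemma kernel_measurable[measurable (raw)]:
  assumes f: "f \<in> measurable M (PiM J (\<lambda>_. lborel :: 'a::euclidean_space measure))" and g: "g \<in> borel_measurable M"
  shows "(\<lambda>z. kernel \<epsilon> (f z) (g z)) \<in> borel_measurable M"
  using measurable_compose[OF measurable_Pair[OF f g] kernel_measurable_pair] by simp

lemma kernel_measurable_snd: "kernel \<epsilon> x \<in> borel_measurable borel"
proof -
  have "(\<lambda>z. \<lambda>j\<in>J. x j \<bullet> z) \<in> measurable borel (PiM J (\<lambda>_. borel))"
    by (rule measurable_restrict) measurable
  note [measurable] = measurable_compose[OF this H_measurable]
  show ?thesis unfolding kernel_def[abs_def] by measurable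
qed

text \<open>The degree -q is multiplied by the number of factors; \<open>dim\<close> makes the
  result -n.\<close>

lemma kernel_homogeneous:
  fixes x :: "'j \<Rightarrow> 'a::euclidean_space"
  assumes dim: "q * real (card L) = real DIM('a)" and c: "c \<noteq> 0" and \<epsilon>: "0 \<le> \<epsilon>"
  shows "kernel \<epsilon> x (c *\<^sub>R u) = ennreal (1 / \<bar>c\<bar> ^ DIM('a)) * kernel \<epsilon> x u"
proof -
  have "kernel \<epsilon> x (c *\<^sub>R u) = (\<Prod>l\<in>L. ennreal (\<bar>c\<bar> powr (- q)) * ennreal ((H l (\<lambda>j\<in>J. x j \<bullet> u) + \<epsilon> * norm u) powr (- q)))"
    unfolding kernel_def
  proof (rule prod.cong[OF refl])
    fix l assume l: "l \<in> L"
    have "(\<lambda>j\<in>J. x j \<bullet> c *\<^sub>R u) = (\<lambda>j\<in>J. c * (\<lambda>j\<in>J. x j \<bullet> u) j)" by (auto simp: fun_eq_iff)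
    then have "H l (\<lambda>j\<in>J. x j \<bullet> c *\<^sub>R u) + \<epsilon> * norm (c *\<^sub>R u) = \<bar>c\<bar> * (H l (\<lambda>j\<in>J. x j \<bullet> u) + \<epsilon> * norm u)"
      using H_hom[OF l, of "\<lambda>j\<in>J. x j \<bullet> u" c] by (simp add: algebra_simps)
    then show "ennreal ((H l (\<lambda>j\<in>J. x j \<bullet> c *\<^sub>R u) + \<epsilon> * norm (c *\<^sub>R u)) powr (- q))
      = ennreal (\<bar>c\<bar> powr (- q)) * ennreal ((H l (\<lambda>j\<in>J. x j \<bullet> u) + \<epsilon> * norm u) powr (- q))"
      using H_nonneg[OF l] \<epsilon> by (simp add: powr_mult ennreal_mult)
  qed
  also have "\<dots> = ennreal (\<bar>c\<bar> powr (- q)) ^ card L * kernel \<epsilon> x u"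
    by (simp add: prod.distrib kernel_def)
  also have "ennreal (\<bar>c\<bar> powr (- q)) ^ card L = ennreal (1 / \<bar>c\<bar> ^ DIM('a))"
  proof -
    have "(\<bar>c\<bar> powr (- q)) ^ card L = (\<bar>c\<bar> powr (- q)) powr real (card L)" using c by (simp add: powr_realpow)
    also have "\<dots> = \<bar>c\<bar> powr (- real DIM('a))" using dim by (simp add: powr_powr)
    also have "\<dots> = 1 / \<bar>c\<bar> ^ DIM('a)" using c by (simp add: powr_minus_divide powr_realpow)
    finally show ?thesis by (simp add: ennreal_power)
  qed
  finally show ?thesis .
qed

lemma Psi_eq:
  fixes x :: "'j \<Rightarrow> 'a::euclidean_space"
  assumes dim: "q * real (card L) = real DIM('a)" and \<epsilon>: "0 \<le> \<epsilon>" and e: "e \<in> Basis"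
  shows "Psi \<epsilon> x = ennreal (2 / real DIM('a)) * (\<integral>\<^sup>+ v. kernel \<epsilon> x (e + emb e v) \<partial>hyp e)"
  unfolding Psi_def
  by (rule emeasure_superlevel_homogeneous[OF e kernel_measurable_snd kernel_homogeneous[OF dim _ \<epsilon>]])

lemma Psi_measurable:
  assumes dim: "q * real (card L) = real DIM('a)" and \<epsilon>: "0 \<le> \<epsilon>"
  shows "Psi \<epsilon> \<in> borel_measurable (PiM J (\<lambda>_. lborel :: 'a::euclidean_space measure))"
proof -
  obtain e :: 'a where e: "e \<in> Basis" using nonempty_Basis by blast
  interpret H: sigma_finite_measure "hyp e" by (rule sigma_finite_hyp)
  show ?thesis unfolding Psi_eq[OF dim \<epsilon> e, abs_def] by measurable
qed

text \<open>As soon as \<epsilon> |u| >= 1, every factor of the kernel is at most 1, so the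
  superlevel set lies in the ball of radius 1 / \<epsilon>.\<close>

lemma Psi_le:
  fixes x :: "'j \<Rightarrow> 'a::euclidean_space"
  assumes \<epsilon>: "0 < \<epsilon>"
  shows "Psi \<epsilon> x \<le> ennreal (measure lborel (ball (0::'a) (1 / \<epsilon>)))"
proof -
  have "u \<in> ball 0 (1 / \<epsilon>)" if u: "1 < kernel \<epsilon> x u" for u
  proof (rule ccontr)
    assume "u \<notin> ball 0 (1 / \<epsilon>)"
    then have "1 \<le> \<epsilon> * norm u" using \<epsilon> by (simp add: field_simps)
    then have "ennreal ((H l (\<lambda>j\<in>J. x j \<bullet> u) + \<epsilon> * norm u) powr (- q)) \<le> 1" if "l \<in> L" for l
      using H_nonneg[OF that, of "\<lambda>j\<in>J. x j \<bullet> u"] q_pos powr_mono2'[of "- q" 1 "H l (\<lambda>j\<in>J. x j \<bullet> u) + \<epsilon> * norm u"]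
      by (simp add: ennreal_le_1)
    then have "kernel \<epsilon> x u \<le> (\<Prod>l\<in>L. 1)" unfolding kernel_def by (rule prod_mono_ennreal)
    then show False using u by simp
  qed
  then have "Psi \<epsilon> x \<le> emeasure lborel (ball (0::'a) (1 / \<epsilon>))"
    unfolding Psi_def by (intro emeasure_mono) auto
  also have "\<dots> = ennreal (measure lborel (ball (0::'a) (1 / \<epsilon>)))"
    using emeasure_bounded_finite[OF bounded_ball, of "0::'a" "1 / \<epsilon>"] by (intro emeasure_eq_ennreal_measure) auto
  finally show ?thesis .
qed

lemma Psi_orthogonal:
  fixes x :: "'j \<Rightarrow> 'a::euclidean_space" and T :: "'a \<Rightarrow> 'a"
  assumes T: "orthogonal_transformation T"
  shows "Psi \<epsilon> (\<lambda>j\<in>J. T (x j)) = Psi \<epsilon> x"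
proof -
  have "kernel \<epsilon> (\<lambda>j\<in>J. T (x j)) (T u) = kernel \<epsilon> x u" for u
  proof -
    have "(\<lambda>j\<in>J. (\<lambda>j\<in>J. T (x j)) j \<bullet> T u) = (\<lambda>j\<in>J. x j \<bullet> u)"
      using T by (auto simp: fun_eq_iff orthogonal_transformation_def)
    then show ?thesis unfolding kernel_def using T by (simp add: orthogonal_transformation_norm)
  qed
  then have "{u. 1 < kernel \<epsilon> x u} = T -` {u. 1 < kernel \<epsilon> (\<lambda>j\<in>J. T (x j)) u}" by auto
  moreover have "{u. 1 < kernel \<epsilon> (\<lambda>j\<in>J. T (x j)) u} \<in> sets borel"
    using kernel_measurable_snd by measurable
  ultimately show ?thesis
    unfolding Psi_def by (simp only: emeasure_orthogonal_vimage(2)[OF T])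
qed

lemma emb_convex_comb:
  "emb e (\<lambda>i\<in>Basis - {e}. (1 - c) * v i + c * v' i) = (1 - c) *\<^sub>R emb e v + c *\<^sub>R emb e v'"
  by (simp add: emb_def scaleR_sum_right sum.distrib[symmetric] scaleR_left_distrib)

text \<open>In the chart the kernel is a product of powers of functions \<open>g l\<close> that are
  convex and even in (t, v). Writing each power by its levels represents \<open>Psi\<close> as an
  integral, over levels s, of section measures of symmetric convex sets, each of which is box
  unimodal.\<close>

lemma Psi_box_unimodal:
  fixes e :: "'a::euclidean_space"
  assumes dim: "q * real (card L) = real DIM('a)" and \<epsilon>: "0 < \<epsilon>" and e: "e \<in> Basis"
  shows "box_unimodal J (\<lambda>t. Psi \<epsilon> (\<lambda>j\<in>J. t j *\<^sub>R e + emb e (y j)))"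
proof -
  interpret PL: product_sigma_finite "\<lambda>_. lborel :: real measure" by (rule product_sigma_finite_lborel)
  interpret H: sigma_finite_measure "hyp e" by (rule sigma_finite_hyp)
  interpret Lm: sigma_finite_measure "PiM L (\<lambda>_. lborel :: real measure)" by (rule sigma_finite_PiM_lborel[OF finite_L])
  interpret HL: pair_sigma_finite "PiM L (\<lambda>_. lborel :: real measure)" "hyp e" ..
  \<comment> \<open>The inner products of the points with e + v. With the hyperplane parts
    \<open>y j\<close> frozen they are jointly linear in (t, v).\<close>
  define a where "a t v = (\<lambda>j\<in>J. t j + emb e (y j) \<bullet> emb e v)" for t v
  define g where "g l t v = H l (a t v) + \<epsilon> * norm (e + emb e v)" for l t v
  have inner: "(t *\<^sub>R e + emb e w) \<bullet> (e + emb e v) = t + emb e w \<bullet> emb e v" for t w v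
    using e by (simp add: inner_add_left inner_add_right emb_orthogonal)
  have ker: "kernel \<epsilon> (\<lambda>j\<in>J. t j *\<^sub>R e + emb e (y j)) (e + emb e v) = (\<Prod>l\<in>L. ennreal (g l t v powr (- q)))" for t v
  proof -
    have "(\<lambda>j\<in>J. (\<lambda>j\<in>J. t j *\<^sub>R e + emb e (y j)) j \<bullet> (e + emb e v)) = a t v"
      by (auto simp: a_def fun_eq_iff inner)
    then show ?thesis by (simp add: kernel_def g_def)
  qed
  have npos: "0 < norm (e + emb e v)" for v
  proof -
    have "(e + emb e v) \<bullet> e = 1" using e by (simp add: inner_add_left emb_orthogonal)
    then have "e + emb e v \<noteq> 0" by auto
    then show ?thesis by simp
  qed
  have gpos: "0 < g l t v" if "l \<in> L" for l t v
    using H_nonneg[OF that, of "a t v"] npos[of v] \<epsilon> by (simp add: g_def add_nonneg_pos)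
  have g_conv: "g l (\<lambda>j\<in>J. (1 - c) * t j + c * t' j) (\<lambda>i\<in>Basis - {e}. (1 - c) * v i + c * v' i) \<le> max (g l t v) (g l t' v')"
    if l: "l \<in> L" and c: "0 < c" "c < 1" for l t t' v v' c
  proof -
    let ?t = "\<lambda>j\<in>J. (1 - c) * t j + c * t' j" and ?v = "\<lambda>i\<in>Basis - {e}. (1 - c) * v i + c * v' i"
    have "a ?t ?v = (\<lambda>j\<in>J. (1 - c) * a t v j + c * a t' v' j)"
      unfolding a_def emb_convex_comb by (auto simp: fun_eq_iff inner_add_right algebra_simps)
    then have 1: "H l (a ?t ?v) \<le> (1 - c) * H l (a t v) + c * H l (a t' v')"
      using H_convex[OF l c, of "a t v" "a t' v'"] by (simp add: a_def)
    have "e + emb e ?v = (1 - c) *\<^sub>R (e + emb e v) + c *\<^sub>R (e + emb e v')"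
      unfolding emb_convex_comb by (simp add: algebra_simps)
    also have "norm \<dots> \<le> (1 - c) * norm (e + emb e v) + c * norm (e + emb e v')"
      using c by (intro order_trans[OF norm_triangle_ineq]) simp
    finally have "\<epsilon> * norm (e + emb e ?v) \<le> \<epsilon> * ((1 - c) * norm (e + emb e v) + c * norm (e + emb e v'))"
      using \<epsilon> by (intro mult_left_mono) auto
    with 1 have "g l ?t ?v \<le> (1 - c) * g l t v + c * g l t' v'"
      by (simp add: g_def algebra_simps)
    also have "\<dots> \<le> (1 - c) * max (g l t v) (g l t' v') + c * max (g l t v) (g l t' v')"
      using c by (intro add_mono mult_left_mono) auto
    finally show ?thesis by (simp add: algebra_simps)
  qed
  have g_sym: "g l (\<lambda>j\<in>J. - t j) (\<lambda>i\<in>Basis - {e}. - v i) = g l t v" if l: "l \<in> L" for l t v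
  proof -
    have emb_m: "emb e (\<lambda>i\<in>Basis - {e}. - v i) = - emb e v" using emb_scale[of e "-1" v] by simp
    have "a (\<lambda>j\<in>J. - t j) (\<lambda>i\<in>Basis - {e}. - v i) = (\<lambda>j\<in>J. (-1) * a t v j)"
      by (auto simp: a_def fun_eq_iff emb_m)
    then have 1: "H l (a (\<lambda>j\<in>J. - t j) (\<lambda>i\<in>Basis - {e}. - v i)) = H l (a t v)"
      using H_hom[OF l, of "a t v" "-1"] by (simp add: a_def)
    \<comment> \<open>The regularising term does not change under v -> -v because v is orthogonal to
      e.\<close>
    have "(norm (e + z))\<^sup>2 = 1 + (norm z)\<^sup>2" if "z \<bullet> e = 0" for z
      using norm_add_orthogonal_sq[OF e that, of 1] by simp
    then have "(norm (e + - emb e v))\<^sup>2 = (norm (e + emb e v))\<^sup>2"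
      using e by (simp add: emb_orthogonal del: add_uminus_conv_diff)
    then have "norm (e + - emb e v) = norm (e + emb e v)" by simp
    then show ?thesis unfolding g_def 1 emb_m by simp
  qed
  have g_meas: "(\<lambda>z. g l (f1 z) (f2 z)) \<in> borel_measurable M"
    if l: "l \<in> L" and "f1 \<in> measurable M (PiM J (\<lambda>_. lborel))" "f2 \<in> measurable M (hyp e)" for l f1 f2 and M :: "'x measure"
  proof -
    have [measurable]: "(\<lambda>z. emb e (f2 z)) \<in> borel_measurable M"
      by (rule measurable_compose[OF that(3) measurable_emb])
    have "(\<lambda>z. a (f1 z) (f2 z)) \<in> measurable M (PiM J (\<lambda>_. borel))"
      unfolding a_def
    proof (rule measurable_restrict)
      fix j assume j: "j \<in> J"
      have [measurable]: "(\<lambda>z. f1 z j) \<in> borel_measurable M"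
        using measurable_compose[OF that(2) measurable_component_singleton[OF j]] by simp
      show "(\<lambda>z. f1 z j + emb e (y j) \<bullet> emb e (f2 z)) \<in> borel_measurable M" by measurable
    qed
    note [measurable] = measurable_compose[OF this H_measurable[OF l]]
    show ?thesis unfolding g_def by measurable
  qed
  \<comment> \<open>One level for each factor. Since the power -q is decreasing, superlevel sets of
    the factors are sublevel sets of the convex \<open>g l\<close>, and their intersection is
    convex.\<close>
  define K where "K s t v \<longleftrightarrow> (\<forall>l\<in>L. 0 < s l \<and> ennreal (s l) < ennreal (g l t v powr (- q)))" for s t v
  have K_ind: "(\<Prod>l\<in>L. indicator {s. 0 < s \<and> ennreal s < ennreal (g l t v powr (- q))} (s l)) = (indicator {v. K s t v} v :: ennreal)" for s t v
    using finite_L by (auto simp: K_def indicator_def intro!: prod.neutral)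
  let ?W = "\<lambda>s t. \<integral>\<^sup>+ v. indicator {v. K s t v} v \<partial>hyp e"
  have K_meas: "Measurable.pred M (\<lambda>z. K (f0 z) (f1 z) (f2 z))"
    if "f0 \<in> measurable M (PiM L (\<lambda>_. lborel))" "f1 \<in> measurable M (PiM J (\<lambda>_. lborel))" "f2 \<in> measurable M (hyp e)" for f0 f1 f2 and M :: "'x measure"
    unfolding K_def
  proof (intro pred_intros_finite(3) finite_L)
    fix l assume l: "l \<in> L"
    have [measurable]: "(\<lambda>z. f0 z l) \<in> borel_measurable M"
      using measurable_compose[OF that(1) measurable_component_singleton[OF l]] by simp
    have [measurable]: "(\<lambda>z. g l (f1 z) (f2 z)) \<in> borel_measurable M" by (rule g_meas[OF l that(2,3)])
    show "Measurable.pred M (\<lambda>z. 0 < f0 z l \<and> ennreal (f0 z l) < ennreal (g l (f1 z) (f2 z) powr (- q)))" by measurable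
  qed
  have Psi: "Psi \<epsilon> (\<lambda>j\<in>J. t j *\<^sub>R e + emb e (y j)) = ennreal (2 / real DIM('a)) * (\<integral>\<^sup>+ s. ?W s t \<partial>PiM L (\<lambda>_. lborel))"
    if t: "t \<in> space (PiM J (\<lambda>_. lborel))" for t
  proof -
    have Km: "(\<lambda>z. indicator {v. K (fst z) t v} (snd z) :: ennreal) \<in> borel_measurable (PiM L (\<lambda>_. lborel) \<Otimes>\<^sub>M hyp e)"
    proof -
      have [measurable]: "Measurable.pred (PiM L (\<lambda>_. lborel) \<Otimes>\<^sub>M hyp e) (\<lambda>z. K (fst z) t (snd z))"
        using t by (intro K_meas) auto
      show ?thesis by measurable
    qed
    have "Psi \<epsilon> (\<lambda>j\<in>J. t j *\<^sub>R e + emb e (y j)) = ennreal (2 / real DIM('a)) * (\<integral>\<^sup>+ v. (\<Prod>l\<in>L. ennreal (g l t v powr (- q))) \<partial>hyp e)"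
      using Psi_eq[OF dim less_imp_le[OF \<epsilon>] e] by (simp add: ker)
    also have "(\<integral>\<^sup>+ v. (\<Prod>l\<in>L. ennreal (g l t v powr (- q))) \<partial>hyp e) = (\<integral>\<^sup>+ v. (\<integral>\<^sup>+ s. indicator {v. K s t v} v \<partial>PiM L (\<lambda>_. lborel)) \<partial>hyp e)"
    proof (rule nn_integral_cong)
      fix v
      have "(\<integral>\<^sup>+ s. (\<Prod>l\<in>L. indicator {s. 0 < s \<and> ennreal s < ennreal (g l t v powr (- q))} (s l)) \<partial>PiM L (\<lambda>_. lborel))
        = (\<Prod>l\<in>L. \<integral>\<^sup>+ s. indicator {s. 0 < s \<and> ennreal s < ennreal (g l t v powr (- q))} s \<partial>lborel)"
        by (rule PL.product_nn_integral_prod[OF finite_L]) measurable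
      then show "(\<Prod>l\<in>L. ennreal (g l t v powr (- q))) = (\<integral>\<^sup>+ s. indicator {v. K s t v} v \<partial>PiM L (\<lambda>_. lborel))"
        by (simp only: K_ind nn_integral_layer_cake_const)
    qed
    also have "\<dots> = (\<integral>\<^sup>+ s. ?W s t \<partial>PiM L (\<lambda>_. lborel))"
      by (rule HL.Fubini') (use Km in \<open>simp add: case_prod_beta'\<close>)
    finally show ?thesis .
  qed
  have Wm: "(\<lambda>z. ?W (snd z) (fst z)) \<in> borel_measurable (PiM J (\<lambda>_. lborel) \<Otimes>\<^sub>M PiM L (\<lambda>_. lborel))"
  proof -
    have [measurable]: "Measurable.pred ((PiM J (\<lambda>_. lborel) \<Otimes>\<^sub>M PiM L (\<lambda>_. lborel)) \<Otimes>\<^sub>M hyp e) (\<lambda>z. K (snd (fst z)) (fst (fst z)) (snd z))"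
      by (intro K_meas) measurable
    show ?thesis by measurable
  qed
  have uW: "box_unimodal J (?W s)" if s: "s \<in> space (PiM L (\<lambda>_. lborel))" for s
  proof (rule box_unimodal_section[OF finite_J])
    show "Measurable.pred (PiM J (\<lambda>_. lborel) \<Otimes>\<^sub>M hyp e) (\<lambda>z. K s (fst z) (snd z))"
      using s by (intro K_meas) auto
    show "K s (\<lambda>j\<in>J. (1 - c) * t j + c * t' j) (\<lambda>i\<in>Basis - {e}. (1 - c) * v i + c * v' i)"
      if c: "0 < c" "c < 1" and k: "K s t v" "K s t' v'" for t t' v v' c
      unfolding K_def
    proof (intro ballI conjI)
      fix l assume l: "l \<in> L"
      let ?g = "g l (\<lambda>j\<in>J. (1 - c) * t j + c * t' j) (\<lambda>i\<in>Basis - {e}. (1 - c) * v i + c * v' i)"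
      show "0 < s l" using k l by (simp add: K_def)
      have "ennreal (s l) < ennreal (max (g l t v) (g l t' v') powr (- q))"
        using k l unfolding K_def by (simp add: max_def)
      also have "\<dots> \<le> ennreal (?g powr (- q))"
        using gpos[OF l] g_conv[OF l c] q_pos by (intro ennreal_leI powr_mono2') auto
      finally show "ennreal (s l) < ennreal (?g powr (- q))" .
    qed
    show "K s (\<lambda>j\<in>J. - t j) (\<lambda>i\<in>Basis - {e}. - v i)" if "K s t v" for t v
      using that g_sym unfolding K_def by simp
  qed simp
  have "box_unimodal J (\<lambda>t. ennreal (2 / real DIM('a)) * (\<integral>\<^sup>+ s. ?W s t \<partial>PiM L (\<lambda>_. lborel)))"
  proof (rule box_unimodal_cmult)
    show "box_unimodal J (\<lambda>t. \<integral>\<^sup>+ s. ?W s t \<partial>PiM L (\<lambda>_. lborel))"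
      by (rule box_unimodal_nn_integral[OF finite_J Lm.sigma_finite_measure_axioms _ uW]) (use Wm in \<open>simp add: case_prod_beta'\<close>)
    show "(\<lambda>t. \<integral>\<^sup>+ s. ?W s t \<partial>PiM L (\<lambda>_. lborel)) \<in> borel_measurable (PiM J (\<lambda>_. lborel))"
      by (rule Lm.borel_measurable_nn_integral) (use Wm in \<open>simp add: case_prod_beta'\<close>)
  qed
  then show ?thesis
    unfolding box_unimodal_def by (simp only: Psi cong: nn_integral_cong)
qed

end

section \<open>Radii of balls, and monotone limits of products and of regularised powers\<close>

lemma ball_radius_le:
  assumes "0 \<le> r" "0 \<le> s" "emeasure lborel (ball (0::real^'n) r) \<le> emeasure lborel (ball (0::real^'n) s)"
  shows "r \<le> s"
proof -
  have "0 < measure lborel (ball (0::real^'n) 1)" by (rule content_ball_pos) simp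
  then have "r ^ CARD('n) \<le> s ^ CARD('n)"
    using assms by (simp add: content_ball_vec ennreal_le_iff)
  then show ?thesis using assms(2) by (rule power_le_imp_le_base[of r "CARD('n) - 1" s, simplified])
qed

lemma SUP_mult_incseq_ennreal:
  fixes f g :: "nat \<Rightarrow> ennreal"
  assumes f: "incseq f" and g: "incseq g"
  shows "(SUP i. f i * g i) = (SUP i. f i) * (SUP i. g i)"
proof (rule antisym)
  show "(SUP i. f i * g i) \<le> (SUP i. f i) * (SUP i. g i)"
    by (intro SUP_least mult_mono SUP_upper) auto
  have "(SUP i. f i) * (SUP i. g i) = (SUP i. SUP j. f i * g j)"
    by (subst SUP_mult_right_ennreal, subst SUP_mult_left_ennreal) (rule refl)
  also have "\<dots> \<le> (SUP i. f i * g i)"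
  proof (intro SUP_least)
    fix i j
    have "f i * g j \<le> f (max i j) * g (max i j)"
      using f g by (intro mult_mono) (auto simp: incseq_def)
    also have "\<dots> \<le> (SUP i. f i * g i)" by (rule SUP_upper) simp
    finally show "f i * g j \<le> (SUP i. f i * g i)" .
  qed
  finally show "(SUP i. f i) * (SUP i. g i) \<le> (SUP i. f i * g i)" .
qed

lemma SUP_prod_incseq_ennreal:
  fixes f :: "'a \<Rightarrow> nat \<Rightarrow> ennreal"
  assumes "finite A" "\<And>a. a \<in> A \<Longrightarrow> incseq (f a)"
  shows "(SUP i. \<Prod>a\<in>A. f a i) = (\<Prod>a\<in>A. SUP i. f a i)"
  using assms
proof (induction A)
  case (insert a A)
  have "incseq (\<lambda>i. \<Prod>a\<in>A. f a i)"
    using insert.prems unfolding incseq_def by (auto intro!: prod_mono_ennreal)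
  then show ?case
    using insert by (simp add: SUP_mult_incseq_ennreal)
qed simp

text \<open>The regularised powers increase to the power with the convention that 0 has the value
  infinity, so monotone convergence restores exactly the conventions of the original definitions.
  \<open>c\<close> stands for the norm of e + v.\<close>

lemma powe_SUP:
  assumes h: "0 \<le> h" and c: "0 < c" and q: "0 < q"
  shows "incseq (\<lambda>i. ennreal ((h + 1 / real (Suc i) * c) powr (- q)))"
    and "(SUP i. ennreal ((h + 1 / real (Suc i) * c) powr (- q))) = powe h (- q)"
proof -
  let ?f = "\<lambda>i. (h + 1 / real (Suc i) * c) powr (- q)"
  have pos: "0 < h + 1 / real (Suc i) * c" for i using h c by (simp add: add_nonneg_pos)
  show inc: "incseq (\<lambda>i. ennreal (?f i))"
  proof (rule incseq_SucI)
    fix i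
    have "h + 1 / real (Suc (Suc i)) * c \<le> h + 1 / real (Suc i) * c"
      using c by (intro add_left_mono mult_right_mono divide_left_mono) auto
    then show "ennreal (?f i) \<le> ennreal (?f (Suc i))"
      using pos[of "Suc i"] q by (intro ennreal_leI powr_mono2') auto
  qed
  have lim: "(\<lambda>i. h + 1 / real (Suc i) * c) \<longlonglongrightarrow> h + 0 * c"
    by (intro tendsto_intros LIMSEQ_Suc lim_1_over_n)
  show "(SUP i. ennreal (?f i)) = powe h (- q)"
  proof (cases "h = 0")
    case False
    then have "?f \<longlonglongrightarrow> h powr (- q)" using lim h by (intro tendsto_powr[where b="- q"]) auto
    then have "(\<lambda>i. ennreal (?f i)) \<longlonglongrightarrow> ennreal (h powr (- q))" by (intro tendsto_ennrealI)
    then have "(SUP i. ennreal (?f i)) = ennreal (h powr (- q))"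
      using LIMSEQ_SUP[OF inc] LIMSEQ_unique by blast
    then show ?thesis using False by (simp add: powe_def)
  next
    case True
    have "(SUP i. ennreal (?f i)) = \<infinity>"
    proof (rule ccontr)
      assume "(SUP i. ennreal (?f i)) \<noteq> \<infinity>"
      then obtain r where r: "(SUP i. ennreal (?f i)) = ennreal r" "0 \<le> r" by (cases "SUP i. ennreal (?f i)") auto
      have le: "?f i \<le> r" for i
      proof -
        have "ennreal (?f i) \<le> ennreal r" unfolding r(1)[symmetric] by (rule SUP_upper) simp
        then show ?thesis using r(2) by (simp add: ennreal_le_iff)
      qed
      \<comment> \<open>Chosen so that the power -q of \<open>w\<close> is \<open>r + 1\<close>,
        above the supposed bound \<open>r\<close>.\<close>
      define w where "w = (r + 1) powr (- 1 / q)"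
      have w: "0 < w" using r by (simp add: w_def)
      have "(\<lambda>i. h + 1 / real (Suc i) * c) \<longlonglongrightarrow> 0" using lim True by simp
      then obtain i where "h + 1 / real (Suc i) * c < w"
        using w order_tendstoD(2)[of _ 0 sequentially w] by (auto dest: eventually_happens simp: eventually_sequentially)
      then have "w powr (- q) \<le> ?f i" using pos[of i] q by (intro powr_mono2') auto
      moreover have "w powr (- q) = r + 1" using r q by (simp add: w_def powr_powr)
      ultimately show False using le[of i] by simp
    qed
    then show ?thesis using True q by (simp add: powe_def)
  qed
qed

section \<open>From bounded sets to sets of finite volume\<close>

context gauge_family
begin

text \<open>The sets are cut by balls of radius m + 1. The ball with the volume of a cut set has
  radius at most m + 1, as the bounded case demands, and is contained in the ball for the whole set;
  monotone convergence in m finishes.\<close>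

lemma nn_integral_Psi_sets_le:
  fixes A :: "'j \<Rightarrow> (real^'n) set"
  assumes dim: "q * real (card L) = real CARD('n)" and \<epsilon>: "0 < \<epsilon>"
    and A: "\<And>j. j \<in> J \<Longrightarrow> A j \<in> sets borel" and fin: "\<And>j. j \<in> J \<Longrightarrow> emeasure lborel (A j) < \<infinity>"
  shows "(\<integral>\<^sup>+ x. Psi \<epsilon> x * (\<Prod>j\<in>J. indicator (A j) (x j)) \<partial>PiM J (\<lambda>_. lborel))
      \<le> (\<integral>\<^sup>+ x. Psi \<epsilon> x * (\<Prod>j\<in>J. indicator (sym_ball (A j)) (x j)) \<partial>PiM J (\<lambda>_. lborel))"
proof -
  obtain e :: "real^'n" where e: "e \<in> Basis" using nonempty_Basis by blast
  have dim': "q * real (card L) = real DIM(real^'n)" using dim by simp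
  note Psi_measurable[OF dim' less_imp_le[OF \<epsilon>], measurable]
  let ?I = "\<lambda>A. \<integral>\<^sup>+ x. Psi \<epsilon> x * (\<Prod>j\<in>J. indicator (A j) (x j)) \<partial>PiM J (\<lambda>_. lborel)"
  define B where "B m j = A j \<inter> cball 0 (real (Suc m))" for m j
  have B: "B m j \<in> sets borel" if "j \<in> J" for m j using A[OF that] by (auto simp: B_def)
  have le: "?I (B m) \<le> ?I (\<lambda>j. sym_ball (A j))" for m
  proof -
    have "\<exists>r. 0 \<le> r \<and> emeasure lborel (ball (0::real^'n) r) = emeasure lborel (B m j) \<and> ball 0 r \<subseteq> sym_ball (A j) \<and> r \<le> real (Suc m)" if j: "j \<in> J" for j
    proof -
      have BA: "emeasure lborel (B m j) \<le> emeasure lborel (A j)" using A[OF j] by (intro emeasure_mono) (auto simp: B_def)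
      obtain r where r: "0 \<le> r" "sym_ball (B m j) = ball 0 r" "emeasure lborel (ball (0::real^'n) r) = emeasure lborel (B m j)"
        using sym_ball_eq_ball[OF B[OF j] le_less_trans[OF BA fin[OF j]]] .
      obtain s where s: "0 \<le> s" "sym_ball (A j) = ball 0 s" "emeasure lborel (ball (0::real^'n) s) = emeasure lborel (A j)"
        using sym_ball_eq_ball[OF A[OF j] fin[OF j]] .
      have rs: "r \<le> s" by (rule ball_radius_le[where 'n='n, OF r(1) s(1)]) (simp only: r(3) s(3) BA)
      have rm: "r \<le> real (Suc m)"
      proof (rule ball_radius_le[where 'n='n])
        have "emeasure lborel (B m j) \<le> emeasure lborel (cball (0::real^'n) (real (Suc m)))"
          by (intro emeasure_mono) (auto simp: B_def)
        also have "\<dots> = emeasure lborel (ball (0::real^'n) (real (Suc m)))"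
        proof -
          have "cball (0::real^'n) (real (Suc m)) = ball 0 (real (Suc m)) \<union> sphere 0 (real (Suc m))" by auto
          moreover have "sphere (0::real^'n) (real (Suc m)) \<in> null_sets lborel"
            using negligible_sphere[of "0::real^'n" "real (Suc m)"]
            unfolding negligible_iff_null_sets by (subst (asm) null_sets_completion_iff) auto
          ultimately show ?thesis by (simp add: emeasure_Un_null_set)
        qed
        finally show "emeasure lborel (ball (0::real^'n) r) \<le> emeasure lborel (ball (0::real^'n) (real (Suc m)))"
          by (simp only: r(3))
      qed (simp_all add: r(1))
      have "ball 0 r \<subseteq> sym_ball (A j)" unfolding s(2) using rs by (rule subset_ball)
      then show ?thesis using r(1,3) rm by blast
    qed
    then obtain \<rho> where \<rho>: "\<And>j. j \<in> J \<Longrightarrow> 0 \<le> \<rho> j" "\<And>j. j \<in> J \<Longrightarrow> emeasure lborel (ball (0::real^'n) (\<rho> j)) = emeasure lborel (B m j)"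
      "\<And>j. j \<in> J \<Longrightarrow> ball 0 (\<rho> j) \<subseteq> sym_ball (A j)" "\<And>j. j \<in> J \<Longrightarrow> \<rho> j \<le> real (Suc m)" by metis
    have "?I (B m) \<le> ?I (\<lambda>j. ball (0::real^'n) (\<rho> j))"
    proof (rule nn_integral_le_balls_bounded[where R="real (Suc m)", OF e finite_J])
      show "Psi \<epsilon> x \<le> ennreal (measure lborel (ball (0::real^'n) (1 / \<epsilon>)))" for x :: "'j \<Rightarrow> real^'n" by (rule Psi_le[OF \<epsilon>])
      show "Psi \<epsilon> (\<lambda>j\<in>J. T (x j)) = Psi \<epsilon> x" if "orthogonal_transformation T" for T :: "real^'n \<Rightarrow> real^'n" and x by (rule Psi_orthogonal[OF that])
      show "box_unimodal J (\<lambda>t. Psi \<epsilon> (\<lambda>j\<in>J. t j *\<^sub>R e + emb e (y j)))" for y by (rule Psi_box_unimodal[OF dim' \<epsilon> e])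
      show "B m j \<in> sets borel" if "j \<in> J" for j by (rule B[OF that])
      show "B m j \<subseteq> cball 0 (real (Suc m))" for j by (auto simp: B_def)
      show "emeasure lborel (B m j) = emeasure lborel (ball (0::real^'n) (\<rho> j))" if "j \<in> J" for j using \<rho>(2)[OF that] by simp
      show "\<rho> j \<le> real (Suc m)" if "j \<in> J" for j by (rule \<rho>(4)[OF that])
    qed auto
    also have "\<dots> \<le> ?I (\<lambda>j. sym_ball (A j))"
      using \<rho>(3) by (intro nn_integral_mono mult_left_mono prod_mono_ennreal) (auto simp: indicator_def subset_iff)
    finally show ?thesis .
  qed
  have pt: "(SUP m. Psi \<epsilon> x * (\<Prod>j\<in>J. indicator (B m j) (x j))) = Psi \<epsilon> x * (\<Prod>j\<in>J. indicator (A j) (x j))" for x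
  proof -
    have inc: "incseq (\<lambda>m. indicator (B m j) (x j) :: ennreal)" for j
      by (auto simp: incseq_def B_def indicator_def)
    have "(SUP m. indicator (B m j) (x j)) = (indicator (A j) (x j) :: ennreal)" for j
    proof -
      obtain m :: nat where "norm (x j) \<le> real m" using real_arch_simple by blast
      then have m: "norm (x j) \<le> real (Suc m)" by simp
      have "indicator (A j) (x j) = (indicator (B m j) (x j) :: ennreal)" using m by (auto simp: B_def indicator_def)
      also have "\<dots> \<le> (SUP m. indicator (B m j) (x j))" by (rule SUP_upper) simp
      finally show ?thesis by (intro antisym SUP_least) (auto simp: B_def indicator_def)
    qed
    then show ?thesis using SUP_prod_incseq_ennreal[OF finite_J inc] by (simp add: SUP_mult_left_ennreal[symmetric])
  qed
  have "?I A = (SUP m. ?I (B m))"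
    unfolding pt[symmetric]
  proof (rule nn_integral_monotone_convergence_SUP)
    show "incseq (\<lambda>m x. Psi \<epsilon> x * (\<Prod>j\<in>J. indicator (B m j) (x j)))"
      by (auto simp: incseq_def le_fun_def B_def indicator_def intro!: mult_left_mono prod_mono_ennreal)
    show "(\<lambda>x. Psi \<epsilon> x * (\<Prod>j\<in>J. indicator (B m j) (x j))) \<in> borel_measurable (PiM J (\<lambda>_. lborel))" for m
      using borel_measurable_prod_indicator_PiM[of J "B m" lborel] B by measurable
  qed
  also have "\<dots> \<le> ?I (\<lambda>j. sym_ball (A j))" by (rule SUP_least) (rule le)
  finally show ?thesis .
qed

end

text \<open>Above an essential bound \<open>M\<close> the superlevel sets are null, and
  \<open>sym_ball\<close> sends a null set to the ball of radius 0, which is empty. The integral is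
  thus at most \<open>max 0 M\<close>, and \<open>enn2real\<close> loses nothing.\<close>

lemma ennreal_sym_rearr:
  fixes f :: "real^'n \<Rightarrow> real"
  assumes f[measurable]: "f \<in> borel_measurable borel" and M: "AE x in lborel. f x \<le> M"
  shows "ennreal (sym_rearr f x) = (\<integral>\<^sup>+ t. indicator {0<..} t * indicator (sym_ball {y. f y > t}) x \<partial>lborel)"
proof -
  have "sym_ball {y. f y > t} = {}" if "M \<le> t" for t
  proof -
    have "AE x in lborel. \<not> t < f x" using M that by (auto elim!: eventually_mono)
    then have "emeasure lborel {y. t < f y} = 0" by (subst (asm) AE_iff_measurable[OF _ refl]) auto
    then show ?thesis by (simp add: sym_ball_def)
  qed
  then have "(\<integral>\<^sup>+ t. indicator {0<..} t * indicator (sym_ball {y. f y > t}) x \<partial>lborel) \<le> (\<integral>\<^sup>+ t. indicator {0..max 0 M} t \<partial>lborel)"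
    by (intro nn_integral_mono) (auto simp: indicator_def not_less intro: ccontr)
  also have "\<dots> < \<infinity>" by simp
  finally show ?thesis unfolding sym_rearr_def by (intro ennreal_enn2real) simp
qed

lemma sym_ball_superlevel_measurable:
  fixes f :: "real^'n \<Rightarrow> real"
  assumes f[measurable]: "f \<in> borel_measurable borel"
  shows "(\<lambda>z. indicator (sym_ball {y. f y > fst z}) (snd z) :: ennreal) \<in> borel_measurable (lborel \<Otimes>\<^sub>M lborel)"
proof -
  define r where "r t = (enn2real (emeasure lborel {y. f y > t}) / measure lebesgue (ball (0::real^'n) 1)) powr (1 / real CARD('n))" for t
  have [measurable]: "(\<lambda>t. emeasure lborel {y. f y > t}) \<in> borel_measurable borel"
  proof -
    have "(\<lambda>t. \<integral>\<^sup>+ y. indicator {y. f y > t} y \<partial>lborel) \<in> borel_measurable borel" by measurable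
    then show ?thesis by simp
  qed
  have [measurable]: "r \<in> borel_measurable borel" unfolding r_def by measurable
  have "sym_ball {y. f y > t} = ball 0 (r t)" for t
    unfolding sym_ball_def r_def by simp
  then have "(\<lambda>z. indicator (sym_ball {y. f y > fst z}) (snd z) :: ennreal) = indicator {z. norm (snd z) < r (fst z)}"
    by (auto simp: indicator_def fun_eq_iff)
  moreover have "Measurable.pred (lborel \<Otimes>\<^sub>M lborel) (\<lambda>z :: real \<times> (real^'n). norm (snd z) < r (fst z))" by measurable
  then have "{z :: real \<times> (real^'n). norm (snd z) < r (fst z)} \<in> sets (lborel \<Otimes>\<^sub>M lborel)"
    by (simp add: pred_def space_pair_measure)
  ultimately show ?thesis by simp
qed

section \<open>From sets to densities, and the limit of vanishing regularisation\<close>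

context gauge_family
begin

text \<open>The layer-cake formula for every density, applied to all points at once, reduces the
  claim to superlevel sets, with one level \<open>s j\<close> for each point;
  \<open>sym_rearr\<close> is by definition the layer-cake integral over the rearranged superlevel
  sets.\<close>

lemma nn_integral_Psi_functions_le:
  fixes f :: "'j \<Rightarrow> real^'n \<Rightarrow> real"
  assumes dim: "q * real (card L) = real CARD('n)" and \<epsilon>: "0 < \<epsilon>"
    and f: "\<And>j. j \<in> J \<Longrightarrow> f j \<in> borel_measurable borel" "\<And>j z. j \<in> J \<Longrightarrow> 0 \<le> f j z"
      "\<And>j. j \<in> J \<Longrightarrow> (\<integral>\<^sup>+ x. ennreal (f j x) \<partial>lborel) < \<infinity>" "\<And>j. j \<in> J \<Longrightarrow> \<exists>M. AE x in lborel. f j x \<le> M"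
  shows "(\<integral>\<^sup>+ x. Psi \<epsilon> x * (\<Prod>j\<in>J. ennreal (f j (x j))) \<partial>PiM J (\<lambda>_. lborel))
      \<le> (\<integral>\<^sup>+ x. Psi \<epsilon> x * (\<Prod>j\<in>J. ennreal (sym_rearr (f j) (x j))) \<partial>PiM J (\<lambda>_. lborel))"
proof -
  have dim': "q * real (card L) = real DIM(real^'n)" using dim by simp
  note Psi_m[measurable] = Psi_measurable[OF dim' less_imp_le[OF \<epsilon>]]
  interpret PL: product_sigma_finite "\<lambda>_. lborel :: real measure" by (rule product_sigma_finite_lborel)
  interpret S: sigma_finite_measure "PiM J (\<lambda>_. lborel :: real measure)" by (rule sigma_finite_PiM_lborel[OF finite_J])
  interpret X: sigma_finite_measure "PiM J (\<lambda>_. lborel :: (real^'n) measure)" by (rule sigma_finite_PiM_lborel[OF finite_J])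
  interpret XS: pair_sigma_finite "PiM J (\<lambda>_. lborel :: (real^'n) measure)" "PiM J (\<lambda>_. lborel :: real measure)" ..
  have swap: "(\<integral>\<^sup>+ x. Psi \<epsilon> x * (\<Prod>j\<in>J. \<integral>\<^sup>+ s. c j s (x j) \<partial>lborel) \<partial>PiM J (\<lambda>_. lborel))
    = (\<integral>\<^sup>+ s. (\<integral>\<^sup>+ x. Psi \<epsilon> x * (\<Prod>j\<in>J. c j (s j) (x j)) \<partial>PiM J (\<lambda>_. lborel)) \<partial>PiM J (\<lambda>_. lborel))"
    if c: "\<And>j. j \<in> J \<Longrightarrow> (\<lambda>z. c j (fst z) (snd z)) \<in> borel_measurable (lborel \<Otimes>\<^sub>M lborel)" for c :: "'j \<Rightarrow> real \<Rightarrow> real^'n \<Rightarrow> ennreal"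
  proof -
    have cm: "(\<lambda>s. c j s z) \<in> borel_measurable lborel" if "j \<in> J" for j z
      using measurable_compose[OF measurable_Pair2' c[OF that], of z] by simp
    have jm[measurable]: "(\<lambda>z. \<Prod>j\<in>J. c j (snd z j) (fst z j)) \<in> borel_measurable (PiM J (\<lambda>_. lborel) \<Otimes>\<^sub>M PiM J (\<lambda>_. lborel))"
    proof (rule borel_measurable_prod_ennreal)
      fix j assume j: "j \<in> J"
      have "(\<lambda>z. (snd z j, fst z j)) \<in> measurable (PiM J (\<lambda>_. lborel) \<Otimes>\<^sub>M PiM J (\<lambda>_. lborel)) (lborel \<Otimes>\<^sub>M (lborel :: (real^'n) measure))"
        using j by measurable
      from measurable_compose[OF this c[OF j]]
      show "(\<lambda>z. c j (snd z j) (fst z j)) \<in> borel_measurable (PiM J (\<lambda>_. lborel) \<Otimes>\<^sub>M PiM J (\<lambda>_. lborel))" by simp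
    qed
    have "(\<integral>\<^sup>+ x. Psi \<epsilon> x * (\<Prod>j\<in>J. \<integral>\<^sup>+ s. c j s (x j) \<partial>lborel) \<partial>PiM J (\<lambda>_. lborel))
      = (\<integral>\<^sup>+ x. (\<integral>\<^sup>+ s. Psi \<epsilon> x * (\<Prod>j\<in>J. c j (s j) (x j)) \<partial>PiM J (\<lambda>_. lborel)) \<partial>PiM J (\<lambda>_. lborel))"
    proof (rule nn_integral_cong)
      fix x assume x: "x \<in> space (PiM J (\<lambda>_. lborel :: (real^'n) measure))"
      have "(\<lambda>s. \<Prod>j\<in>J. c j (s j) (x j)) \<in> borel_measurable (PiM J (\<lambda>_. lborel))"
        using measurable_compose[OF measurable_Pair1'[OF x] jm] by simp
      then show "Psi \<epsilon> x * (\<Prod>j\<in>J. \<integral>\<^sup>+ s. c j s (x j) \<partial>lborel) = (\<integral>\<^sup>+ s. Psi \<epsilon> x * (\<Prod>j\<in>J. c j (s j) (x j)) \<partial>PiM J (\<lambda>_. lborel))"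
        using PL.product_nn_integral_prod[OF finite_J, of "\<lambda>j s. c j s (x j)"] cm by (simp add: nn_integral_cmult)
    qed
    also have "\<dots> = (\<integral>\<^sup>+ s. (\<integral>\<^sup>+ x. Psi \<epsilon> x * (\<Prod>j\<in>J. c j (s j) (x j)) \<partial>PiM J (\<lambda>_. lborel)) \<partial>PiM J (\<lambda>_. lborel))"
      by (rule XS.Fubini'[symmetric]) (use jm in \<open>simp add: case_prod_beta'\<close>)
    finally show ?thesis .
  qed
  let ?a = "\<lambda>j s z. indicator {0<..} s * indicator {y. f j y > s} z :: ennreal"
  let ?b = "\<lambda>j s z. indicator {0<..} s * indicator (sym_ball {y. f j y > s}) z :: ennreal"
  have fa: "ennreal (f j z) = (\<integral>\<^sup>+ s. ?a j s z \<partial>lborel)" if "j \<in> J" for j z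
  proof -
    have "ennreal (f j z) = (\<integral>\<^sup>+ s. indicator {s. 0 < s \<and> ennreal s < ennreal (f j z)} s \<partial>lborel)"
      by (simp only: nn_integral_layer_cake_const)
    also have "\<dots> = (\<integral>\<^sup>+ s. ?a j s z \<partial>lborel)"
      by (intro nn_integral_cong) (auto simp: indicator_def ennreal_less_iff)
    finally show ?thesis .
  qed
  have fb: "ennreal (sym_rearr (f j) z) = (\<integral>\<^sup>+ s. ?b j s z \<partial>lborel)" if j: "j \<in> J" for j z
    using ennreal_sym_rearr[OF f(1)[OF j]] f(4)[OF j] by blast
  have am: "(\<lambda>z. ?a j (fst z) (snd z)) \<in> borel_measurable (lborel \<Otimes>\<^sub>M lborel)" if "j \<in> J" for j
  proof -
    have [measurable]: "f j \<in> borel_measurable borel" using f(1)[OF that] .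
    show ?thesis by measurable
  qed
  have bm: "(\<lambda>z. ?b j (fst z) (snd z)) \<in> borel_measurable (lborel \<Otimes>\<^sub>M lborel)" if "j \<in> J" for j
    using sym_ball_superlevel_measurable[OF f(1)[OF that]] by measurable
  have le: "(\<integral>\<^sup>+ x. Psi \<epsilon> x * (\<Prod>j\<in>J. ?a j (s j) (x j)) \<partial>PiM J (\<lambda>_. lborel))
    \<le> (\<integral>\<^sup>+ x. Psi \<epsilon> x * (\<Prod>j\<in>J. ?b j (s j) (x j)) \<partial>PiM J (\<lambda>_. lborel))" for s
  proof (cases "\<forall>j\<in>J. 0 < s j")
    case True
    have "(\<integral>\<^sup>+ x. Psi \<epsilon> x * (\<Prod>j\<in>J. indicator {y. f j y > s j} (x j)) \<partial>PiM J (\<lambda>_. lborel))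
      \<le> (\<integral>\<^sup>+ x. Psi \<epsilon> x * (\<Prod>j\<in>J. indicator (sym_ball {y. f j y > s j}) (x j)) \<partial>PiM J (\<lambda>_. lborel))"
    proof (rule nn_integral_Psi_sets_le[OF dim \<epsilon>])
      fix j assume j: "j \<in> J"
      have [measurable]: "f j \<in> borel_measurable borel" using f(1)[OF j] .
      show "{y. s j < f j y} \<in> sets borel" by measurable
      \<comment> \<open>Markov's inequality: superlevel sets at positive levels have finite
        volume.\<close>
      have "ennreal (s j) * emeasure lborel {y. s j < f j y} = (\<integral>\<^sup>+ x. ennreal (s j) * indicator {y. s j < f j y} x \<partial>lborel)"
        by (simp add: nn_integral_cmult)
      also have "\<dots> \<le> (\<integral>\<^sup>+ x. ennreal (f j x) \<partial>lborel)"
        by (intro nn_integral_mono) (auto simp: indicator_def intro!: ennreal_leI)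
      also have "\<dots> < \<infinity>" by (rule f(3)[OF j])
      finally show "emeasure lborel {y. s j < f j y} < \<infinity>"
        using True j by (auto simp: ennreal_mult_less_top)
    qed
    then show ?thesis using True by (simp cong: prod.cong)
  next
    case False
    then obtain j where j: "j \<in> J" "\<not> 0 < s j" by blast
    have "(\<Prod>j\<in>J. ?a j (s j) (x j)) = 0" for x
      using j finite_J by (intro prod_zero bexI[of _ j]) auto
    then show ?thesis by (simp only: mult_zero_right nn_integral_const mult_zero_left zero_le)
  qed
  have "(\<integral>\<^sup>+ x. Psi \<epsilon> x * (\<Prod>j\<in>J. ennreal (f j (x j))) \<partial>PiM J (\<lambda>_. lborel)) = (\<integral>\<^sup>+ x. Psi \<epsilon> x * (\<Prod>j\<in>J. \<integral>\<^sup>+ s. ?a j s (x j) \<partial>lborel) \<partial>PiM J (\<lambda>_. lborel))"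
    by (intro nn_integral_cong arg_cong2[where f="(*)"] prod.cong refl fa)
  also have "\<dots> = (\<integral>\<^sup>+ s. (\<integral>\<^sup>+ x. Psi \<epsilon> x * (\<Prod>j\<in>J. ?a j (s j) (x j)) \<partial>PiM J (\<lambda>_. lborel)) \<partial>PiM J (\<lambda>_. lborel))"
    by (rule swap[OF am])
  also have "\<dots> \<le> (\<integral>\<^sup>+ s. (\<integral>\<^sup>+ x. Psi \<epsilon> x * (\<Prod>j\<in>J. ?b j (s j) (x j)) \<partial>PiM J (\<lambda>_. lborel)) \<partial>PiM J (\<lambda>_. lborel))"
    by (rule nn_integral_mono) (rule le)
  also have "\<dots> = (\<integral>\<^sup>+ x. Psi \<epsilon> x * (\<Prod>j\<in>J. \<integral>\<^sup>+ s. ?b j s (x j) \<partial>lborel) \<partial>PiM J (\<lambda>_. lborel))"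
    by (rule swap[OF bm, symmetric])
  also have "\<dots> = (\<integral>\<^sup>+ x. Psi \<epsilon> x * (\<Prod>j\<in>J. ennreal (sym_rearr (f j) (x j))) \<partial>PiM J (\<lambda>_. lborel))"
    by (intro nn_integral_cong arg_cong2[where f="(*)"] prod.cong refl fb[symmetric])
  finally show ?thesis .
qed

text \<open>The limit of \<open>Psi\<close> as \<epsilon> tends to 0. Setting \<epsilon> = 0 in
  \<open>kernel\<close> would not do: \<open>0 powr (- q)\<close> is 0, whereas a vanishing gauge
  has to contribute infinity.\<close>

definition volume :: "'a::euclidean_space \<Rightarrow> ('j \<Rightarrow> 'a) \<Rightarrow> ennreal" where
  "volume e x = ennreal (2 / real DIM('a)) * (\<integral>\<^sup>+ v. (\<Prod>l\<in>L. powe (H l (\<lambda>j\<in>J. x j \<bullet> (e + emb e v))) (- q)) \<partial>hyp e)"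

lemma volume_eq_SUP:
  fixes e :: "'a::euclidean_space"
  assumes dim: "q * real (card L) = real DIM('a)" and e: "e \<in> Basis" and x: "x \<in> space (PiM J (\<lambda>_. lborel))"
  shows "incseq (\<lambda>i. Psi (1 / real (Suc i)) x)" "volume e x = (SUP i. Psi (1 / real (Suc i)) x)"
proof -
  let ?h = "\<lambda>l v. H l (\<lambda>j\<in>J. x j \<bullet> (e + emb e v))"
  have npos: "0 < norm (e + emb e v)" for v
  proof -
    have "(e + emb e v) \<bullet> e = 1" using e by (simp add: inner_add_left emb_orthogonal)
    then have "e + emb e v \<noteq> 0" by auto
    then show ?thesis by simp
  qed
  have ker: "incseq (\<lambda>i. kernel (1 / real (Suc i)) x (e + emb e v))" for v
    unfolding incseq_def kernel_def
    using powe_SUP(1)[OF H_nonneg npos q_pos] by (auto intro!: prod_mono_ennreal simp: incseq_def)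
  then have inc: "incseq (\<lambda>i v. kernel (1 / real (Suc i)) x (e + emb e v))"
    by (auto simp: incseq_def le_fun_def)
  have eq: "Psi (1 / real (Suc i)) x = ennreal (2 / real DIM('a)) * (\<integral>\<^sup>+ v. kernel (1 / real (Suc i)) x (e + emb e v) \<partial>hyp e)" for i
    by (rule Psi_eq[OF dim _ e]) simp
  show "incseq (\<lambda>i. Psi (1 / real (Suc i)) x)"
    unfolding eq incseq_def using ker by (auto intro!: mult_left_mono nn_integral_mono simp: incseq_def)
  have "(\<Prod>l\<in>L. powe (?h l v) (- q)) = (SUP i. kernel (1 / real (Suc i)) x (e + emb e v))" for v
    unfolding kernel_def
    using SUP_prod_incseq_ennreal[OF finite_L, of "\<lambda>l i. ennreal ((?h l v + 1 / real (Suc i) * norm (e + emb e v)) powr (- q))"]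
      powe_SUP[OF H_nonneg npos q_pos] by simp
  then have "volume e x = ennreal (2 / real DIM('a)) * (\<integral>\<^sup>+ v. (SUP i. kernel (1 / real (Suc i)) x (e + emb e v)) \<partial>hyp e)"
    by (simp add: volume_def)
  also have "(\<integral>\<^sup>+ v. (SUP i. kernel (1 / real (Suc i)) x (e + emb e v)) \<partial>hyp e) = (SUP i. \<integral>\<^sup>+ v. kernel (1 / real (Suc i)) x (e + emb e v) \<partial>hyp e)"
    by (rule nn_integral_monotone_convergence_SUP[OF inc]) (use x in measurable)
  also have "ennreal (2 / real DIM('a)) * \<dots> = (SUP i. Psi (1 / real (Suc i)) x)"
    unfolding eq by (rule SUP_mult_left_ennreal)
  finally show "volume e x = (SUP i. Psi (1 / real (Suc i)) x)" .
qed

text \<open>On the left, monotone convergence expresses the integral as a supremum over the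
  regularised ones; on the right it suffices that each \<open>Psi\<close> is at most
  \<open>volume\<close>.\<close>

lemma nn_integral_volume_rearrange:
  fixes f :: "'j \<Rightarrow> real^'n \<Rightarrow> real"
  assumes dim: "q * real (card L) = real CARD('n)" and e: "e \<in> Basis"
    and f: "\<And>j. j \<in> J \<Longrightarrow> f j \<in> borel_measurable borel" "\<And>j z. j \<in> J \<Longrightarrow> 0 \<le> f j z"
      "\<And>j. j \<in> J \<Longrightarrow> (\<integral>\<^sup>+ x. ennreal (f j x) \<partial>lborel) < \<infinity>" "\<And>j. j \<in> J \<Longrightarrow> \<exists>M. AE x in lborel. f j x \<le> M"
  shows "(\<integral>\<^sup>+ x. volume e x * (\<Prod>j\<in>J. ennreal (f j (x j))) \<partial>PiM J (\<lambda>_. lborel))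
      \<le> (\<integral>\<^sup>+ x. volume e x * (\<Prod>j\<in>J. ennreal (sym_rearr (f j) (x j))) \<partial>PiM J (\<lambda>_. lborel))"
proof -
  have dim': "q * real (card L) = real DIM(real^'n)" using dim by simp
  let ?P = "\<lambda>i. Psi (1 / real (Suc i))" and ?w = "\<lambda>x. \<Prod>j\<in>J. ennreal (f j (x j))"
  let ?w' = "\<lambda>x. \<Prod>j\<in>J. ennreal (sym_rearr (f j) (x j))"
  have Pm[measurable]: "?P i \<in> borel_measurable (PiM J (\<lambda>_. lborel :: (real^'n) measure))" for i
    by (rule Psi_measurable[OF dim']) simp
  have wm[measurable]: "?w \<in> borel_measurable (PiM J (\<lambda>_. lborel))"
  proof (rule borel_measurable_prod_ennreal)
    fix j assume j: "j \<in> J"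
    show "(\<lambda>x. ennreal (f j (x j))) \<in> borel_measurable (PiM J (\<lambda>_. lborel))"
      using measurable_compose[OF measurable_component_singleton[OF j, of "\<lambda>_. lborel"], of "\<lambda>z. ennreal (f j z)" borel] f(1)[OF j] by simp
  qed
  have "(\<integral>\<^sup>+ x. volume e x * ?w x \<partial>PiM J (\<lambda>_. lborel)) = (\<integral>\<^sup>+ x. (SUP i. ?P i x * ?w x) \<partial>PiM J (\<lambda>_. lborel))"
    by (intro nn_integral_cong) (simp add: volume_eq_SUP(2)[OF dim' e] SUP_mult_right_ennreal)
  also have "\<dots> = (SUP i. \<integral>\<^sup>+ x. ?P i x * ?w x \<partial>PiM J (\<lambda>_. lborel))"
  proof (rule nn_integral_monotone_convergence_SUP_AE)
    show "AE x in PiM J (\<lambda>_. lborel). ?P i x * ?w x \<le> ?P (Suc i) x * ?w x" for i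
      using volume_eq_SUP(1)[OF dim' e] by (intro AE_I2 mult_right_mono) (auto simp: incseq_Suc_iff)
  qed measurable
  also have "\<dots> \<le> (\<integral>\<^sup>+ x. volume e x * ?w' x \<partial>PiM J (\<lambda>_. lborel))"
  proof (rule SUP_least)
    fix i
    have "(\<integral>\<^sup>+ x. ?P i x * ?w x \<partial>PiM J (\<lambda>_. lborel)) \<le> (\<integral>\<^sup>+ x. ?P i x * ?w' x \<partial>PiM J (\<lambda>_. lborel))"
      by (rule nn_integral_Psi_functions_le[OF dim _ f]) simp_all
    also have "\<dots> \<le> (\<integral>\<^sup>+ x. volume e x * ?w' x \<partial>PiM J (\<lambda>_. lborel))"
      by (intro nn_integral_mono mult_right_mono) (auto simp: volume_eq_SUP(2)[OF dim' e] intro: SUP_upper)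
    finally show "(\<integral>\<^sup>+ x. ?P i x * ?w x \<partial>PiM J (\<lambda>_. lborel)) \<le> (\<integral>\<^sup>+ x. volume e x * ?w' x \<partial>PiM J (\<lambda>_. lborel))" .
  qed
  finally show ?thesis .
qed

end

section \<open>Borel versions and radial functions\<close>

lemma sigma_finite_lebesgue: "sigma_finite_measure (lebesgue :: 'a::euclidean_space measure)"
proof
  obtain A :: "'a set set" where A: "countable A" "A \<subseteq> sets lborel" "\<Union>A = space lborel" "\<forall>a\<in>A. emeasure lborel a \<noteq> \<infinity>"
    using lborel.sigma_finite_countable by blast
  show "\<exists>A. countable A \<and> A \<subseteq> sets lebesgue \<and> \<Union>A = space (lebesgue :: 'a measure) \<and> (\<forall>a\<in>A. emeasure lebesgue a \<noteq> \<infinity>)"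
  proof (intro exI[of _ A] conjI ballI)
    fix a assume "a \<in> A"
    then show "emeasure lebesgue a \<noteq> \<infinity>" using A by auto
  qed (use A in auto)
qed

text \<open>The notions of the theorem are formulated with products of completed measures, while the
  proof runs in products of Borel measures, where Fubini and the measurability of kernels are at
  hand.\<close>

lemma nn_integral_PiM_lebesgue:
  fixes F :: "('j \<Rightarrow> 'a::euclidean_space) \<Rightarrow> ennreal"
  assumes J: "finite J" and F: "F \<in> borel_measurable (PiM J (\<lambda>_. lborel))"
  shows "(\<integral>\<^sup>+ x. F x \<partial>PiM J (\<lambda>_. lebesgue)) = (\<integral>\<^sup>+ x. F x \<partial>PiM J (\<lambda>_. lborel))"
proof -
  have L: "sigma_finite_measure (lborel :: 'a measure)" ..
  have "(\<integral>\<^sup>+ x. F (\<lambda>j\<in>J. x j) \<partial>PiM J (\<lambda>_. lebesgue)) = 1 ^ card J * (\<integral>\<^sup>+ x. F x \<partial>PiM J (\<lambda>_. lborel))"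
  proof (rule nn_integral_PiM_comp[OF sigma_finite_lebesgue L J _ _ F])
    show "(\<lambda>x. x) \<in> measurable lebesgue (lborel :: 'a measure)" by (rule measurable_completion) simp
  qed (simp add: nn_integral_completion)
  moreover have "(\<integral>\<^sup>+ x. F (\<lambda>j\<in>J. x j) \<partial>PiM J (\<lambda>_. lebesgue)) = (\<integral>\<^sup>+ x. F x \<partial>PiM J (\<lambda>_. lebesgue))"
    by (intro nn_integral_cong) (auto simp: space_PiM)
  ultimately show ?thesis by simp
qed

text \<open>The rearrangement depends only on the volumes of superlevel sets, so a change on a null
  set leaves it untouched at every point.\<close>

lemma Pn_borel_version:
  fixes f :: "real^'n \<Rightarrow> real"
  assumes f: "f \<in> Pn"
  obtains g where "g \<in> borel_measurable borel" "\<forall>x. 0 \<le> g x" "AE x in lebesgue. f x = g x"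
    "(\<integral>\<^sup>+ x. ennreal (g x) \<partial>lborel) < \<infinity>" "\<exists>M. AE x in lborel. g x \<le> M" "sym_rearr f = sym_rearr g"
proof -
  have fm: "f \<in> borel_measurable lebesgue" and f0: "\<And>x. 0 \<le> f x" and f1: "(\<integral>\<^sup>+ x. ennreal (f x) \<partial>lebesgue) = 1"
    and fM: "\<exists>M. AE x in lebesgue. f x \<le> M" using f by (auto simp: Pn_def)
  obtain h where h: "h \<in> borel_measurable lborel" "AE x in lborel. f x = h x"
    using completion_ex_borel_measurable_real[OF fm] by blast
  \<comment> \<open>The Borel version could be negative on a null set; the later lemmas ask for
    nonnegativity everywhere.\<close>
  define g where "g x = max 0 (h x)" for x
  have g: "g \<in> borel_measurable borel" using h(1) unfolding g_def by measurable
  have fg: "AE x in lborel. f x = g x" using h(2)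
  proof eventually_elim
    case (elim x)
    then show ?case using f0[of x] by (simp add: g_def)
  qed
  then have fg': "AE x in lebesgue. f x = g x" by (rule AE_completion)
  have "(\<integral>\<^sup>+ x. ennreal (g x) \<partial>lborel) = (\<integral>\<^sup>+ x. ennreal (g x) \<partial>lebesgue)" by (simp add: nn_integral_completion)
  also have "\<dots> = (\<integral>\<^sup>+ x. ennreal (f x) \<partial>lebesgue)" using fg' by (intro nn_integral_cong_AE) (auto elim: eventually_mono)
  finally have g1: "(\<integral>\<^sup>+ x. ennreal (g x) \<partial>lborel) < \<infinity>" using f1 by simp
  have gM: "\<exists>M. AE x in lborel. g x \<le> M"
  proof -
    obtain M where "AE x in lebesgue. f x \<le> M" using fM by blast
    with fg' have "AE x in lebesgue. g x \<le> M" by eventually_elim simp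
    then show ?thesis by (auto simp: AE_completion_iff)
  qed
  have "emeasure lebesgue {y. f y > t} = emeasure lebesgue {y. g y > t}" for t
  proof (rule emeasure_eq_AE)
    show "AE x in lebesgue. x \<in> {y. f y > t} \<longleftrightarrow> x \<in> {y. g y > t}" using fg' by eventually_elim simp
    have gl: "g \<in> borel_measurable lebesgue" using g by (simp add: measurable_completion)
    show "{y. f y > t} \<in> sets lebesgue" "{y. g y > t} \<in> sets lebesgue"
      using borel_measurable_less[OF measurable_const fm, of t] borel_measurable_less[OF measurable_const gl, of t] by simp_all
  qed
  then have "sym_rearr f = sym_rearr g" by (simp add: fun_eq_iff sym_rearr_def sym_ball_def)
  then show thesis using that[of g] g fg' g1 gM by (auto simp: g_def)
qed

lemma sym_rearr_measurable:
  fixes f :: "real^'n \<Rightarrow> real"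
  assumes f: "f \<in> borel_measurable borel"
  shows "sym_rearr f \<in> borel_measurable borel"
proof -
  have "(\<lambda>z. indicator (sym_ball {y. f y > snd z}) (fst z) :: ennreal) \<in> borel_measurable (borel \<Otimes>\<^sub>M lborel)"
  proof -
    have "(\<lambda>z. (snd z, fst z)) \<in> measurable (borel \<Otimes>\<^sub>M lborel) (lborel \<Otimes>\<^sub>M (lborel :: (real^'n) measure))" by measurable
    from measurable_compose[OF this sym_ball_superlevel_measurable[OF f]] show ?thesis by simp
  qed
  note [measurable] = this
  show ?thesis unfolding sym_rearr_def[abs_def] by measurable
qed

lemma powe_mult:
  assumes c: "0 < c" and h: "0 \<le> h"
  shows "powe (c * h) p = ennreal (c powr p) * powe h p"
  using assms by (auto simp: powe_def powr_mult ennreal_mult ennreal_mult_top)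

text \<open>Valid for \<open>I = 0\<close> and \<open>I = \<infinity>\<close> as well, which is what
  makes the conventions of \<open>rho_of\<close> agree with the description of the star-shaped set
  as a superlevel set.\<close>

lemma rho_of_less_iff:
  assumes t: "0 < t" and q: "0 < q"
  shows "ennreal t < rho_of q I \<longleftrightarrow> ennreal (t powr q) < I"
proof (cases I)
  case (real r)
  have "t < r powr (1 / q) \<longleftrightarrow> t powr q < r" if r: "0 < r"
  proof -
    have "t < r powr (1 / q) \<longleftrightarrow> t powr q < (r powr (1 / q)) powr q"
      using powr_less_mono2[of q t "r powr (1 / q)"] powr_mono2[of q "r powr (1 / q)" t] t q by force
    then show ?thesis using q r by (simp add: powr_powr)
  qed
  then show ?thesis using real t q by (auto simp: rho_of_def ennreal_less_iff ennreal_eq_0_iff)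
qed (use q in \<open>simp add: rho_of_def\<close>)

lemma ennreal_less_mult_iff:
  fixes I :: ennreal
  assumes a: "0 < a"
  shows "ennreal a < ennreal a * I \<longleftrightarrow> 1 < I"
  using a ennreal_mult_strict_left_mono[of 1 I "ennreal a"]
    mult_left_mono[of I 1 "ennreal a"] by (auto simp: not_less[symmetric])

text \<open>By homogeneity, a nonzero x belongs to the star-shaped set exactly if
  \<open>1 < \<Phi> x\<close>, and this is the same as \<open>1 < \<Phi> x ^ k\<close>. The power
  has degree -q k = -n, the degree for which the chart formula holds.\<close>

lemma emeasure_star_set:
  fixes \<Phi> :: "real^'n \<Rightarrow> ennreal"
  assumes e: "e \<in> Basis" and q: "0 < q" and dim: "q * real k = real CARD('n)"
    and \<Phi>[measurable]: "\<Phi> \<in> borel_measurable borel"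
    and hom: "\<And>c u. c \<noteq> 0 \<Longrightarrow> \<Phi> (c *\<^sub>R u) = ennreal (\<bar>c\<bar> powr (- q)) * \<Phi> u"
  shows "emeasure lebesgue (star_set (\<lambda>u. rho_of q (\<Phi> u))) = ennreal (2 / real CARD('n)) * (\<integral>\<^sup>+ v. \<Phi> (e + emb e v) ^ k \<partial>hyp e)"
proof -
  let ?Z = "star_set (\<lambda>u. rho_of q (\<Phi> u))"
  have k: "0 < k" using dim by (cases k) auto
  have mem: "x \<in> ?Z \<longleftrightarrow> 1 < \<Phi> x" if x: "x \<noteq> 0" for x
  proof -
    have "x \<in> ?Z \<longleftrightarrow> ennreal (norm x) < rho_of q (\<Phi> (x /\<^sub>R norm x))"
    proof
      assume "x \<in> ?Z"
      then obtain u t where ut: "x = t *\<^sub>R u" "norm u = 1" "0 \<le> t" "ennreal t < rho_of q (\<Phi> u)" by (auto simp: star_set_def)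
      then have "norm x = t" "x /\<^sub>R norm x = u" using x by auto
      then show "ennreal (norm x) < rho_of q (\<Phi> (x /\<^sub>R norm x))" using ut by simp
    next
      assume *: "ennreal (norm x) < rho_of q (\<Phi> (x /\<^sub>R norm x))"
      have "x = norm x *\<^sub>R (x /\<^sub>R norm x)" "norm (x /\<^sub>R norm x) = 1" using x by simp_all
      then show "x \<in> ?Z" using * unfolding star_set_def by (intro CollectI exI[of _ "x /\<^sub>R norm x"] exI[of _ "norm x"]) simp
    qed
    also have "\<dots> \<longleftrightarrow> ennreal (norm x powr q) < \<Phi> (x /\<^sub>R norm x)"
      using x q by (intro rho_of_less_iff) auto
    also have "\<Phi> (x /\<^sub>R norm x) = ennreal (norm x powr q) * \<Phi> x"
      using hom[of "inverse (norm x)" x] x by (simp add: powr_minus inverse_powr)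
    also have "ennreal (norm x powr q) < ennreal (norm x powr q) * \<Phi> x \<longleftrightarrow> 1 < \<Phi> x"
      using x by (intro ennreal_less_mult_iff) simp
    finally show ?thesis .
  qed
  have pow: "1 < a ^ k \<longleftrightarrow> 1 < a" for a :: ennreal
  proof
    assume "1 < a" then show "1 < a ^ k" using k by (metis one_less_power)
  next
    assume *: "1 < a ^ k"
    show "1 < a"
    proof (rule ccontr)
      assume "\<not> 1 < a"
      then have "a ^ k \<le> 1 ^ k" by (intro power_mono) auto
      then show False using * by simp
    qed
  qed
  have "emeasure lebesgue ?Z = emeasure lborel {u. 1 < \<Phi> u ^ k}"
  proof -
    let ?S = "{u. 1 < \<Phi> u ^ k}"
    have S: "?S \<in> sets borel" by measurable
    \<comment> \<open>Membership of the origin does not follow the criterion for nonzero points, but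
      a single point is a null set.\<close>
    have Zeq: "?Z = (?S - {0}) \<union> (?Z \<inter> {0})" using mem pow by auto
    have Z0: "?Z \<inter> {0} \<in> null_sets lborel" by (rule finite_imp_null_set_lborel) simp
    then have "?Z \<in> sets borel" by (subst Zeq) (use S in auto)
    then have "emeasure lebesgue ?Z = emeasure lborel ?Z" by simp
    also have "\<dots> = emeasure lborel (?S - {0})"
      by (subst Zeq) (use S Z0 in \<open>auto intro!: emeasure_Un_null_set\<close>)
    also have "\<dots> = emeasure lborel ?S" using S by (intro emeasure_Diff_null_set) auto
    finally show ?thesis .
  qed
  also have "\<dots> = ennreal (2 / real DIM(real^'n)) * (\<integral>\<^sup>+ v. \<Phi> (e + emb e v) ^ k \<partial>hyp e)"
  proof (rule emeasure_superlevel_homogeneous[OF e])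
    fix c :: real and u :: "real^'n" assume c: "c \<noteq> 0"
    have "(\<bar>c\<bar> powr (- q)) ^ k = \<bar>c\<bar> powr (- q * real k)" using c by (simp add: powr_realpow[symmetric] powr_powr)
    also have "\<dots> = 1 / \<bar>c\<bar> ^ DIM(real^'n)" using c dim by (simp add: powr_minus_divide powr_realpow)
    finally show "\<Phi> (c *\<^sub>R u) ^ k = ennreal (1 / \<bar>c\<bar> ^ DIM(real^'n)) * \<Phi> u ^ k"
      using hom[OF c] by (simp add: power_mult_distrib ennreal_power)
  qed measurable
  finally show ?thesis by simp
qed

section \<open>Support functions\<close>

lemma sym_convex_body_nonempty:
  assumes "sym_convex_body m C"
  shows "C \<noteq> {}"
proof -
  obtain x r where "r > 0" "\<forall>y\<in>Rsp m. (\<Sum>j<m. (y j - x j)\<^sup>2) < r\<^sup>2 \<longrightarrow> y \<in> C"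
    using assms by (auto simp: sym_convex_body_def)
  then have "(\<lambda>j. if j < m then x j else 0) \<in> C" by (auto simp: Rsp_def)
  then show ?thesis by auto
qed

lemma supp_bdd_above:
  assumes "sym_convex_body m C"
  shows "bdd_above ((\<lambda>c. \<Sum>j<m. c j * y j) ` C)"
proof -
  have "\<exists>R. \<forall>c\<in>C. \<forall>j<m. \<bar>c j\<bar> \<le> R" using assms unfolding sym_convex_body_def by blast
  then obtain R where R: "\<And>c j. c \<in> C \<Longrightarrow> j < m \<Longrightarrow> \<bar>c j\<bar> \<le> R" by blast
  have "(\<Sum>j<m. c j * y j) \<le> (\<Sum>j<m. R * \<bar>y j\<bar>)" if "c \<in> C" for c
  proof (rule sum_mono)
    fix j assume "j \<in> {..<m}"
    then have "\<bar>c j\<bar> * \<bar>y j\<bar> \<le> R * \<bar>y j\<bar>" using R[OF that] by (intro mult_right_mono) auto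
    then show "c j * y j \<le> R * \<bar>y j\<bar>" by (auto simp: abs_mult[symmetric])
  qed
  then show ?thesis by (auto intro!: bdd_aboveI2)
qed

lemma supp_upper: "sym_convex_body m C \<Longrightarrow> c \<in> C \<Longrightarrow> (\<Sum>j<m. c j * y j) \<le> supp m C y"
  unfolding supp_def by (rule cSUP_upper[OF _ supp_bdd_above])

lemma supp_least: "sym_convex_body m C \<Longrightarrow> (\<And>c. c \<in> C \<Longrightarrow> (\<Sum>j<m. c j * y j) \<le> b) \<Longrightarrow> supp m C y \<le> b"
  unfolding supp_def by (rule cSUP_least[OF sym_convex_body_nonempty])

lemma supp_cong: "(\<And>j. j < m \<Longrightarrow> y j = z j) \<Longrightarrow> supp m C y = supp m C z"
  unfolding supp_def by (intro SUP_cong sum.cong) auto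

lemma sym_convex_body_uminus: "sym_convex_body m C \<Longrightarrow> c \<in> C \<Longrightarrow> (\<lambda>j. - c j) \<in> C"
  by (auto simp: sym_convex_body_def)

lemma supp_nonneg:
  assumes C: "sym_convex_body m C"
  shows "0 \<le> supp m C y"
proof -
  obtain c where c: "c \<in> C" using sym_convex_body_nonempty[OF C] by auto
  show ?thesis
    using supp_upper[OF C c, of y] supp_upper[OF C sym_convex_body_uminus[OF C c], of y] by (simp add: sum_negf)
qed

lemma supp_hom:
  assumes C: "sym_convex_body m C"
  shows "supp m C (\<lambda>j. a * y j) = \<bar>a\<bar> * supp m C y"
proof -
  have le: "supp m C (\<lambda>j. a * y j) \<le> \<bar>a\<bar> * supp m C y" for a y
  proof (rule supp_least[OF C])
    fix c assume c: "c \<in> C"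
    show "(\<Sum>j<m. c j * (a * y j)) \<le> \<bar>a\<bar> * supp m C y"
    proof (cases "0 \<le> a")
      case True
      have "(\<Sum>j<m. c j * (a * y j)) = a * (\<Sum>j<m. c j * y j)" by (simp add: sum_distrib_left mult_ac)
      also have "\<dots> \<le> a * supp m C y" using True supp_upper[OF C c] by (intro mult_left_mono) auto
      finally show ?thesis using True by simp
    next
      case False
      have "(\<Sum>j<m. c j * (a * y j)) = (- a) * (\<Sum>j<m. (- c j) * y j)" by (simp add: sum_distrib_left mult_ac)
      also have "\<dots> \<le> (- a) * supp m C y"
        using False supp_upper[OF C sym_convex_body_uminus[OF C c]] by (intro mult_left_mono) auto
      finally show ?thesis using False by simp
    qed
  qed
  show ?thesis
  proof (cases "a = 0")
    case True
    then show ?thesis using le[of 0 y] supp_nonneg[OF C, of "\<lambda>j. 0 * y j"] by simp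
  next
    case False
    have "supp m C y \<le> \<bar>1 / a\<bar> * supp m C (\<lambda>j. a * y j)"
      using le[of "1 / a" "\<lambda>j. a * y j"] False by simp
    then have "\<bar>a\<bar> * supp m C y \<le> supp m C (\<lambda>j. a * y j)" using False by (simp add: field_simps)
    then show ?thesis using le[of a y] by simp
  qed
qed

lemma supp_convex:
  assumes C: "sym_convex_body m C" and c: "0 < c" "c < 1"
  shows "supp m C (\<lambda>j. (1 - c) * y j + c * z j) \<le> (1 - c) * supp m C y + c * supp m C z"
proof (rule supp_least[OF C])
  fix d assume d: "d \<in> C"
  have "(\<Sum>j<m. d j * ((1 - c) * y j + c * z j)) = (1 - c) * (\<Sum>j<m. d j * y j) + c * (\<Sum>j<m. d j * z j)"
    by (simp add: sum_distrib_left sum.distrib[symmetric] algebra_simps)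
  also have "\<dots> \<le> (1 - c) * supp m C y + c * supp m C z"
    using c supp_upper[OF C d] by (intro add_mono mult_left_mono) auto
  finally show "(\<Sum>j<m. d j * ((1 - c) * y j + c * z j)) \<le> (1 - c) * supp m C y + c * supp m C z" .
qed

text \<open>Superlevel sets of a supremum of continuous linear functions are unions of open sets.
  The union may be uncountable, which is harmless for openness.\<close>

lemma supp_borel_measurable:
  assumes C: "sym_convex_body m C"
  shows "supp m C \<in> borel_measurable borel"
proof (subst borel_measurable_iff_greater, intro allI)
  fix a
  have "{y. a < supp m C y} = (\<Union>c\<in>C. {y. a < (\<Sum>j<m. c j * y j)})"
    unfolding supp_def using less_cSUP_iff[OF sym_convex_body_nonempty[OF C] supp_bdd_above[OF C]] by auto
  moreover have "open {y :: nat \<Rightarrow> real. a < (\<Sum>j<m. c j * y j)}" for c :: "nat \<Rightarrow> real"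
    by (intro open_Collect_less continuous_on_const continuous_on_sum continuous_on_mult_left continuous_on_product_coordinates)
  ultimately show "{y \<in> space borel. a < supp m C y} \<in> sets borel" by (auto intro!: borel_open open_UN)
qed

lemma supp_measurable_comp:
  assumes C: "sym_convex_body m C" and f: "\<And>j. j < m \<Longrightarrow> (\<lambda>z. f z j) \<in> borel_measurable M"
  shows "(\<lambda>z. supp m C (\<lambda>j. f z j)) \<in> borel_measurable M"
proof -
  have "(\<lambda>z j. if j < m then f z j else 0) \<in> measurable M (PiM UNIV (\<lambda>_::nat. borel))"
  proof (rule measurable_PiM_single')
    show "(\<lambda>z. if j < m then f z j else 0) \<in> borel_measurable M" for j
      using f by (cases "j < m") auto
  qed auto
  then have "(\<lambda>z j. if j < m then f z j else 0) \<in> borel_measurable M"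
    by (simp add: measurable_cong_sets[OF refl sets_PiM_equal_borel])
  from measurable_compose[OF this supp_borel_measurable[OF C]]
  show ?thesis by (rule measurable_cong[THEN iffD1, rotated]) (auto intro: supp_cong)
qed

text \<open>The map \<open>\<sigma>\<close> stands for one term in the expansion of the k-th power
  of a sum over the bodies: factor \<open>l\<close> uses body \<open>\<sigma> l\<close> with its own
  block of points. Repeated values are allowed, and then factors share their points.\<close>

lemma gauge_family_supp:
  fixes k N :: nat
  assumes \<sigma>: "\<And>l. l < k \<Longrightarrow> \<sigma> l < N" and C: "\<And>i. i < N \<Longrightarrow> sym_convex_body (ms i) (Cs i)" and q: "0 < q"
  shows "gauge_family (idx N ms) {..<k} (\<lambda>l y. supp (ms (\<sigma> l)) (Cs (\<sigma> l)) (\<lambda>j. y (\<sigma> l, j))) q"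
proof
  have "idx N ms = Sigma {..<N} (\<lambda>i. {..<ms i})" by (auto simp: idx_def)
  then show "finite (idx N ms)" by simp
  fix l assume "l \<in> {..<k}"
  then have l: "\<sigma> l < N" using \<sigma> by simp
  have idx: "(\<sigma> l, j) \<in> idx N ms" if "j < ms (\<sigma> l)" for j using that l by (simp add: idx_def)
  show "(\<lambda>y. supp (ms (\<sigma> l)) (Cs (\<sigma> l)) (\<lambda>j. y (\<sigma> l, j))) \<in> borel_measurable (PiM (idx N ms) (\<lambda>_. borel))"
    by (rule supp_measurable_comp[OF C[OF l]]) (use idx in measurable)
  show "0 \<le> supp (ms (\<sigma> l)) (Cs (\<sigma> l)) (\<lambda>j. y (\<sigma> l, j))" for y by (rule supp_nonneg[OF C[OF l]])
  show "supp (ms (\<sigma> l)) (Cs (\<sigma> l)) (\<lambda>j. (\<lambda>j\<in>idx N ms. (1 - c) * y j + c * z j) (\<sigma> l, j))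
     \<le> (1 - c) * supp (ms (\<sigma> l)) (Cs (\<sigma> l)) (\<lambda>j. y (\<sigma> l, j)) + c * supp (ms (\<sigma> l)) (Cs (\<sigma> l)) (\<lambda>j. z (\<sigma> l, j))"
    if "0 < c" "c < 1" for c y z
  proof -
    have "supp (ms (\<sigma> l)) (Cs (\<sigma> l)) (\<lambda>j. (\<lambda>j\<in>idx N ms. (1 - c) * y j + c * z j) (\<sigma> l, j))
      = supp (ms (\<sigma> l)) (Cs (\<sigma> l)) (\<lambda>j. (1 - c) * y (\<sigma> l, j) + c * z (\<sigma> l, j))"
      using idx by (intro supp_cong) simp
    then show ?thesis using supp_convex[OF C[OF l] that] by simp
  qed
  show "supp (ms (\<sigma> l)) (Cs (\<sigma> l)) (\<lambda>j. (\<lambda>j\<in>idx N ms. c * y j) (\<sigma> l, j)) = \<bar>c\<bar> * supp (ms (\<sigma> l)) (Cs (\<sigma> l)) (\<lambda>j. y (\<sigma> l, j))" for c y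
  proof -
    have "supp (ms (\<sigma> l)) (Cs (\<sigma> l)) (\<lambda>j. (\<lambda>j\<in>idx N ms. c * y j) (\<sigma> l, j)) = supp (ms (\<sigma> l)) (Cs (\<sigma> l)) (\<lambda>j. c * y (\<sigma> l, j))"
      using idx by (intro supp_cong) simp
    then show ?thesis using supp_hom[OF C[OF l]] by simp
  qed
qed (use q in auto)

context gauge_family
begin

lemma volume_measurable:
  assumes dim: "q * real (card L) = real DIM('a)" and e: "e \<in> Basis"
  shows "volume e \<in> borel_measurable (PiM J (\<lambda>_. lborel :: 'a::euclidean_space measure))"
proof -
  have [measurable]: "Psi (1 / real (Suc i)) \<in> borel_measurable (PiM J (\<lambda>_. lborel :: 'a measure))" for i
    by (rule Psi_measurable[OF dim]) simp
  have "(\<lambda>x. SUP i. Psi (1 / real (Suc i)) x) \<in> borel_measurable (PiM J (\<lambda>_. lborel :: 'a measure))" by measurable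
  then show ?thesis by (rule measurable_cong[THEN iffD1, rotated]) (simp add: volume_eq_SUP(2)[OF dim e])
qed

end

section \<open>Powers of integrals as integrals over independent copies\<close>

lemma nn_integral_PiM_reindex:
  fixes t :: "'i \<Rightarrow> 'j"
  assumes M: "sigma_finite_measure M" and K: "finite K" and t: "inj_on t K"
    and g: "g \<in> borel_measurable (PiM K (\<lambda>_. M))"
  shows "(\<integral>\<^sup>+ y. g (\<lambda>i\<in>K. y (t i)) \<partial>PiM (t ` K) (\<lambda>_. M)) = (\<integral>\<^sup>+ x. g x \<partial>PiM K (\<lambda>_. M))"
proof -
  interpret P: product_sigma_finite "\<lambda>_::'i. M" by standard (use M in \<open>auto simp: sigma_finite_measure_def\<close>)
  interpret Q: product_sigma_finite "\<lambda>_::'j. M" by standard (use M in \<open>auto simp: sigma_finite_measure_def\<close>)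
  let ?r = "\<lambda>y. \<lambda>i\<in>K. y (t i)"
  have r: "?r \<in> measurable (PiM (t ` K) (\<lambda>_. M)) (PiM K (\<lambda>_. M))"
    by (rule measurable_restrict) (auto intro: measurable_component_singleton)
  have "distr (PiM (t ` K) (\<lambda>_. M)) (PiM K (\<lambda>_. M)) ?r = PiM K (\<lambda>_. M)"
  proof (rule P.PiM_eqI[OF K])
    fix A assume A: "\<And>i. i \<in> K \<Longrightarrow> A i \<in> sets M"
    have "emeasure (distr (PiM (t ` K) (\<lambda>_. M)) (PiM K (\<lambda>_. M)) ?r) (PiE K A)
      = emeasure (PiM (t ` K) (\<lambda>_. M)) (?r -` PiE K A \<inter> space (PiM (t ` K) (\<lambda>_. M)))"
      using A K by (intro emeasure_distr[OF r] sets_PiM_I_finite) auto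
    also have "?r -` PiE K A \<inter> space (PiM (t ` K) (\<lambda>_. M)) = PiE (t ` K) (\<lambda>j. A (inv_into K t j))"
    proof -
      have "A i \<subseteq> space M" if "i \<in> K" for i using A[OF that] by (rule sets.sets_into_space)
      then show ?thesis using t by (auto simp: space_PiM PiE_iff subset_iff)
    qed
    also have "emeasure (PiM (t ` K) (\<lambda>_. M)) \<dots> = (\<Prod>j\<in>t ` K. emeasure M (A (inv_into K t j)))"
      using A K t by (intro Q.emeasure_PiM) auto
    also have "\<dots> = (\<Prod>i\<in>K. emeasure M (A i))"
      using t by (simp add: prod.reindex)
    finally show "emeasure (distr (PiM (t ` K) (\<lambda>_. M)) (PiM K (\<lambda>_. M)) ?r) (PiE K A) = (\<Prod>i\<in>K. emeasure M (A i))" .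
  qed simp
  then show ?thesis using nn_integral_distr[OF r, of g] g by simp
qed

text \<open>Each factor of the power receives its own copy of the variables, namely row
  \<open>l\<close> of the index set; the induction splits off the last row and relabels it.\<close>

lemma nn_integral_power_PiM:
  fixes g :: "(nat \<Rightarrow> 'a) \<Rightarrow> ennreal"
  assumes M: "sigma_finite_measure M" and g[measurable]: "g \<in> borel_measurable (PiM {..<m} (\<lambda>_. M))"
  shows "(\<integral>\<^sup>+ x. g x \<partial>PiM {..<m} (\<lambda>_. M)) ^ k = (\<integral>\<^sup>+ x. (\<Prod>l<k. g (\<lambda>i\<in>{..<m}. x (l, i))) \<partial>PiM (idx k (\<lambda>_. m)) (\<lambda>_. M))"
proof (induction k)
  case 0
  interpret Q: product_sigma_finite "\<lambda>_::nat \<times> nat. M" by standard (use M in \<open>auto simp: sigma_finite_measure_def\<close>)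
  have "idx 0 (\<lambda>_. m) = {}" by (auto simp: idx_def)
  then show ?case by (simp add: Q.nn_integral_empty del: nn_integral_const)
next
  case (Suc k)
  interpret Q: product_sigma_finite "\<lambda>_::nat \<times> nat. M" by standard (use M in \<open>auto simp: sigma_finite_measure_def\<close>)
  let ?I = "idx k (\<lambda>_. m)" and ?K = "Pair k ` {..<m}"
  let ?G = "\<lambda>x. \<Prod>l<k. g (\<lambda>i\<in>{..<m}. x (l, i))"
  have "?I = {..<k} \<times> {..<m}" by (auto simp: idx_def)
  then have fin: "finite ?I" by simp
  have un: "idx (Suc k) (\<lambda>_. m) = ?I \<union> ?K" and dis: "?I \<inter> ?K = {}" by (auto simp: idx_def less_Suc_eq)
  have row: "(\<lambda>x. g (\<lambda>i\<in>{..<m}. x (l, i))) \<in> borel_measurable (PiM A (\<lambda>_. M))" if "\<And>i. i < m \<Longrightarrow> (l, i) \<in> A" for l A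
  proof -
    have "(\<lambda>x. \<lambda>i\<in>{..<m}. x (l, i)) \<in> measurable (PiM A (\<lambda>_. M)) (PiM {..<m} (\<lambda>_. M))"
      by (rule measurable_restrict) (use that in \<open>auto intro: measurable_component_singleton\<close>)
    from measurable_compose[OF this g] show ?thesis .
  qed
  have Gm: "?G \<in> borel_measurable (PiM ?I (\<lambda>_. M))"
    by (intro borel_measurable_prod_ennreal row) (auto simp: idx_def)
  have "(\<integral>\<^sup>+ x. (\<Prod>l<Suc k. g (\<lambda>i\<in>{..<m}. x (l, i))) \<partial>PiM (idx (Suc k) (\<lambda>_. m)) (\<lambda>_. M))
     = (\<integral>\<^sup>+ x. (\<integral>\<^sup>+ y. (\<Prod>l<Suc k. g (\<lambda>i\<in>{..<m}. merge ?I ?K (x, y) (l, i))) \<partial>PiM ?K (\<lambda>_. M)) \<partial>PiM ?I (\<lambda>_. M))"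
    unfolding un
  proof (rule Q.product_nn_integral_fold[OF dis fin])
    show "(\<lambda>x. \<Prod>l<Suc k. g (\<lambda>i\<in>{..<m}. x (l, i))) \<in> borel_measurable (PiM (?I \<union> ?K) (\<lambda>_. M))"
      unfolding un[symmetric] by (intro borel_measurable_prod_ennreal row) (auto simp: idx_def)
  qed simp
  also have "\<dots> = (\<integral>\<^sup>+ x. (\<integral>\<^sup>+ y. ?G x * g (\<lambda>i\<in>{..<m}. y (k, i)) \<partial>PiM ?K (\<lambda>_. M)) \<partial>PiM ?I (\<lambda>_. M))"
  proof (intro nn_integral_cong)
    fix x y :: "nat \<times> nat \<Rightarrow> 'a"
    have "(\<lambda>i\<in>{..<m}. merge ?I ?K (x, y) (l, i)) = (\<lambda>i\<in>{..<m}. x (l, i))" if "l < k" for l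
      using that by (auto simp: fun_eq_iff merge_def idx_def)
    moreover have "(\<lambda>i\<in>{..<m}. merge ?I ?K (x, y) (k, i)) = (\<lambda>i\<in>{..<m}. y (k, i))"
      by (auto simp: fun_eq_iff merge_def idx_def)
    ultimately show "(\<Prod>l<Suc k. g (\<lambda>i\<in>{..<m}. merge ?I ?K (x, y) (l, i))) = ?G x * g (\<lambda>i\<in>{..<m}. y (k, i))"
      by simp
  qed
  also have "\<dots> = (\<integral>\<^sup>+ x. ?G x * (\<integral>\<^sup>+ y. g (\<lambda>i\<in>{..<m}. y (k, i)) \<partial>PiM ?K (\<lambda>_. M)) \<partial>PiM ?I (\<lambda>_. M))"
    by (intro nn_integral_cong nn_integral_cmult row) auto
  also have "\<dots> = (\<integral>\<^sup>+ x. ?G x \<partial>PiM ?I (\<lambda>_. M)) * (\<integral>\<^sup>+ y. g (\<lambda>i\<in>{..<m}. y (k, i)) \<partial>PiM ?K (\<lambda>_. M))"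
    by (rule nn_integral_multc[OF Gm])
  also have "(\<integral>\<^sup>+ y. g (\<lambda>i\<in>{..<m}. y (k, i)) \<partial>PiM ?K (\<lambda>_. M)) = (\<integral>\<^sup>+ x. g x \<partial>PiM {..<m} (\<lambda>_. M))"
    using nn_integral_PiM_reindex[OF M _ _ g, of "Pair k"] by (simp add: inj_on_def)
  finally show ?case using Suc.IH by (simp add: mult.commute)
qed

section \<open>Polar centroid-type bodies\<close>

text \<open>The contribution of one selection \<open>\<sigma>\<close> of bodies. The empirical
  volume is a multiple of the sum over all selections; the deterministic volume is the case of k
  copies of one body with \<open>\<sigma>\<close> the identity.\<close>

definition product_volume :: "nat \<Rightarrow> (nat \<Rightarrow> nat) \<Rightarrow> (nat \<Rightarrow> (nat \<Rightarrow> real) set) \<Rightarrow> (nat \<Rightarrow> nat) \<Rightarrow> real \<Rightarrow> real^'n \<Rightarrow> (nat \<times> nat \<Rightarrow> real^'n) \<Rightarrow> ennreal" where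
  "product_volume k ms Cs \<sigma> q e X = ennreal (2 / real CARD('n)) *
     (\<integral>\<^sup>+ v. (\<Prod>l<k. powe (supp (ms (\<sigma> l)) (Cs (\<sigma> l)) (\<lambda>j. X (\<sigma> l, j) \<bullet> (e + emb e v))) (- q)) \<partial>hyp e)"

lemma finite_idx: "finite (idx N ms)"
proof -
  have "idx N ms = Sigma {..<N} (\<lambda>i. {..<ms i})" by (auto simp: idx_def)
  then show ?thesis by simp
qed

lemma product_volume_eq:
  fixes X :: "nat \<times> nat \<Rightarrow> real^'n"
  assumes \<sigma>: "\<And>l. l < k \<Longrightarrow> \<sigma> l < N" and C: "\<And>i. i < N \<Longrightarrow> sym_convex_body (ms i) (Cs i)" and q: "0 < q"
  shows "product_volume k ms Cs \<sigma> q e X =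
    gauge_family.volume (idx N ms) {..<k} (\<lambda>l y. supp (ms (\<sigma> l)) (Cs (\<sigma> l)) (\<lambda>j. y (\<sigma> l, j))) q e X"
proof -
  interpret G: gauge_family "idx N ms" "{..<k}" "\<lambda>l y. supp (ms (\<sigma> l)) (Cs (\<sigma> l)) (\<lambda>j. y (\<sigma> l, j))" q
    by (rule gauge_family_supp[OF \<sigma> C q])
  have "supp (ms (\<sigma> l)) (Cs (\<sigma> l)) (\<lambda>j. (\<lambda>ij\<in>idx N ms. X ij \<bullet> u) (\<sigma> l, j)) = supp (ms (\<sigma> l)) (Cs (\<sigma> l)) (\<lambda>j. X (\<sigma> l, j) \<bullet> u)"
    if "l < k" for l u
    using \<sigma>[OF that] by (intro supp_cong) (simp add: idx_def)
  then show ?thesis unfolding product_volume_def G.volume_def by simp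
qed

lemma product_volume_measurable:
  assumes \<sigma>: "\<And>l. l < k \<Longrightarrow> \<sigma> l < N" and C: "\<And>i. i < N \<Longrightarrow> sym_convex_body (ms i) (Cs i)" and q: "0 < q"
    and dim: "q * real k = real CARD('n)" and e: "e \<in> Basis"
  shows "product_volume k ms Cs \<sigma> q (e :: real^'n) \<in> borel_measurable (PiM (idx N ms) (\<lambda>_. lborel))"
proof -
  interpret G: gauge_family "idx N ms" "{..<k}" "\<lambda>l y. supp (ms (\<sigma> l)) (Cs (\<sigma> l)) (\<lambda>j. y (\<sigma> l, j))" q
    by (rule gauge_family_supp[OF \<sigma> C q])
  have eq: "product_volume k ms Cs \<sigma> q e = G.volume e"
    by (rule ext, rule product_volume_eq) (use \<sigma> C q in auto)
  show ?thesis unfolding eq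
    by (rule G.volume_measurable[OF _ e]) (use dim in simp)
qed

lemma nn_integral_product_volume_rearrange:
  fixes f :: "nat \<times> nat \<Rightarrow> real^'n \<Rightarrow> real"
  assumes \<sigma>: "\<And>l. l < k \<Longrightarrow> \<sigma> l < N" and C: "\<And>i. i < N \<Longrightarrow> sym_convex_body (ms i) (Cs i)" and q: "0 < q"
    and dim: "q * real k = real CARD('n)" and e: "e \<in> Basis"
    and f: "\<And>ij. ij \<in> idx N ms \<Longrightarrow> f ij \<in> borel_measurable borel" "\<And>ij z. ij \<in> idx N ms \<Longrightarrow> 0 \<le> f ij z"
      "\<And>ij. ij \<in> idx N ms \<Longrightarrow> (\<integral>\<^sup>+ x. ennreal (f ij x) \<partial>lborel) < \<infinity>" "\<And>ij. ij \<in> idx N ms \<Longrightarrow> \<exists>M. AE x in lborel. f ij x \<le> M"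
  shows "(\<integral>\<^sup>+ X. product_volume k ms Cs \<sigma> q e X * (\<Prod>ij\<in>idx N ms. ennreal (f ij (X ij))) \<partial>PiM (idx N ms) (\<lambda>_. lborel))
      \<le> (\<integral>\<^sup>+ X. product_volume k ms Cs \<sigma> q e X * (\<Prod>ij\<in>idx N ms. ennreal (sym_rearr (f ij) (X ij))) \<partial>PiM (idx N ms) (\<lambda>_. lborel))"
proof -
  interpret G: gauge_family "idx N ms" "{..<k}" "\<lambda>l y. supp (ms (\<sigma> l)) (Cs (\<sigma> l)) (\<lambda>j. y (\<sigma> l, j))" q
    by (rule gauge_family_supp[OF \<sigma> C q])
  have eq: "product_volume k ms Cs \<sigma> q e = G.volume e"
    by (rule ext, rule product_volume_eq) (use \<sigma> C q in auto)
  show ?thesis unfolding eq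
    by (rule G.nn_integral_volume_rearrange[OF _ e f]) (use dim in simp_all)
qed

lemma powe_supp_scaleR:
  assumes C: "sym_convex_body m C" and c: "c \<noteq> 0"
  shows "powe (supp m C (\<lambda>j. x j \<bullet> c *\<^sub>R u)) p = ennreal (\<bar>c\<bar> powr p) * powe (supp m C (\<lambda>j. x j \<bullet> u)) p"
  using supp_hom[OF C, of c "\<lambda>j. x j \<bullet> u"] powe_mult[of "\<bar>c\<bar>" "supp m C (\<lambda>j. x j \<bullet> u)" p] supp_nonneg[OF C] c by simp

lemma powe_measurable[measurable]: "(\<lambda>h. powe h p) \<in> borel_measurable borel"
  unfolding powe_def by measurable

text \<open>The sum over bodies has degree -q in u, so the star-set formula applies; its k-th power
  expands by distributivity into one product for every map from the k factors to the N
  bodies.\<close>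

lemma emeasure_ZdiamEmp:
  fixes X :: "nat \<times> nat \<Rightarrow> real^'n"
  assumes C: "\<And>i. i < N \<Longrightarrow> sym_convex_body (ms i) (Cs i)" and q: "0 < q"
    and dim: "q * real k = real CARD('n)" and e: "e \<in> Basis"
  shows "emeasure lebesgue (ZdiamEmp (- q) N ms Cs X)
    = ennreal (1 / real N) ^ k * (\<Sum>\<sigma>\<in>PiE {..<k} (\<lambda>_. {..<N}). product_volume k ms Cs \<sigma> q e X)"
proof -
  let ?a = "\<lambda>i u. powe (supp (ms i) (Cs i) (\<lambda>j. X (i, j) \<bullet> u)) (- q)"
  let ?\<Phi> = "\<lambda>u. ennreal (1 / real N) * (\<Sum>i<N. ?a i u)"
  have am: "(\<lambda>u. ?a i u) \<in> borel_measurable borel" if "i < N" for i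
    by (intro measurable_compose[OF supp_measurable_comp[OF C[OF that]] powe_measurable]) measurable
  have am2: "(\<lambda>v. ?a i (e + emb e v)) \<in> borel_measurable (hyp e)" if "i < N" for i
    by (rule measurable_compose[OF _ am[OF that]]) measurable
  have \<Phi>m: "?\<Phi> \<in> borel_measurable borel"
    by (intro borel_measurable_times_ennreal borel_measurable_sum am) auto
  have "emeasure lebesgue (ZdiamEmp (- q) N ms Cs X) = ennreal (2 / real CARD('n)) * (\<integral>\<^sup>+ v. ?\<Phi> (e + emb e v) ^ k \<partial>hyp e)"
    unfolding ZdiamEmp_def minus_minus
  proof (rule emeasure_star_set[OF e q dim \<Phi>m])
    fix c :: real and u :: "real^'n" assume "c \<noteq> 0"
    then have "(\<Sum>i<N. ?a i (c *\<^sub>R u)) = (\<Sum>i<N. ennreal (\<bar>c\<bar> powr (- q)) * ?a i u)"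
      by (intro sum.cong refl powe_supp_scaleR C) auto
    then show "?\<Phi> (c *\<^sub>R u) = ennreal (\<bar>c\<bar> powr (- q)) * ?\<Phi> u"
      by (simp only: sum_distrib_left[symmetric] mult.left_commute)
  qed
  also have "(\<integral>\<^sup>+ v. ?\<Phi> (e + emb e v) ^ k \<partial>hyp e) = (\<integral>\<^sup>+ v. ennreal (1 / real N) ^ k * (\<Sum>\<sigma>\<in>PiE {..<k} (\<lambda>_. {..<N}). \<Prod>l<k. ?a (\<sigma> l) (e + emb e v)) \<partial>hyp e)"
  proof (rule nn_integral_cong)
    fix v
    have "(\<Sum>i<N. ?a i (e + emb e v)) ^ k = (\<Prod>l<k. \<Sum>i<N. ?a i (e + emb e v))" by simp
    also have "\<dots> = (\<Sum>\<sigma>\<in>PiE {..<k} (\<lambda>_. {..<N}). \<Prod>l<k. ?a (\<sigma> l) (e + emb e v))"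
      by (rule prod_sum_PiE) auto
    finally show "?\<Phi> (e + emb e v) ^ k = ennreal (1 / real N) ^ k * (\<Sum>\<sigma>\<in>PiE {..<k} (\<lambda>_. {..<N}). \<Prod>l<k. ?a (\<sigma> l) (e + emb e v))"
      by (simp add: power_mult_distrib)
  qed
  also have "\<dots> = ennreal (1 / real N) ^ k * (\<Sum>\<sigma>\<in>PiE {..<k} (\<lambda>_. {..<N}). \<integral>\<^sup>+ v. (\<Prod>l<k. ?a (\<sigma> l) (e + emb e v)) \<partial>hyp e)"
  proof -
    have pm: "(\<lambda>v. \<Prod>l<k. ?a (\<sigma> l) (e + emb e v)) \<in> borel_measurable (hyp e)" if "\<sigma> \<in> PiE {..<k} (\<lambda>_. {..<N})" for \<sigma>
      using that by (intro borel_measurable_prod_ennreal am2) (auto simp: PiE_iff)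
    show ?thesis
      by (subst nn_integral_cmult, (intro borel_measurable_sum pm, assumption)[1], subst nn_integral_sum) (auto intro!: pm)
  qed
  also have "ennreal (2 / real CARD('n)) * \<dots> = ennreal (1 / real N) ^ k * (\<Sum>\<sigma>\<in>PiE {..<k} (\<lambda>_. {..<N}). product_volume k ms Cs \<sigma> q e X)"
    by (simp add: product_volume_def sum_distrib_left mult_ac)
  finally show ?thesis .
qed

text \<open>The order of the steps matters: the densities are first exchanged for Borel versions,
  then the volume is written by the explicit formula, and only then is the integrand known to be
  Borel, as the change from \<open>lebesgue\<close> to \<open>lborel\<close> requires.\<close>

lemma EvolEmp_eq:
  fixes F :: "nat \<times> nat \<Rightarrow> real^'n \<Rightarrow> real"
  assumes C: "\<And>i. i < N \<Longrightarrow> sym_convex_body (ms i) (Cs i)" and q: "0 < q"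
    and dim: "q * real k = real CARD('n)" and e: "e \<in> Basis"
    and g: "\<And>ij. ij \<in> idx N ms \<Longrightarrow> g ij \<in> borel_measurable borel"
    and ae: "\<And>ij. ij \<in> idx N ms \<Longrightarrow> AE x in lebesgue. F ij x = g ij x"
  shows "EvolEmp (- q) N ms Cs F = ennreal (1 / real N) ^ k *
    (\<Sum>\<sigma>\<in>PiE {..<k} (\<lambda>_. {..<N}). \<integral>\<^sup>+ X. product_volume k ms Cs \<sigma> q e X * (\<Prod>ij\<in>idx N ms. ennreal (g ij (X ij))) \<partial>PiM (idx N ms) (\<lambda>_. lborel))"
proof -
  let ?P = "PiE {..<k} (\<lambda>_. {..<N})" and ?w = "\<lambda>X. \<Prod>ij\<in>idx N ms. ennreal (g ij (X ij))"
  have wm[measurable]: "?w \<in> borel_measurable (PiM (idx N ms) (\<lambda>_. lborel))"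
  proof (rule borel_measurable_prod_ennreal)
    fix ij assume j: "ij \<in> idx N ms"
    show "(\<lambda>x. ennreal (g ij (x ij))) \<in> borel_measurable (PiM (idx N ms) (\<lambda>_. lborel))"
      using measurable_compose[OF measurable_component_singleton[OF j, of "\<lambda>_. lborel"], of "\<lambda>z. ennreal (g ij z)" borel] g[OF j] by simp
  qed
  have pv: "product_volume k ms Cs \<sigma> q e \<in> borel_measurable (PiM (idx N ms) (\<lambda>_. lborel))" if "\<sigma> \<in> ?P" for \<sigma>
    using that by (intro product_volume_measurable[OF _ C q dim e]) (auto simp: PiE_iff)
  have "EvolEmp (- q) N ms Cs F = (\<integral>\<^sup>+ X. emeasure lebesgue (ZdiamEmp (- q) N ms Cs X) * ?w X \<partial>PiM (idx N ms) (\<lambda>_. lebesgue))"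
    unfolding EvolEmp_def
  proof (rule nn_integral_PiM_weight_cong_AE[OF sigma_finite_lebesgue finite_idx])
    fix ij assume "ij \<in> idx N ms"
    from ae[OF this] show "AE z in lebesgue. ennreal (F ij z) = ennreal (g ij z)" by eventually_elim simp
  qed
  also have "\<dots> = (\<integral>\<^sup>+ X. ennreal (1 / real N) ^ k * (\<Sum>\<sigma>\<in>?P. product_volume k ms Cs \<sigma> q e X * ?w X) \<partial>PiM (idx N ms) (\<lambda>_. lebesgue))"
    by (simp add: emeasure_ZdiamEmp[OF C q dim e] sum_distrib_right mult.assoc)
  also have "\<dots> = (\<integral>\<^sup>+ X. ennreal (1 / real N) ^ k * (\<Sum>\<sigma>\<in>?P. product_volume k ms Cs \<sigma> q e X * ?w X) \<partial>PiM (idx N ms) (\<lambda>_. lborel))"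
    by (intro nn_integral_PiM_lebesgue finite_idx borel_measurable_times_ennreal borel_measurable_sum wm pv) auto
  also have "\<dots> = ennreal (1 / real N) ^ k * (\<Sum>\<sigma>\<in>?P. \<integral>\<^sup>+ X. product_volume k ms Cs \<sigma> q e X * ?w X \<partial>PiM (idx N ms) (\<lambda>_. lborel))"
    by (subst nn_integral_cmult, (intro borel_measurable_sum borel_measurable_times_ennreal wm pv, assumption)[1],
        subst nn_integral_sum) (auto intro!: borel_measurable_times_ennreal wm pv)
  finally show ?thesis .
qed

lemma Zdiam_cong_AE:
  assumes "AE x in lebesgue. f x = g x"
  shows "Zdiam p m C f = Zdiam p m C g"
  unfolding Zdiam_def
  using nn_integral_PiM_weight_cong_AE[OF sigma_finite_lebesgue, of "{..<m}" "\<lambda>_ z. ennreal (f z)" "\<lambda>_ z. ennreal (g z)"] assms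
  by (simp add: eventually_mono)

text \<open>The function under the star set is an integral over m points, and its k-th power is an
  integral over k independent copies of them. Fubini moves the hyperplane integral inside, so the
  deterministic volume takes the same form as an expected volume over k m points.\<close>

lemma emeasure_Zdiam:
  fixes g :: "real^'n \<Rightarrow> real"
  assumes C: "sym_convex_body m C" and q: "0 < q" and dim: "q * real k = real CARD('n)" and e: "e \<in> Basis"
    and g[measurable]: "g \<in> borel_measurable borel"
  shows "emeasure lebesgue (Zdiam (- q) m C g) =
    (\<integral>\<^sup>+ X. product_volume k (\<lambda>_. m) (\<lambda>_. C) (\<lambda>l. l) q e X * (\<Prod>ij\<in>idx k (\<lambda>_. m). ennreal (g (X ij))) \<partial>PiM (idx k (\<lambda>_. m)) (\<lambda>_. lborel))"
proof -
  have L: "sigma_finite_measure (lborel :: (real^'n) measure)" ..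
  let ?M = "PiM {..<m} (\<lambda>_. lborel :: (real^'n) measure)" and ?I = "idx k (\<lambda>_. m)"
  let ?MI = "PiM ?I (\<lambda>_. lborel :: (real^'n) measure)"
  interpret M: sigma_finite_measure ?M by (rule sigma_finite_PiM_lborel) simp
  interpret MI: sigma_finite_measure ?MI by (rule sigma_finite_PiM_lborel[OF finite_idx])
  interpret H: sigma_finite_measure "hyp e" by (rule sigma_finite_hyp)
  interpret HI: pair_sigma_finite ?MI "hyp e" ..
  define a where "a x u = powe (supp m C (\<lambda>i. x i \<bullet> u)) (- q)" for x and u :: "real^'n"
  define w where "w x = (\<Prod>i<m. ennreal (g (x i)))" for x
  have wm[measurable]: "w \<in> borel_measurable ?M"
    unfolding w_def by measurable
  have am: "(\<lambda>z. a (f1 z) (f2 z)) \<in> borel_measurable N"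
    if f1: "\<And>i. i < m \<Longrightarrow> (\<lambda>z. f1 z i) \<in> borel_measurable N" and f2: "f2 \<in> borel_measurable N" for f1 f2 and N :: "'z measure"
    unfolding a_def
    by (intro measurable_compose[OF supp_measurable_comp[OF C] powe_measurable] borel_measurable_inner f1 f2)
  have am1: "(\<lambda>x. a x u) \<in> borel_measurable ?M" for u
    by (rule am) auto
  define \<Phi> where "\<Phi> u = (\<integral>\<^sup>+ x. a x u * w x \<partial>?M)" for u
  have Z: "Zdiam (- q) m C g = star_set (\<lambda>u. rho_of q (\<Phi> u))"
  proof -
    have "(\<integral>\<^sup>+ x. a x u * w x \<partial>PiM {..<m} (\<lambda>_. lebesgue)) = \<Phi> u" for u
      unfolding \<Phi>_def by (intro nn_integral_PiM_lebesgue borel_measurable_times_ennreal am1 wm) simp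
    then show ?thesis unfolding Zdiam_def a_def w_def by simp
  qed
  have \<Phi>m: "\<Phi> \<in> borel_measurable borel"
  proof -
    have "(\<lambda>z. a (snd z) (fst z)) \<in> borel_measurable (borel \<Otimes>\<^sub>M ?M)"
      by (rule am) auto
    note [measurable] = this
    show ?thesis unfolding \<Phi>_def[abs_def] by measurable
  qed
  have hom: "\<Phi> (c *\<^sub>R u) = ennreal (\<bar>c\<bar> powr (- q)) * \<Phi> u" if "c \<noteq> 0" for c u
  proof -
    have "a x (c *\<^sub>R u) * w x = ennreal (\<bar>c\<bar> powr (- q)) * (a x u * w x)" for x
      using powe_supp_scaleR[OF C that, of x u "- q"] by (simp add: a_def mult.assoc)
    then show ?thesis unfolding \<Phi>_def using am1 by (simp add: nn_integral_cmult)
  qed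
  have pow: "\<Phi> u ^ k = (\<integral>\<^sup>+ X. (\<Prod>l<k. a (\<lambda>i. X (l, i)) u) * (\<Prod>ij\<in>?I. ennreal (g (X ij))) \<partial>?MI)" for u
  proof -
    have "\<Phi> u ^ k = (\<integral>\<^sup>+ X. (\<Prod>l<k. a (\<lambda>i\<in>{..<m}. X (l, i)) u * w (\<lambda>i\<in>{..<m}. X (l, i))) \<partial>?MI)"
      unfolding \<Phi>_def by (rule nn_integral_power_PiM[OF L]) (intro borel_measurable_times_ennreal am1 wm)
    also have "\<dots> = (\<integral>\<^sup>+ X. (\<Prod>l<k. a (\<lambda>i. X (l, i)) u) * (\<Prod>ij\<in>?I. ennreal (g (X ij))) \<partial>?MI)"
    proof (rule nn_integral_cong)
      fix X :: "nat \<times> nat \<Rightarrow> real^'n"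
      have "a (\<lambda>i\<in>{..<m}. X (l, i)) u = a (\<lambda>i. X (l, i)) u" for l
        unfolding a_def by (intro arg_cong[where f="\<lambda>h. powe h (- q)"] supp_cong) simp
      moreover have "(\<Prod>l<k. w (\<lambda>i\<in>{..<m}. X (l, i))) = (\<Prod>ij\<in>?I. ennreal (g (X ij)))"
      proof -
        have "?I = {..<k} \<times> {..<m}" by (auto simp: idx_def)
        then show ?thesis by (simp add: w_def prod.cartesian_product)
      qed
      ultimately show "(\<Prod>l<k. a (\<lambda>i\<in>{..<m}. X (l, i)) u * w (\<lambda>i\<in>{..<m}. X (l, i))) = (\<Prod>l<k. a (\<lambda>i. X (l, i)) u) * (\<Prod>ij\<in>?I. ennreal (g (X ij)))"
        by (simp add: prod.distrib)
    qed
    finally show ?thesis .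
  qed
  let ?A = "\<lambda>X v. \<Prod>l<k. a (\<lambda>i. X (l, i)) (e + emb e v)" and ?W = "\<lambda>X. \<Prod>ij\<in>?I. ennreal (g (X ij))"
  have Am: "(\<lambda>z. ?A (fst z) (snd z)) \<in> borel_measurable (?MI \<Otimes>\<^sub>M hyp e)"
  proof (intro borel_measurable_prod_ennreal am)
    fix l i assume "l \<in> {..<k}" "i < m"
    then have [measurable]: "(l, i) \<in> ?I" by (simp add: idx_def)
    show "(\<lambda>z. fst z (l, i)) \<in> borel_measurable (?MI \<Otimes>\<^sub>M hyp e)" by measurable
  qed measurable
  have Wm[measurable]: "?W \<in> borel_measurable ?MI"
  proof (rule borel_measurable_prod_ennreal)
    fix ij assume j[measurable]: "ij \<in> ?I"
    show "(\<lambda>x. ennreal (g (x ij))) \<in> borel_measurable ?MI" by measurable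
  qed
  have "emeasure lebesgue (Zdiam (- q) m C g) = ennreal (2 / real CARD('n)) * (\<integral>\<^sup>+ v. \<Phi> (e + emb e v) ^ k \<partial>hyp e)"
    unfolding Z by (rule emeasure_star_set[OF e q dim \<Phi>m hom])
  also have "(\<integral>\<^sup>+ v. \<Phi> (e + emb e v) ^ k \<partial>hyp e) = (\<integral>\<^sup>+ v. (\<integral>\<^sup>+ X. ?A X v * ?W X \<partial>?MI) \<partial>hyp e)"
    by (simp only: pow)
  also have "\<dots> = (\<integral>\<^sup>+ X. (\<integral>\<^sup>+ v. ?A X v * ?W X \<partial>hyp e) \<partial>?MI)"
    by (rule HI.Fubini') (use Am in \<open>simp add: case_prod_beta'\<close>)
  also have "\<dots> = (\<integral>\<^sup>+ X. (\<integral>\<^sup>+ v. ?A X v \<partial>hyp e) * ?W X \<partial>?MI)"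
  proof (rule nn_integral_cong)
    fix X assume X: "X \<in> space ?MI"
    have "(\<lambda>v. ?A X v) \<in> borel_measurable (hyp e)"
      using measurable_compose[OF measurable_Pair1'[OF X] Am] by simp
    then show "(\<integral>\<^sup>+ v. ?A X v * ?W X \<partial>hyp e) = (\<integral>\<^sup>+ v. ?A X v \<partial>hyp e) * ?W X" by (rule nn_integral_multc)
  qed
  also have "ennreal (2 / real CARD('n)) * \<dots> = (\<integral>\<^sup>+ X. ennreal (2 / real CARD('n)) * ((\<integral>\<^sup>+ v. ?A X v \<partial>hyp e) * ?W X) \<partial>?MI)"
  proof (rule nn_integral_cmult[symmetric])
    have "(\<lambda>X. \<integral>\<^sup>+ v. ?A X v \<partial>hyp e) \<in> borel_measurable ?MI"
      by (rule H.borel_measurable_nn_integral) (use Am in \<open>simp add: case_prod_beta'\<close>)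
    then show "(\<lambda>X. (\<integral>\<^sup>+ v. ?A X v \<partial>hyp e) * ?W X) \<in> borel_measurable ?MI" using Wm by measurable
  qed
  finally show ?thesis unfolding product_volume_def a_def by (simp add: mult.assoc)
qed

theorem theorem2p3:
  fixes dummy :: "real^'n"
  shows "(\<forall>(f :: real^'n \<Rightarrow> real) m C p.
            f \<in> Pn \<and> m \<ge> 1 \<and> sym_convex_body m C \<and> -1 < p \<and> p < 0
            \<and> real CARD('n) / \<bar>p\<bar> \<in> \<nat>
        \<longrightarrow> emeasure lebesgue (Zdiam p m C f) \<le> emeasure lebesgue (Zdiam p m C (sym_rearr f)))
       \<and> (\<forall>N ms Cs (F :: nat \<times> nat \<Rightarrow> real^'n \<Rightarrow> real) p.
            N > CARD('n) \<and> (\<forall>ij\<in>idx N ms. F ij \<in> Pn)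
            \<and> (\<forall>i<N. ms i \<ge> CARD('n) + 1 \<and> sym_convex_body (ms i) (Cs i))
            \<and> -1 \<le> p \<and> p < 0 \<and> real CARD('n) / \<bar>p\<bar> \<in> \<nat>
        \<longrightarrow> EvolEmp p N ms Cs F \<le> EvolEmp p N ms Cs (\<lambda>ij. sym_rearr (F ij)))"
proof (intro conjI allI impI; elim conjE)
  obtain e :: "real^'n" where e: "e \<in> Basis" using nonempty_Basis by blast
  {
    fix f :: "real^'n \<Rightarrow> real" and m C and p :: real
    assume f: "f \<in> Pn" and C: "sym_convex_body m C" and p: "p < 0" and "real CARD('n) / \<bar>p\<bar> \<in> \<nat>"
    then obtain k where k: "real CARD('n) / \<bar>p\<bar> = real k" by (auto simp: Nats_def)
    define q where "q = - p"
    have q: "0 < q" "p = - q" and dim: "q * real k = real CARD('n)"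
      using p k by (auto simp: q_def field_simps)
    obtain g where g: "g \<in> borel_measurable borel" "\<forall>x. 0 \<le> g x" "AE x in lebesgue. f x = g x"
      "(\<integral>\<^sup>+ x. ennreal (g x) \<partial>lborel) < \<infinity>" "\<exists>M. AE x in lborel. g x \<le> M" "sym_rearr f = sym_rearr g"
      using Pn_borel_version[OF f] .
    have "emeasure lebesgue (Zdiam p m C f) = emeasure lebesgue (Zdiam (- q) m C g)"
      unfolding q(2) using Zdiam_cong_AE[OF g(3)] by simp
    also have "\<dots> \<le> emeasure lebesgue (Zdiam (- q) m C (sym_rearr g))"
      unfolding emeasure_Zdiam[OF C q(1) dim e g(1)] emeasure_Zdiam[OF C q(1) dim e sym_rearr_measurable[OF g(1)]]
      \<comment> \<open>Here there are k bodies, all equal to \<open>C\<close>, the selection is the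
        identity, and all k m points carry the same density \<open>g\<close>.\<close>
      by (rule nn_integral_product_volume_rearrange[OF _ _ q(1) dim e]) (use C g in auto)
    finally show "emeasure lebesgue (Zdiam p m C f) \<le> emeasure lebesgue (Zdiam p m C (sym_rearr f))"
      unfolding q(2) g(6) .
  }
  {
    fix N ms Cs and F :: "nat \<times> nat \<Rightarrow> real^'n \<Rightarrow> real" and p :: real
    assume F: "\<forall>ij\<in>idx N ms. F ij \<in> Pn" and "\<forall>i<N. ms i \<ge> CARD('n) + 1 \<and> sym_convex_body (ms i) (Cs i)"
      and p: "p < 0" and "real CARD('n) / \<bar>p\<bar> \<in> \<nat>"
    then obtain k where k: "real CARD('n) / \<bar>p\<bar> = real k" and C: "\<And>i. i < N \<Longrightarrow> sym_convex_body (ms i) (Cs i)"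
      by (auto simp: Nats_def)
    define q where "q = - p"
    have q: "0 < q" "p = - q" and dim: "q * real k = real CARD('n)"
      using p k by (auto simp: q_def field_simps)
    define good where "good ij g \<longleftrightarrow> g \<in> borel_measurable borel \<and> (\<forall>x. 0 \<le> g x) \<and> (AE x in lebesgue. F ij x = g x)
      \<and> (\<integral>\<^sup>+ x. ennreal (g x) \<partial>lborel) < \<infinity> \<and> (\<exists>M. AE x in lborel. g x \<le> M) \<and> sym_rearr (F ij) = sym_rearr g" for ij g
    have "\<exists>g. good ij g" if "ij \<in> idx N ms" for ij
      by (rule Pn_borel_version[of "F ij"]) (use F that in \<open>auto simp: good_def\<close>)
    then obtain g where "\<And>ij. ij \<in> idx N ms \<Longrightarrow> good ij (g ij)" by metis
    then have g: "\<And>ij. ij \<in> idx N ms \<Longrightarrow> g ij \<in> borel_measurable borel" "\<And>ij x. ij \<in> idx N ms \<Longrightarrow> 0 \<le> g ij x"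
      "\<And>ij. ij \<in> idx N ms \<Longrightarrow> AE x in lebesgue. F ij x = g ij x" "\<And>ij. ij \<in> idx N ms \<Longrightarrow> (\<integral>\<^sup>+ x. ennreal (g ij x) \<partial>lborel) < \<infinity>"
      "\<And>ij. ij \<in> idx N ms \<Longrightarrow> \<exists>M. AE x in lborel. g ij x \<le> M" "\<And>ij. ij \<in> idx N ms \<Longrightarrow> sym_rearr (F ij) = sym_rearr (g ij)"
      unfolding good_def by blast+
    let ?P = "PiE {..<k} (\<lambda>_. {..<N})"
    let ?J = "\<lambda>\<sigma> w. \<integral>\<^sup>+ X. product_volume k ms Cs \<sigma> q e X * (\<Prod>ij\<in>idx N ms. ennreal (w ij (X ij))) \<partial>PiM (idx N ms) (\<lambda>_. lborel)"
    have "EvolEmp p N ms Cs F = ennreal (1 / real N) ^ k * (\<Sum>\<sigma>\<in>?P. ?J \<sigma> g)"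
      unfolding q(2) by (rule EvolEmp_eq[OF C q(1) dim e g(1) g(3)])
    also have "\<dots> \<le> ennreal (1 / real N) ^ k * (\<Sum>\<sigma>\<in>?P. ?J \<sigma> (\<lambda>ij. sym_rearr (g ij)))"
    \<comment> \<open>Each selection \<open>\<sigma>\<close> satisfies the inequality separately,
      for the full set of points, including those that its factors do not read.\<close>
    proof (intro mult_left_mono sum_mono)
      fix \<sigma> assume "\<sigma> \<in> ?P"
      then have \<sigma>: "\<sigma> l < N" if "l < k" for l using that by (auto simp: PiE_iff)
      show "?J \<sigma> g \<le> ?J \<sigma> (\<lambda>ij. sym_rearr (g ij))"
        by (rule nn_integral_product_volume_rearrange[OF \<sigma> C q(1) dim e g(1) g(2) g(4) g(5)])
    qed simp
    also have "\<dots> = EvolEmp p N ms Cs (\<lambda>ij. sym_rearr (F ij))"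
      unfolding q(2)
      by (rule EvolEmp_eq[OF C q(1) dim e, symmetric]) (use g in \<open>auto intro: sym_rearr_measurable\<close>)
    finally show "EvolEmp p N ms Cs F \<le> EvolEmp p N ms Cs (\<lambda>ij. sym_rearr (F ij))" .
  }
qed

end
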